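(* Let $n,m\ge1$ and let $\mu$ be a positive measure on the bi-circle $\mathbb{T}^2$ whose functional $\mathcal L(f)=(\frac1{2\pi})^2\int_{\mathbb{T}^2}f\,d\mu$ is positive definite, with coefficients $\mathcal K_{i,j},\hat E_{i,j},\hat{\tilde E}_{i,j}$ and parameters $u_{i,j}$ as defined in the context. Then $\mu$ is purely absolutely continuous with respect to Lebesgue measure with $$d\mu=\frac{d\theta\,d\phi}{|p_{n,m}(e^{i\theta},e^{i\phi})|^2},$$ where $p_{n,m}$ is a polynomial of degree $(n,m)$ with $\overleftarrow p_{n,m}$ stable, if and only if (a) $\mathcal K_{n,j}=0$, $\hat{\tilde E}_{n-1,j+1}=0$ and $u_{n,j+1}=0$ for all $j\ge m$; (b) $\mathcal K_{i,m}=0$, $\hat E_{i,m-1}=0$ and $u_{i,m}=0$ for all $i>n$; (c) $u_{i,j}=0$ and $u_{-i,j}=0$ for all $i>n$, $j>m$.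
   Context: For a (matrix valued) Laurent polynomial $Q$, $Q^\dagger(z,w)=Q(1/\bar z,1/\bar w)^\dagger$; $\mathcal L$ is applied entrywise and $\langle X,Y\rangle=\mathcal L(XY^\dagger)$. $\mathcal L$ is positive definite if $\mathcal L(pp^\dagger)>0$ for every nonzero polynomial $p(z,w)$; $z=e^{i\theta}$, $w=e^{i\phi}$. Lexicographic orthonormal polynomials: for $a,b\ge0$, $0\le l\le b$, $\phi^l_{a,b}$ is the unique element of $\mathrm{span}(\{z^iw^j:0\le i<a,0\le j\le b\}\cup\{z^aw^j:0\le j\le l\})$ with positive coefficient of $z^aw^l$, norm one, orthogonal to all of these monomials except $z^aw^l$; $\Phi_{a,b}=[\phi^b_{a,b},\dots,\phi^0_{a,b}]^T$. Reverse lexicographic: for $0\le l\le a$, $\tilde\phi^l_{a,b}$ is the unique element of $\mathrm{span}(\{z^iw^j:0\le i\le a,0\le j<b\}\cup\{z^iw^b:0\le i\le l\})$ with positive coefficient of $z^lw^b$, norm one, orthogonal to all of these monomials except $z^lw^b$; $\tilde\Phi_{a,b}=[\tilde\phi^a_{a,b},\dots,\tilde\phi^0_{a,b}]^T$. Reversals are the row vectors $\overleftarrow\Phi_{a,b}(z,w)=z^aw^b\Phi_{a,b}(1/\bar z,1/\bar w)^\dagger$, $\overleftarrow{\tilde\Phi}_{a,b}(z,w)=z^aw^b\tilde\Phi_{a,b}(1/\bar z,1/\bar w)^\dagger$. Coefficients: $\hat E_{i,j}=\langle z\Phi_{i-1,j},\overleftarrow\Phi_{i-1,j}^T\rangle$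 ($i\ge1$), $\hat{\tilde E}_{i,j}=\langle w\tilde\Phi_{i,j-1},\overleftarrow{\tilde\Phi}_{i,j-1}^T\rangle$ ($j\ge1$), $\mathcal K_{i,j}=\langle\Phi_{i,j-1},\tilde\Phi_{i-1,j}\rangle$ and $\mathcal K^1_{i,j}=\langle w\Phi_{i,j-1},\overleftarrow{\tilde\Phi}_{i-1,j}^T\rangle$ ($i,j\ge1$; both are $j\times i$ matrices). Parameters, for $i,j\ge1$: $u_{i,j}=\overline{(\mathcal K^1_{i,j})_{1,1}}$; $u_{-1,1}=\mathcal K_{1,1}$, and for $(i,j)\neq(1,1)$, $u_{-i,j}$ is the bottom right entry of $(\Phi^{j-1}_{i,i})^{-1}\mathcal K_{i,j}((\tilde\Phi^{i-1}_{j,j})^\dagger)^{-1}$. Here $\Phi^b_{a,a}$ is the matrix with $\Phi_{a,b}=z^a\Phi^b_{a,a}[w^b,\dots,1]^T+$ lower powers of $z$, and $\tilde\Phi^a_{b,b}$ is the matrix with $\tilde\Phi_{a,b}=w^b\tilde\Phi^a_{b,b}[z^a,\dots,1]^T+$ lower powers of $w$ (both invertible). A polynomial $p=\sum_{i=0}^n\sum_{j=0}^mk_{i,j}z^iw^j$ has degree $(n,m)$ if $k_{n,m}\ne0$; then $\overleftarrow p(z,w)=z^nw^m\overline{p(1/\bar z,1/\bar w)}$. A polynomial is stable if it has no zeros in $|z|\le1,|w|\le1$. *)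

theory Defs
  imports
    "HOL-Analysis.Analysis"
    "HOL-Library.Poly_Mapping"
    "HOL-Library.Complex_Order"
    "Jordan_Normal_Form.Gauss_Jordan_Elimination"
    "Jordan_Normal_Form.Schur_Decomposition"
begin

text \<open>
  A Laurent polynomial in \<open>z, w\<close> is an element of the group algebra of \<open>int \<times> int\<close>: the
  coefficient of \<open>z\<^sup>i w\<^sup>j\<close> is its value at \<open>(i, j)\<close>, and multiplication is convolution.
  Matrix-valued Laurent polynomials are matrices over this ring.
\<close>

type_synonym laurent = "(int \<times> int) \<Rightarrow>\<^sub>0 complex"

abbreviation coeff2 :: "laurent \<Rightarrow> nat \<Rightarrow> nat \<Rightarrow> complex" where
  "coeff2 p i j \<equiv> Poly_Mapping.lookup p (int i, int j)"

abbreviation monom2 :: "nat \<Rightarrow> nat \<Rightarrow> laurent" where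
  "monom2 i j \<equiv> Poly_Mapping.single (int i, int j) 1"

text \<open>
  Evaluation. Terms with a negative exponent are meaningful only at nonzero arguments;
  for polynomials the value is the usual one everywhere, since \<open>0 powi 0 = 1\<close>.
\<close>

definition leval :: "laurent \<Rightarrow> complex \<times> complex \<Rightarrow> complex" where
  "leval Q = (\<lambda>(z, w). \<Sum>(i, j)\<in>Poly_Mapping.keys Q. Poly_Mapping.lookup Q (i, j) * z powi i * w powi j)"

text \<open>
  The adjoint \<open>cnj (Q (1 / cnj z, 1 / cnj w))\<close>: its coefficient of \<open>z\<^sup>i w\<^sup>j\<close> is the conjugate
  of the coefficient of \<open>z\<close> to the \<open>-i\<close> times \<open>w\<close> to the \<open>-j\<close> in \<open>Q\<close>.
\<close>

definition ladj :: "laurent \<Rightarrow> laurent" where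
  "ladj Q = (\<Sum>(i, j)\<in>Poly_Mapping.keys Q. Poly_Mapping.single (- i, - j) (cnj (Poly_Mapping.lookup Q (i, j))))"

definition mat_ladj :: "laurent mat \<Rightarrow> laurent mat" where
  "mat_ladj X = map_mat ladj (transpose_mat X)"

definition bicircle :: "(complex \<times> complex) set" where
  "bicircle = sphere 0 1 \<times> sphere 0 1"

definition bicircle_lebesgue :: "(complex \<times> complex) measure" where
  "bicircle_lebesgue =
     distr (restrict_space lborel ({0..<2*pi} \<times> {0..<2*pi})) (restrict_space borel bicircle)
       (\<lambda>(\<theta>, \<phi>). (cis \<theta>, cis \<phi>))"

definition bicircle_measure :: "(complex \<times> complex) measure \<Rightarrow> bool" where
  "bicircle_measure \<mu> \<longleftrightarrow> finite_measure \<mu> \<and> sets \<mu> = sets (restrict_space borel bicircle)"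

definition Lfun :: "(complex \<times> complex) measure \<Rightarrow> laurent \<Rightarrow> complex" where
  "Lfun \<mu> f = complex_of_real ((1 / (2*pi))\<^sup>2) * (LINT x|\<mu>. leval f x)"

text \<open>\<open>c > 0\<close> for complex \<open>c\<close> means that \<open>c\<close> is real and positive.\<close>

definition positive_definite :: "(laurent \<Rightarrow> complex) \<Rightarrow> bool" where
  "positive_definite L \<longleftrightarrow>
     (\<forall>p. Poly_Mapping.keys p \<subseteq> {0..} \<times> {0..} \<and> p \<noteq> 0 \<longrightarrow> L (p * ladj p) > 0)"

definition mat_inner :: "(laurent \<Rightarrow> complex) \<Rightarrow> laurent mat \<Rightarrow> laurent mat \<Rightarrow> complex mat" where
  "mat_inner L X Y = map_mat L (X * mat_ladj Y)"

text \<open>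
  The element of the span of the monomials \<open>z\<^sup>i w\<^sup>j\<close>, \<open>(i, j) \<in> S\<close>, that has norm one, positive
  coefficient at \<open>k\<close>, and is orthogonal to all these monomials except the one at \<open>k\<close>. It exists
  and is unique when \<open>L\<close> is positive definite and \<open>S\<close> is a finite set of nonnegative exponents
  containing \<open>k\<close>.
\<close>

definition orthopoly :: "(laurent \<Rightarrow> complex) \<Rightarrow> (nat \<times> nat) set \<Rightarrow> nat \<times> nat \<Rightarrow> laurent" where
  "orthopoly L S = (\<lambda>(k, l). THE p.
     Poly_Mapping.keys p \<subseteq> (\<lambda>(i, j). (int i, int j)) ` S \<and>
     coeff2 p k l > 0 \<and>
     L (p * ladj p) = 1 \<and>
     (\<forall>(i, j)\<in>S - {(k, l)}. L (p * ladj (monom2 i j)) = 0))"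

definition phi :: "(laurent \<Rightarrow> complex) \<Rightarrow> nat \<Rightarrow> nat \<Rightarrow> nat \<Rightarrow> laurent" where
  "phi L a b l = orthopoly L ({0..<a} \<times> {0..b} \<union> {a} \<times> {0..l}) (a, l)"

definition phi_rev :: "(laurent \<Rightarrow> complex) \<Rightarrow> nat \<Rightarrow> nat \<Rightarrow> nat \<Rightarrow> laurent" where
  "phi_rev L a b l = orthopoly L ({0..a} \<times> {0..<b} \<union> {0..l} \<times> {b}) (l, b)"

text \<open>Column vectors, as one-column matrices; row \<open>r\<close> (from 0) holds the polynomial of index \<open>b - r\<close>
  respectively \<open>a - r\<close>.\<close>

definition Phi :: "(laurent \<Rightarrow> complex) \<Rightarrow> nat \<Rightarrow> nat \<Rightarrow> laurent mat" where
  "Phi L a b = Matrix.mat (b + 1) 1 (\<lambda>(r, _). phi L a b (b - r))"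

definition Phi_rev :: "(laurent \<Rightarrow> complex) \<Rightarrow> nat \<Rightarrow> nat \<Rightarrow> laurent mat" where
  "Phi_rev L a b = Matrix.mat (a + 1) 1 (\<lambda>(r, _). phi_rev L a b (a - r))"

text \<open>The reversal \<open>z\<^sup>a w\<^sup>b X (1 / cnj z, 1 / cnj w)\<^sup>\<dagger>\<close>, which turns column vectors into row vectors.\<close>

definition reversal :: "nat \<Rightarrow> nat \<Rightarrow> laurent mat \<Rightarrow> laurent mat" where
  "reversal a b X = monom2 a b \<cdot>\<^sub>m mat_ladj X"

definition E_hat :: "(laurent \<Rightarrow> complex) \<Rightarrow> nat \<Rightarrow> nat \<Rightarrow> complex mat" where
  "E_hat L i j = mat_inner L (monom2 1 0 \<cdot>\<^sub>m Phi L (i - 1) j)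
     (transpose_mat (reversal (i - 1) j (Phi L (i - 1) j)))"

definition E_hat_rev :: "(laurent \<Rightarrow> complex) \<Rightarrow> nat \<Rightarrow> nat \<Rightarrow> complex mat" where
  "E_hat_rev L i j = mat_inner L (monom2 0 1 \<cdot>\<^sub>m Phi_rev L i (j - 1))
     (transpose_mat (reversal i (j - 1) (Phi_rev L i (j - 1))))"

definition K_mat :: "(laurent \<Rightarrow> complex) \<Rightarrow> nat \<Rightarrow> nat \<Rightarrow> complex mat" where
  "K_mat L i j = mat_inner L (Phi L i (j - 1)) (Phi_rev L (i - 1) j)"

definition K1_mat :: "(laurent \<Rightarrow> complex) \<Rightarrow> nat \<Rightarrow> nat \<Rightarrow> complex mat" where
  "K1_mat L i j = mat_inner L (monom2 0 1 \<cdot>\<^sub>m Phi L i (j - 1))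
     (transpose_mat (reversal (i - 1) j (Phi_rev L (i - 1) j)))"

text \<open>
  The leading coefficient matrices: \<open>lead_mat L a b\<close> is the matrix \<open>A\<close> such that
  \<open>Phi L a b = z\<^sup>a A [w\<^sup>b, \<dots>, 1]\<^sup>T\<close> plus lower powers of \<open>z\<close>, and \<open>lead_mat_rev L a b\<close> is the
  matrix \<open>A\<close> such that \<open>Phi_rev L a b = w\<^sup>b A [z\<^sup>a, \<dots>, 1]\<^sup>T\<close> plus lower powers of \<open>w\<close>.
\<close>

definition lead_mat :: "(laurent \<Rightarrow> complex) \<Rightarrow> nat \<Rightarrow> nat \<Rightarrow> complex mat" where
  "lead_mat L a b = Matrix.mat (b + 1) (b + 1) (\<lambda>(r, c). coeff2 (Phi L a b $$ (r, 0)) a (b - c))"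

definition lead_mat_rev :: "(laurent \<Rightarrow> complex) \<Rightarrow> nat \<Rightarrow> nat \<Rightarrow> complex mat" where
  "lead_mat_rev L a b = Matrix.mat (a + 1) (a + 1) (\<lambda>(r, c). coeff2 (Phi_rev L a b $$ (r, 0)) (a - c) b)"

text \<open>For \<open>i, j \<ge> 1\<close>: \<open>u_pos L i j\<close> is \<open>u\<^bsub>i,j\<^esub>\<close> and \<open>u_neg L i j\<close> is \<open>u\<^bsub>-i,j\<^esub>\<close>.\<close>

definition u_pos :: "(laurent \<Rightarrow> complex) \<Rightarrow> nat \<Rightarrow> nat \<Rightarrow> complex" where
  "u_pos L i j = cnj (K1_mat L i j $$ (0, 0))"

definition u_neg :: "(laurent \<Rightarrow> complex) \<Rightarrow> nat \<Rightarrow> nat \<Rightarrow> complex" where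
  "u_neg L i j =
     (if (i, j) = (1, 1) then K_mat L 1 1 $$ (0, 0)
      else (the (mat_inverse (lead_mat L i (j - 1))) * K_mat L i j *
            the (mat_inverse (mat_adjoint (lead_mat_rev L (i - 1) j)))) $$ (j - 1, i - 1))"

definition has_degree :: "laurent \<Rightarrow> nat \<Rightarrow> nat \<Rightarrow> bool" where
  "has_degree p n m \<longleftrightarrow>
     Poly_Mapping.keys p \<subseteq> {0..int n} \<times> {0..int m} \<and> coeff2 p n m \<noteq> 0"

definition poly_reversal :: "nat \<Rightarrow> nat \<Rightarrow> laurent \<Rightarrow> laurent" where
  "poly_reversal n m p = monom2 n m * ladj p"

definition bidisk_stable :: "laurent \<Rightarrow> bool" where
  "bidisk_stable p \<longleftrightarrow> (\<forall>z w. norm z \<le> 1 \<and> norm w \<le> 1 \<longrightarrow> leval p (z, w) \<noteq> 0)"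

end

theory Submission
  imports Defs "HOL-Complex_Analysis.Cauchy_Integral_Formula"
begin

text \<open>
  Read the Laurent polynomials with the inner product \<open>L (f * ladj g)\<close> as a stationary Gaussian field on
  \<open>int \<times> int\<close>. Then \<open>K\<^bsub>i,j\<^esub> = 0\<close> and the vanishing of the other coefficients say that certain sets of
  monomials are conditionally independent given the monomials of a rectangle, and the rules of
  conditional independence (symmetry, weak union, contraction), translations and reflections propagate (a), (b), (c) to
  all \<open>K\<^bsub>i,j\<^esub>\<close> and all reflection coefficients beyond \<open>(n, m)\<close>. Consequently \<open>p = \<phi>\<^sup>m\<^bsub>n,m\<^esub>\<close> is orthogonal to every
  \<open>z\<^sup>k w\<^sup>l\<close> with \<open>k < n\<close> or \<open>l < m\<close>, so all moments of \<open>|p|\<^sup>2 d\<mu>\<close> are those of Lebesgue measure. The reversal of \<open>p\<close>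
  is stable because \<open>K\<^bsub>n,m\<^esub> = 0\<close> yields a Christoffel--Darboux formula with two positive terms.

  Conversely, for \<open>d\<mu> = d\<theta> d\<phi> / |p|\<^sup>2\<close> with stable reversal, Cauchy's theorem gives the same orthogonality
  of \<open>p\<close>. The Gram matrix of a strip \<open>0 \<le> k < n\<close> then has a banded inverse, explicitly given by \<open>p\<close>, which
  together with the decay of the Fourier coefficients is the Markov property expressed by the vanishing
  coefficients.
\<close>

subsection \<open>Laurent polynomials\<close>

text \<open>Condition (c) prescribes two scalars per index, whereas whole matrices have to vanish.
  The gap closes because in the conditional independence behind \<open>K_mat\<close> all pairs of
  monomials except one corner pair follow from smaller indices, and that pair is u_{-i,j}; behind
  \<open>E_hat\<close> and \<open>E_hat_rev\<close> two corner pairs remain, governed by u_{i,j} and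
  u_{-i,j}. Conditions (a) and (b) are the initial column and row of this induction.

  Stability must hold on the closed bidisk. On the torus both positive terms of the
  Christoffel-Darboux formula lose their weights 1 - |z|^2 and 1 - |w|^2, so the formula has to be
  used there as an identity of polynomials: divisibility by a linear factor and the definiteness of
  \<open>L\<close> take over from positivity.

  In the converse, the polynomials z^a w^b p all belong to the same weight, so whatever is proved at
  degree (n, m) holds at all larger degrees. Most mirror statements are obtained by exchanging z and
  w.\<close>

abbreviation exps :: "laurent \<Rightarrow> (int \<times> int) set" where
  "exps \<equiv> Poly_Mapping.keys"

abbreviation coef :: "laurent \<Rightarrow> int \<times> int \<Rightarrow> complex" where
  "coef \<equiv> Poly_Mapping.lookup"

abbreviation mon :: "int \<times> int \<Rightarrow> laurent" where
  "mon a \<equiv> Poly_Mapping.single a 1"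

abbreviation cst :: "complex \<Rightarrow> laurent" where
  "cst c \<equiv> Poly_Mapping.single 0 c"

lemma lookup_mon_mult [simp]: "coef (mon a * p) b = coef (p::laurent) (b - a)"
proof -
  have "b = a + q \<longleftrightarrow> b - a = q" for q by (simp add: diff_eq_eq add.commute)
  then show ?thesis by (simp add: lookup_mult lookup_single when_mult)
qed

lemma lookup_cst_mult [simp]: "coef (cst c * p) b = c * coef (p::laurent) b"
  by (simp add: lookup_mult lookup_single when_mult)

lemma keys_mon_mult: "exps (mon a * p) = (+) a ` exps (p::laurent)"
proof (intro equalityI subsetI)
  fix b assume "b \<in> exps (mon a * p)"
  then have "b - a \<in> exps p" by (simp add: in_keys_iff)
  then show "b \<in> (+) a ` exps p" by (intro image_eqI[of _ _ "b - a"]) auto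
qed (auto simp: in_keys_iff)

lemma keys_cst_mult: "exps (cst c * p) \<subseteq> exps (p::laurent)"
  by (auto simp: in_keys_iff)

lemma laurent_expand:
  fixes p :: laurent
  assumes "finite S" "exps p \<subseteq> S"
  shows "p = (\<Sum>a\<in>S. cst (coef p a) * mon a)"
proof (rule poly_mapping_eqI)
  fix k
  have "coef (\<Sum>a\<in>S. cst (coef p a) * mon a) k
     = (\<Sum>a\<in>S. if a = k then coef p a else 0)"
    by (simp add: lookup_sum lookup_single when_def if_distrib cong: if_cong)
  also have "\<dots> = coef p k"
    using assms by (auto simp: sum.delta in_keys_iff)
  finally show "coef p k = coef (\<Sum>a\<in>S. cst (coef p a) * mon a) k" by simp
qed

lemma laurent_induct [case_names monom add]:
  fixes p :: laurent
  assumes "\<And>c a. P (cst c * mon a)" "\<And>p q. P p \<Longrightarrow> P q \<Longrightarrow> P (p + q)"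
  shows "P p"
proof -
  have "P (\<Sum>a\<in>S. cst (coef p a) * mon a)" if "finite S" for S
    using that
  proof (induction S)
    case empty
    show ?case using assms(1)[of 0 0] by simp
  next
    case (insert x F)
    then show ?case by (simp add: assms)
  qed
  from this[of "exps p"] show ?thesis
    by (subst laurent_expand[of "exps p"]) auto
qed

lemma lookup_ladj [simp]: "coef (ladj p) a = cnj (coef p (- a))"
proof (cases a)
  case (Pair i j)
  have "coef (ladj p) a = (\<Sum>b\<in>exps p. if b = - a then cnj (coef p b) else 0)"
    unfolding ladj_def lookup_sum
    by (rule sum.cong) (auto simp: lookup_single when_def Pair split: if_splits)
  also have "\<dots> = cnj (coef p (- a))"
    by (auto simp: sum.delta in_keys_iff)
  finally show ?thesis .
qed

lemma ladj_add: "ladj (p + q) = ladj p + ladj q"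
  by (rule poly_mapping_eqI) (simp add: lookup_add)

lemma ladj_zero [simp]: "ladj 0 = 0"
  by (rule poly_mapping_eqI) simp

lemma ladj_ladj [simp]: "ladj (ladj p) = p"
  by (rule poly_mapping_eqI) simp

lemma ladj_sum: "ladj (sum f A) = (\<Sum>x\<in>A. ladj (f x))"
  by (induction A rule: infinite_finite_induct) (auto simp: ladj_add)

lemma ladj_single: "ladj (Poly_Mapping.single a c) = Poly_Mapping.single (- a) (cnj c)"
proof (rule poly_mapping_eqI)
  fix b
  have "a = - b \<longleftrightarrow> - a = b" by (rule equation_minus_iff[THEN trans]) (simp add: eq_commute)
  then show "coef (ladj (Poly_Mapping.single a c)) b = coef (Poly_Mapping.single (- a) (cnj c)) b"
    by (simp add: lookup_single when_def)
qed

lemma single_mult: "Poly_Mapping.single a c * p = cst c * (mon a * p :: laurent)"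
proof -
  have "cst c * mon a = Poly_Mapping.single a c"
    by (simp only: mult_single add_0 mult_1_right)
  then show ?thesis by (metis mult.assoc)
qed

lemma ladj_mult_single: "ladj (Poly_Mapping.single a c * p) = Poly_Mapping.single (- a) (cnj c) * ladj p"
proof (rule poly_mapping_eqI)
  fix b
  show "coef (ladj (Poly_Mapping.single a c * p)) b =
      coef (Poly_Mapping.single (- a) (cnj c) * ladj p) b"
    unfolding single_mult[of a c p] single_mult[of "- a" "cnj c" "ladj p"] by simp
qed

lemma ladj_mult: "ladj (p * q) = ladj p * ladj q"
proof (induction p rule: laurent_induct)
  case (monom c a)
  then show ?case by (simp only: mult_single ladj_mult_single ladj_single)
next
  case (add p1 p2)
  then show ?case by (simp add: ladj_add distrib_right)
qed

lemma keys_ladj: "exps (ladj p) = uminus ` exps p"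
proof (intro equalityI subsetI)
  fix b assume "b \<in> exps (ladj p)"
  then have "- b \<in> exps p" by (simp add: in_keys_iff)
  then show "b \<in> uminus ` exps p" by (intro image_eqI[of _ _ "- b"]) auto
qed (auto simp: in_keys_iff)

lemma keys_subset_add: "exps p \<subseteq> S \<Longrightarrow> exps q \<subseteq> S \<Longrightarrow> exps (p + q :: laurent) \<subseteq> S"
  using keys_add[of p q] by blast

lemma keys_subset_cst: "exps p \<subseteq> S \<Longrightarrow> exps (cst c * p :: laurent) \<subseteq> S"
  using keys_cst_mult by blast

lemma keys_subset_diff: "exps p \<subseteq> S \<Longrightarrow> exps q \<subseteq> S \<Longrightarrow> exps (p - q :: laurent) \<subseteq> S"
  using keys_subset_add[of p S "cst (- 1) * q"] keys_subset_cst[of q S "- 1"]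
  by (simp add: single_uminus)

lemma keys_subset_sum: "(\<And>x. x \<in> A \<Longrightarrow> exps (f x) \<subseteq> S) \<Longrightarrow> exps (sum f A :: laurent) \<subseteq> S"
  by (induction A rule: infinite_finite_induct) (auto simp: keys_subset_add)

lemma keys_subset_mon: "exps p \<subseteq> S \<Longrightarrow> (\<And>b. b \<in> S \<Longrightarrow> a + b \<in> T) \<Longrightarrow> exps (mon a * p :: laurent) \<subseteq> T"
  by (auto simp: keys_mon_mult)

lemma lookup_outside: "exps p \<subseteq> S \<Longrightarrow> a \<notin> S \<Longrightarrow> coef p a = 0"
  by (auto simp: in_keys_iff)

subsection \<open>Positive definite functionals\<close>

text \<open>Positivity is demanded of all Laurent polynomials, so every finite set of exponents in
  the plane may serve as a conditioning set, and translations are isometries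
  (\<open>ip_mon\<close>).\<close>

locale pd_form =
  fixes L :: "laurent \<Rightarrow> complex"
  assumes L_add: "L (p + q) = L p + L q"
    and L_cst: "L (cst c * p) = c * L p"
    and L_ladj: "L (ladj p) = cnj (L p)"
    and L_pos: "p \<noteq> 0 \<Longrightarrow> L (p * ladj p) > 0"
begin

definition ip :: "laurent \<Rightarrow> laurent \<Rightarrow> complex" where
  "ip f g = L (f * ladj g)"

lemma L_0 [simp]: "L 0 = 0"
  using L_cst[of 0 0] by simp

lemma ip_add_left: "ip (f + g) h = ip f h + ip g h"
  by (simp add: ip_def distrib_right L_add)

lemma ip_cnj: "cnj (ip f g) = ip g f"
  by (simp add: ip_def flip: L_ladj) (simp add: ladj_mult mult.commute)

lemma ip_add_right: "ip h (f + g) = ip h f + ip h g"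
  by (simp add: ip_def distrib_left ladj_add L_add)

lemma ip_cst_left: "ip (cst c * f) g = c * ip f g"
  by (simp add: ip_def mult.assoc L_cst)

lemma ip_cst_right: "ip f (cst c * g) = cnj c * ip f g"
  by (metis ip_cnj ip_cst_left complex_cnj_mult)

lemma ip_0 [simp]: "ip 0 g = 0" "ip g 0 = 0"
  by (simp_all add: ip_def)

lemma ip_diff_left: "ip (f - g) h = ip f h - ip g h"
  using ip_add_left[of "f - g" g h] by simp

lemma ip_diff_right: "ip h (f - g) = ip h f - ip h g"
  using ip_add_right[of h "f - g" g] by simp

lemma ip_sum_left: "ip (sum f A) g = (\<Sum>x\<in>A. ip (f x) g)"
  by (induction A rule: infinite_finite_induct) (auto simp: ip_add_left)

lemma ip_sum_right: "ip g (sum f A) = (\<Sum>x\<in>A. ip g (f x))"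
  by (induction A rule: infinite_finite_induct) (auto simp: ip_add_right)

lemmas ip_linear = ip_add_left ip_add_right ip_diff_left ip_diff_right ip_cst_left ip_cst_right
  ip_sum_left ip_sum_right

lemma ip_commute_eq_0: "ip f g = 0 \<longleftrightarrow> ip g f = 0"
  by (metis ip_cnj complex_cnj_zero)

lemma ip_mon [simp]: "ip (mon a * f) (mon a * g) = ip f g"
proof -
  have "mon a * mon (- a) = 1" by (simp add: mult_single)
  moreover have "mon a * f * (mon (- a) * ladj g) = mon a * mon (- a) * (f * ladj g)"
    by (simp only: ac_simps)
  ultimately show ?thesis by (simp add: ip_def ladj_mult_single)
qed

lemma ip_mon_left: "ip (mon a * f) g = ip f (mon (- a) * g)"
  using ip_mon[of a f "mon (- a) * g"] by (simp add: mult_single flip: mult.assoc)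

lemma ip_ladj [simp]: "ip (ladj f) (ladj g) = ip g f"
  by (simp add: ip_def mult.commute)

lemma ip_self_nonneg: "ip f f \<ge> 0"
  using L_pos[of f] by (cases "f = 0") (auto simp: ip_def less_imp_le)

lemma ip_self_eq_0 [simp]: "ip f f = 0 \<longleftrightarrow> f = 0"
  using L_pos[of f] by (cases "f = 0") (auto simp: ip_def)

lemma ip_self_real: "ip f f = of_real (Re (ip f f))"
  using ip_self_nonneg[of f] by (auto simp: complex_eq_iff less_eq_complex_def)

definition perp :: "laurent \<Rightarrow> (int \<times> int) set \<Rightarrow> bool" where
  "perp f S \<longleftrightarrow> (\<forall>a\<in>S. ip f (mon a) = 0)"

lemma perpD: "perp f S \<Longrightarrow> exps g \<subseteq> S \<Longrightarrow> ip f g = 0"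
  by (subst laurent_expand[of "exps g" g])
     (auto simp: perp_def ip_linear intro!: sum.neutral)

lemma perpD': "perp f S \<Longrightarrow> exps g \<subseteq> S \<Longrightarrow> ip g f = 0"
  using perpD ip_commute_eq_0 by blast

lemma perp_mono: "perp f S \<Longrightarrow> T \<subseteq> S \<Longrightarrow> perp f T"
  by (auto simp: perp_def)

lemma perp_Un: "perp f (S \<union> T) \<longleftrightarrow> perp f S \<and> perp f T"
  by (auto simp: perp_def)

lemma perp_diff: "perp f S \<Longrightarrow> perp g S \<Longrightarrow> perp (f - g) S"
  by (auto simp: perp_def ip_linear)

lemma perp_cst: "perp f S \<Longrightarrow> perp (cst c * f) S"
  by (auto simp: perp_def ip_linear)

lemma perp_self: "perp f S \<Longrightarrow> exps f \<subseteq> S \<Longrightarrow> f = 0"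
  using perpD[of f S f] by simp

lemma perp_mon: "perp (mon a * f) S \<longleftrightarrow> perp f ((+) (- a) ` S)"
  by (auto simp: perp_def ip_mon_left mult_single)

lemma perp_ladj: "perp (ladj f) S \<longleftrightarrow> perp f (uminus ` S)"
proof -
  have "ip (ladj f) (mon a) = 0 \<longleftrightarrow> ip f (mon (- a)) = 0" for a
    using ip_ladj[of f "mon (- a)"] ip_commute_eq_0[of f] by (simp add: ladj_single)
  then show ?thesis by (auto simp: perp_def)
qed

text \<open>Gram-Schmidt: the representer over \<open>insert a S\<close> is the one over
  \<open>S\<close> plus a multiple of the residual of the new monomial, which is orthogonal to
  everything over \<open>S\<close>. Serves for projections and for the representers of point
  evaluation.\<close>

lemma riesz:
  fixes ev :: "laurent \<Rightarrow> complex"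
  assumes "finite S" and "\<And>f g. ev (f + g) = ev f + ev g" and "\<And>c f. ev (cst c * f) = c * ev f"
  shows "\<exists>k. exps k \<subseteq> S \<and> (\<forall>f. exps f \<subseteq> S \<longrightarrow> ip f k = ev f)"
  using assms
proof (induction S arbitrary: ev)
  case empty
  then show ?case using empty.prems(2)[of 0 0] by (auto intro!: exI[of _ 0])
next
  case (insert a S)
  obtain k where k: "exps k \<subseteq> S" "\<And>f. exps f \<subseteq> S \<Longrightarrow> ip f k = ev f"
    using insert.IH[of ev] insert.prems by blast
  obtain h where h: "exps h \<subseteq> S" "\<And>f. exps f \<subseteq> S \<Longrightarrow> ip f h = ip f (mon a)"
    using insert.IH[of "\<lambda>f. ip f (mon a)"] by (auto simp: ip_linear)
  define r where "r = mon a - h"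
  have ra: "coef r a = 1"
    using h(1) insert.hyps by (auto simp: r_def lookup_minus lookup_outside)
  then have r0: "ip r r \<noteq> 0" by auto
  have rS: "ip f r = 0" if "exps f \<subseteq> S" for f
    using h(2)[OF that] by (simp add: r_def ip_linear)
  \<comment> \<open>The coefficient is chosen so that \<open>ip r k' = ev r\<close>; it is
    conjugated because \<open>ip\<close> is antilinear on the right.\<close>
  define k' where "k' = k + cst (cnj ((ev r - ip r k) / ip r r)) * r"
  have kr: "exps r \<subseteq> insert a S"
    using h(1) by (auto simp: r_def in_keys_iff lookup_minus lookup_single when_def split: if_splits)
  have "exps k' \<subseteq> insert a S"
    unfolding k'_def using k(1) kr by (intro keys_subset_add keys_subset_cst) auto
  moreover have "ip f k' = ev f" if f: "exps f \<subseteq> insert a S" for f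
  proof -
    define c where "c = coef f a"
    define g where "g = f - cst c * r"
    have "exps g \<subseteq> insert a S"
      unfolding g_def using f kr by (intro keys_subset_diff keys_subset_cst)
    moreover have "a \<notin> exps g"
      using ra by (auto simp: g_def in_keys_iff lookup_minus c_def)
    ultimately have g: "exps g \<subseteq> S" by auto
    have fg: "f = g + cst c * r" by (simp add: g_def)
    define x where "x = (ev r - ip r k) / ip r r"
    have "ip f k' = ip g k + c * ip r k + x * (ip g r + c * ip r r)"
      unfolding fg k'_def x_def[symmetric] by (simp only: ip_linear complex_cnj_cnj)
    also have "\<dots> = ip g k + c * (ip r k + x * ip r r)"
      unfolding rS[OF g] by (simp only: add_0_left distrib_left add.assoc mult.left_commute)
    also have "\<dots> = ev g + c * (ip r k + (ev r - ip r k) / ip r r * ip r r)"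
      by (simp only: k(2)[OF g] x_def)
    also have "\<dots> = ev g + c * ev r"
      using r0 by simp
    also have "\<dots> = ev f"
      unfolding fg by (simp add: insert.prems)
    finally show ?thesis .
  qed
  ultimately show ?case by blast
qed

lemma projection:
  assumes "finite S"
  obtains h where "exps h \<subseteq> S" "perp (f - h) S"
proof -
  obtain h where h: "exps h \<subseteq> S" "\<And>g. exps g \<subseteq> S \<Longrightarrow> ip g h = ip g f"
    using riesz[OF assms, of "\<lambda>g. ip g f"] by (auto simp: ip_linear)
  have "ip (mon a) (f - h) = 0" if "a \<in> S" for a
    using h(2)[of "mon a"] that by (simp add: ip_linear)
  then have "perp (f - h) S" unfolding perp_def using ip_commute_eq_0 by blast
  with h(1) that show ?thesis by blast
qed

lemma residual:
  assumes "finite S" "a \<notin> S"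
  obtains r where "exps r \<subseteq> insert a S" "coef r a = 1" "perp r S"
proof -
  obtain h where h: "exps h \<subseteq> S" "perp (mon a - h) S"
    using projection[OF assms(1)] .
  have "exps (mon a - h) \<subseteq> insert a S"
    using h(1) by (intro keys_subset_diff) auto
  moreover have "coef (mon a - h) a = 1"
    using h(1) assms by (auto simp: lookup_minus lookup_outside)
  ultimately show ?thesis using h(2) that by blast
qed

end

lemma keys_Un_split:
  fixes f :: laurent
  assumes "exps f \<subseteq> A \<union> B"
  obtains g h where "f = g + h" "exps g \<subseteq> A" "exps h \<subseteq> B"
proof
  let ?t = "\<lambda>a. cst (coef f a) * mon a"
  have "f = sum ?t (exps f)" by (rule laurent_expand) auto
  also have "\<dots> = sum ?t (exps f \<inter> A) + sum ?t (exps f - A)"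
    by (subst sum.union_disjoint[symmetric]) (auto intro: sum.cong)
  finally show "f = sum ?t (exps f \<inter> A) + sum ?t (exps f - A)" .
  show "exps (sum ?t (exps f \<inter> A)) \<subseteq> A"
    by (intro keys_subset_sum keys_subset_cst) auto
  show "exps (sum ?t (exps f - A)) \<subseteq> B"
    using assms by (intro keys_subset_sum keys_subset_cst) auto
qed

section \<open>Exchange of the two variables\<close>

lift_definition lswap :: "laurent \<Rightarrow> laurent" is "\<lambda>p a. p (prod.swap a)"
proof -
  fix p :: "int \<times> int \<Rightarrow> complex" assume "finite {a. p a \<noteq> 0}"
  then have "finite (prod.swap ` {a. p a \<noteq> 0})" by simp
  moreover have "{a. p (prod.swap a) \<noteq> 0} \<subseteq> prod.swap ` {a. p a \<noteq> 0}"
    by (auto simp: image_iff)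
  ultimately show "finite {a. p (prod.swap a) \<noteq> 0}" by (rule finite_subset[rotated])
qed

lemma lookup_lswap [simp]: "coef (lswap p) a = coef p (prod.swap a)"
  by transfer simp

lemma swap_0 [simp]: "prod.swap (0 :: int \<times> int) = 0"
  by (simp add: zero_prod_def)

lemma lswap_lswap [simp]: "lswap (lswap p) = p"
  by (rule poly_mapping_eqI) simp

lemma lswap_add: "lswap (p + q) = lswap p + lswap q"
  by (rule poly_mapping_eqI) (simp add: lookup_add)

lemma lswap_0 [simp]: "lswap 0 = 0"
  by (rule poly_mapping_eqI) simp

lemma lswap_eq_0 [simp]: "lswap p = 0 \<longleftrightarrow> p = 0"
  by (metis lswap_lswap lswap_0)

lemma lswap_single [simp]: "lswap (Poly_Mapping.single a c) = Poly_Mapping.single (prod.swap a) c"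
proof (rule poly_mapping_eqI)
  fix b :: "int \<times> int"
  show "coef (lswap (Poly_Mapping.single a c)) b = coef (Poly_Mapping.single (prod.swap a) c) b"
    by (cases a; cases b) (auto simp: lookup_single when_def)
qed

lemma lswap_mult: "lswap (p * q) = lswap p * lswap q"
proof (induction p rule: laurent_induct)
  case (monom c a)
  have "lswap (cst c * mon a * q) = cst c * (mon (prod.swap a) * lswap q)"
    by (rule poly_mapping_eqI) (cases a, auto simp: mult.assoc)
  moreover have "lswap (cst c * mon a) = cst c * mon (prod.swap a)"
    by (simp add: mult_single)
  ultimately show ?case by (simp add: mult.assoc)
next
  case (add p1 p2)
  then show ?case by (simp add: lswap_add distrib_right)
qed

lemma lswap_ladj: "lswap (ladj p) = ladj (lswap p)"
proof (rule poly_mapping_eqI)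
  fix a show "coef (lswap (ladj p)) a = coef (ladj (lswap p)) a"
    by (cases a) simp
qed

lemma keys_lswap: "exps (lswap p) = prod.swap ` exps p"
proof (intro equalityI subsetI)
  fix b assume "b \<in> exps (lswap p)"
  then have "prod.swap b \<in> exps p" by (simp add: in_keys_iff)
  then show "b \<in> prod.swap ` exps p" by (intro image_eqI[of _ _ "prod.swap b"]) auto
qed (auto simp: in_keys_iff)

lemma box_shift:
  fixes s t a b c d :: int
  shows "(+) (s, t) ` ({a..b} \<times> {c..d}) = {a + s..b + s} \<times> {c + t..d + t}"
    and "(+) (s, t) ` ({a} \<times> {c..d}) = {a + s} \<times> {c + t..d + t}"
    and "(+) (s, t) ` ({a..b} \<times> {c}) = {a + s..b + s} \<times> {c + t}"
proof -
  have "(+) (s, t) = (\<lambda>(x, y). (x + s, y + t))" by (simp add: fun_eq_iff add.commute)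
  then have *: "(+) (s, t) ` (A \<times> B) = (\<lambda>x. x + s) ` A \<times> (\<lambda>x. x + t) ` B" for A B :: "int set"
    by (simp only: image_paired_Times)
  show "(+) (s, t) ` ({a..b} \<times> {c..d}) = {a + s..b + s} \<times> {c + t..d + t}"
    "(+) (s, t) ` ({a} \<times> {c..d}) = {a + s} \<times> {c + t..d + t}"
    "(+) (s, t) ` ({a..b} \<times> {c}) = {a + s..b + s} \<times> {c + t}"
    unfolding * by (simp_all add: image_add_atLeastAtMost')
qed

lemma box_reflect:
  fixes s t a b c d :: int
  shows "(-) (s, t) ` ({a..b} \<times> {c..d}) = {s - b..s - a} \<times> {t - d..t - c}"
    and "(-) (s, t) ` ({a} \<times> {c..d}) = {s - a} \<times> {t - d..t - c}"
    and "(-) (s, t) ` ({a..b} \<times> {c}) = {s - b..s - a} \<times> {t - c}"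
proof -
  have "(-) (s, t) = (\<lambda>(x, y). (s - x, t - y))" by (simp add: fun_eq_iff)
  then have *: "(-) (s, t) ` (A \<times> B) = (-) s ` A \<times> (-) t ` B" for A B :: "int set"
    by (simp only: image_paired_Times)
  show "(-) (s, t) ` ({a..b} \<times> {c..d}) = {s - b..s - a} \<times> {t - d..t - c}"
    "(-) (s, t) ` ({a} \<times> {c..d}) = {s - a} \<times> {t - d..t - c}"
    "(-) (s, t) ` ({a..b} \<times> {c}) = {s - b..s - a} \<times> {t - c}"
    unfolding * by simp_all
qed

context pd_form
begin

subsection \<open>Conditional independence of monomials\<close>

text \<open>Conditional independence of the monomials over \<open>A\<close> and over \<open>B\<close> given those over \<open>C\<close>, in the
  sense of Gaussian vectors with covariance \<open>ip\<close>. All the conditions of the theorem take this form.\<close>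

definition indep :: "(int \<times> int) set \<Rightarrow> (int \<times> int) set \<Rightarrow> (int \<times> int) set \<Rightarrow> bool" where
  "indep C A B \<longleftrightarrow> (\<forall>f. exps f \<subseteq> A \<union> C \<and> perp f C \<longrightarrow> perp f B)"

lemma indepD: "indep C A B \<Longrightarrow> exps f \<subseteq> A \<union> C \<Longrightarrow> perp f C \<Longrightarrow> perp f B"
  by (auto simp: indep_def)

lemma indep_mono: "indep C A B \<Longrightarrow> A' \<subseteq> A \<Longrightarrow> B' \<subseteq> B \<Longrightarrow> indep C A' B'"
  unfolding indep_def by (meson perp_mono Un_mono order_refl order_trans)

text \<open>The residual of a monomial of \<open>A\<close> given \<open>C\<close> is orthogonal to
  \<open>B\<close>, and an \<open>f\<close> orthogonal to \<open>C\<close> cannot distinguish the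
  monomial from its residual. Finiteness of \<open>C\<close> provides the projection.\<close>

lemma indep_sym:
  assumes "finite C" "indep C A B"
  shows "indep C B A"
  unfolding indep_def
proof (intro allI impI, elim conjE)
  fix f assume f: "exps f \<subseteq> B \<union> C" "perp f C"
  have "ip f (mon a) = 0" if "a \<in> A" for a
  proof -
    obtain h where h: "exps h \<subseteq> C" "perp (mon a - h) C"
      using projection[OF assms(1)] .
    have "exps (mon a - h) \<subseteq> A \<union> C"
      using h that by (intro keys_subset_diff) auto
    then have "perp (mon a - h) (B \<union> C)"
      using indepD[OF assms(2) _ h(2)] h(2) by (auto simp: perp_Un)
    then have "ip f (mon a - h) = 0" using f(1) by (rule perpD')
    moreover have "ip f h = 0" using f(2) h(1) by (rule perpD)
    ultimately show ?thesis by (simp add: ip_linear)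
  qed
  then show "perp f A" by (simp add: perp_def)
qed

text \<open>Typical of the Gaussian setting: independence is orthogonality of residuals, hence
  bilinear, so pairs suffice. This is what lets one scalar parameter complete a matrix
  condition.\<close>

lemma indep_pointwise:
  assumes "finite C" "\<And>a b. a \<in> A \<Longrightarrow> b \<in> B \<Longrightarrow> indep C {a} {b}"
  shows "indep C A B"
proof -
  have "indep C {a} B" if "a \<in> A" for a
    using assms(2)[OF that] by (force simp: indep_def perp_def)
  then have "indep C B {a}" if "a \<in> A" for a
    using indep_sym[OF assms(1)] that by blast
  then have "indep C B A" by (force simp: indep_def perp_def)
  then show ?thesis using indep_sym[OF assms(1)] by blast
qed

text \<open>A residual given \<open>C\<close> is orthogonal to \<open>D\<close>, so it is already a
  residual given \<open>C \<union> D\<close>.\<close>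

lemma indep_contraction:
  assumes "indep C A D" "indep (C \<union> D) A B"
  shows "indep C A B"
  using assms unfolding indep_def
  by (metis perp_Un Un_assoc le_supI1)

text \<open>The residuals of \<open>A\<close> given \<open>C\<close> and given
  \<open>C \<union> D\<close> coincide: \<open>f\<close> differs from the residual
  \<open>g - k\<close> of its \<open>A\<close>-part by something over \<open>C \<union> D\<close>
  that is also orthogonal to \<open>C \<union> D\<close>.\<close>

lemma indep_weak_union:
  assumes "finite C" "finite D" "indep C A D" "indep C A B"
  shows "indep (C \<union> D) A B"
  unfolding indep_def
proof (intro allI impI, elim conjE)
  fix f assume f: "exps f \<subseteq> A \<union> (C \<union> D)" "perp f (C \<union> D)"
  obtain g h where gh: "f = g + h" "exps g \<subseteq> A" "exps h \<subseteq> C \<union> D"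
    using keys_Un_split[OF f(1)] .
  obtain k where k: "exps k \<subseteq> C" "perp (g - k) C"
    using projection[OF assms(1)] .
  have keys: "exps (g - k) \<subseteq> A \<union> C"
    using gh(2) k(1) by (intro keys_subset_diff) auto
  then have "perp (g - k) (C \<union> D)"
    using indepD[OF assms(3) keys k(2)] k(2) by (simp add: perp_Un)
  then have "perp (f - (g - k)) (C \<union> D)"
    by (rule perp_diff[OF f(2)])
  moreover have "f - (g - k) = h + k" using gh(1) by simp
  moreover have "exps (h + k) \<subseteq> C \<union> D"
    using gh(3) k(1) by (intro keys_subset_add) auto
  ultimately have "h + k = 0"
    using perp_self[of "h + k" "C \<union> D"] by simp
  then have "f = g - k" using \<open>f - (g - k) = h + k\<close> by simp
  then show "perp f B" using indepD[OF assms(4) keys k(2)] by simp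
qed

lemma indep_shift:
  assumes "indep C A B"
  shows "indep ((+) t ` C) ((+) t ` A) ((+) t ` B)"
  unfolding indep_def
proof (intro allI impI, elim conjE)
  fix f assume f: "exps f \<subseteq> (+) t ` A \<union> (+) t ` C" "perp f ((+) t ` C)"
  have "exps (mon (- t) * f) \<subseteq> A \<union> C"
    using f(1) by (intro keys_subset_mon) auto
  moreover have "perp (mon (- t) * f) C" using f(2) by (simp add: perp_mon)
  ultimately have "perp (mon (- t) * f) B" by (rule indepD[OF assms])
  then show "perp f ((+) t ` B)" by (simp add: perp_mon)
qed

lemma indep_uminus:
  assumes "indep C A B"
  shows "indep (uminus ` C) (uminus ` A) (uminus ` B)"
  unfolding indep_def
proof (intro allI impI, elim conjE)
  fix f assume f: "exps f \<subseteq> uminus ` A \<union> uminus ` C" "perp f (uminus ` C)"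
  have "exps (ladj f) \<subseteq> A \<union> C"
    using f(1) by (auto simp: keys_ladj)
  moreover have "perp (ladj f) C" using f(2) by (simp add: perp_ladj)
  ultimately have "perp (ladj f) B" by (rule indepD[OF assms])
  then show "perp f (uminus ` B)" by (simp add: perp_ladj)
qed

lemma indep_reflect:
  assumes "indep C A B"
  shows "indep ((-) t ` C) ((-) t ` A) ((-) t ` B)"
proof -
  have "(-) t ` X = (+) t ` uminus ` X" for X by (auto simp: image_image)
  then show ?thesis using indep_shift[OF indep_uminus[OF assms]] by metis
qed

text \<open>Permits instantiating the locale with the mirrored functional, so that results about
  rows yield those about columns.\<close>

lemma pd_form_swap: "pd_form (L \<circ> lswap)"
proof
  show "(L \<circ> lswap) (ladj p) = cnj ((L \<circ> lswap) p)" for p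
    by (simp add: lswap_ladj L_ladj)
  show "0 < (L \<circ> lswap) (p * ladj p)" if "p \<noteq> 0" for p
    using L_pos[of "lswap p"] that by (simp add: lswap_mult lswap_ladj)
qed (simp_all add: lswap_add lswap_mult L_add L_cst)

lemma ip_swap: "pd_form.ip (L \<circ> lswap) f g = ip (lswap f) (lswap g)"
  by (simp add: pd_form.ip_def[OF pd_form_swap] ip_def lswap_mult lswap_ladj)

lemma perp_swap: "pd_form.perp (L \<circ> lswap) f S \<longleftrightarrow> perp (lswap f) (prod.swap ` S)"
  by (auto simp: pd_form.perp_def[OF pd_form_swap] perp_def ip_swap)

lemma indep_swap: "pd_form.indep (L \<circ> lswap) C A B \<longleftrightarrow> indep (prod.swap ` C) (prod.swap ` A) (prod.swap ` B)"
proof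
  assume *: "pd_form.indep (L \<circ> lswap) C A B"
  show "indep (prod.swap ` C) (prod.swap ` A) (prod.swap ` B)"
    unfolding indep_def
  proof (intro allI impI, elim conjE)
    fix f assume f: "exps f \<subseteq> prod.swap ` A \<union> prod.swap ` C" "perp f (prod.swap ` C)"
    have "exps (lswap f) \<subseteq> A \<union> C" using f(1) by (auto simp: keys_lswap)
    then show "perp f (prod.swap ` B)"
      using pd_form.indepD[OF pd_form_swap *, of "lswap f"] f(2) by (simp add: perp_swap)
  qed
next
  assume *: "indep (prod.swap ` C) (prod.swap ` A) (prod.swap ` B)"
  show "pd_form.indep (L \<circ> lswap) C A B"
    unfolding pd_form.indep_def[OF pd_form_swap]
  proof (intro allI impI, elim conjE)
    fix f assume f: "exps f \<subseteq> A \<union> C" "pd_form.perp (L \<circ> lswap) f C"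
    have "exps (lswap f) \<subseteq> prod.swap ` A \<union> prod.swap ` C" using f(1) by (auto simp: keys_lswap)
    then show "pd_form.perp (L \<circ> lswap) f B"
      using indepD[OF *, of "lswap f"] f(2) by (simp add: perp_swap)
  qed
qed

text \<open>The first four conditions below amount to \<open>K\<^bsub>i,j\<^esub> = 0\<close>, to the vanishing of the coefficients
  \<open>E_hat_rev\<close> of index \<open>(i, j + 1)\<close> and \<open>E_hat\<close> of index \<open>(i + 1, j)\<close>, and to \<open>u\<^bsub>-i,j\<^esub> = 0\<close>.\<close>

definition ciK :: "int \<Rightarrow> int \<Rightarrow> bool" where
  "ciK i j \<longleftrightarrow> indep ({0..i-1} \<times> {0..j-1}) ({i} \<times> {0..j-1}) ({0..i-1} \<times> {j})"

definition ciW :: "int \<Rightarrow> int \<Rightarrow> bool" where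
  "ciW i j \<longleftrightarrow> indep ({0..i} \<times> {1..j}) ({0..i} \<times> {0}) ({0..i} \<times> {j+1})"

definition ciZ :: "int \<Rightarrow> int \<Rightarrow> bool" where
  "ciZ i j \<longleftrightarrow> indep ({1..i} \<times> {0..j}) ({0} \<times> {0..j}) ({i+1} \<times> {0..j})"

definition ciN :: "int \<Rightarrow> int \<Rightarrow> bool" where
  "ciN i j \<longleftrightarrow> indep ({0..i-1} \<times> {0..j-1}) {(i, 0)} {(0, j)}"

text \<open>What is left of \<open>u\<^bsub>i,j\<^esub> = 0\<close>: the two polynomials in the definition of \<open>u\<^bsub>i,j\<^esub>\<close> are residuals with respect
  to different sets, which can be reconciled only under the stated premise.\<close>

definition ciU :: "int \<Rightarrow> int \<Rightarrow> bool" where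
  "ciU i j \<longleftrightarrow>
    (indep ({0..i} \<times> {1..j-1} \<union> {0..i-1} \<times> {j}) {(i, j)} ({1..i-1} \<times> {0}) \<longrightarrow>
     indep ({0..i} \<times> {1..j-1} \<union> {0..i-1} \<times> {j}) {(i, j)} {(0, 0)})"

definition ciU' :: "int \<Rightarrow> int \<Rightarrow> bool" where
  "ciU' i j \<longleftrightarrow>
    (indep ({1..i-1} \<times> {0..j} \<union> {i} \<times> {0..j-1}) {(i, j)} ({0} \<times> {1..j-1}) \<longrightarrow>
     indep ({1..i-1} \<times> {0..j} \<union> {i} \<times> {0..j-1}) {(i, j)} {(0, 0)})"

lemma ci_swap:
  "pd_form.ciK (L \<circ> lswap) i j \<longleftrightarrow> ciK j i"
  "pd_form.ciW (L \<circ> lswap) i j \<longleftrightarrow> ciZ j i"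
  "pd_form.ciZ (L \<circ> lswap) i j \<longleftrightarrow> ciW j i"
  "pd_form.ciN (L \<circ> lswap) i j \<longleftrightarrow> ciN j i"
  "pd_form.ciU (L \<circ> lswap) i j \<longleftrightarrow> ciU' j i"
  "pd_form.ciU' (L \<circ> lswap) i j \<longleftrightarrow> ciU j i"
proof -
  have s: "prod.swap ` (A \<times> B) = B \<times> A" for A B :: "int set" by auto
  note defs = ciK_def ciW_def ciZ_def ciN_def ciU_def ciU'_def
    pd_form.ciK_def[OF pd_form_swap] pd_form.ciW_def[OF pd_form_swap] pd_form.ciZ_def[OF pd_form_swap]
    pd_form.ciN_def[OF pd_form_swap] pd_form.ciU_def[OF pd_form_swap] pd_form.ciU'_def[OF pd_form_swap]
    indep_swap
  show "pd_form.ciK (L \<circ> lswap) i j \<longleftrightarrow> ciK j i" "pd_form.ciN (L \<circ> lswap) i j \<longleftrightarrow> ciN j i"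
    unfolding defs s using indep_sym by (auto simp: s)
  show "pd_form.ciW (L \<circ> lswap) i j \<longleftrightarrow> ciZ j i" "pd_form.ciZ (L \<circ> lswap) i j \<longleftrightarrow> ciW j i"
    unfolding defs s by (auto simp: s)
  show "pd_form.ciU (L \<circ> lswap) i j \<longleftrightarrow> ciU' j i" "pd_form.ciU' (L \<circ> lswap) i j \<longleftrightarrow> ciU j i"
    unfolding defs image_Un s by (auto simp: Un_commute)
qed

section \<open>Propagation of the independence conditions over the quadrant\<close>

lemma ciK_imp_ciN: "ciK i j \<Longrightarrow> i \<ge> 1 \<Longrightarrow> j \<ge> 1 \<Longrightarrow> ciN i j"
  unfolding ciK_def ciN_def by (erule indep_mono) auto

text \<open>\<open>ciK i j\<close> moved up by one row says that column \<open>i\<close> is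
  independent of row \<open>j+1\<close> given the columns before it, so this column may join the
  conditioning set of \<open>ciW (i - 1) j\<close>.\<close>

lemma ciW_weak_union:
  assumes W: "ciW (i - 1) j" and K: "ciK i j"
  shows "indep ({0..i} \<times> {1..j}) ({0..i-1} \<times> {j+1}) ({0..i-1} \<times> {0})"
    and "indep ({0..i-1} \<times> {1..j}) ({0..i-1} \<times> {j+1}) ({i} \<times> {1..j})"
proof -
  have "indep ({0..i-1} \<times> {1..j}) ({i} \<times> {1..j}) ({0..i-1} \<times> {j + 1})"
    using indep_shift[OF K[unfolded ciK_def], of "(0, 1)"] by (simp add: box_shift)
  then show 1: "indep ({0..i-1} \<times> {1..j}) ({0..i-1} \<times> {j+1}) ({i} \<times> {1..j})"
    by (rule indep_sym[rotated]) simp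
  have 2: "indep ({0..i-1} \<times> {1..j}) ({0..i-1} \<times> {j+1}) ({0..i-1} \<times> {0})"
    using W unfolding ciW_def by (rule indep_sym[rotated]) simp
  show "indep ({0..i} \<times> {1..j}) ({0..i-1} \<times> {j+1}) ({0..i-1} \<times> {0})"
  proof (cases "i \<ge> 0")
    case True
    then have "{0..i-1} \<times> {1..j} \<union> {i} \<times> {1..j} = {0..i} \<times> {1..j}" by auto
    then show ?thesis using indep_weak_union[OF _ _ 1 2] by simp
  qed (auto simp: indep_def perp_def)
qed

text \<open>Settles every pair of \<open>ciK i j\<close> that avoids the corner
  \<open>(i, 0)\<close>: \<open>ciW (i - 1) (j - 1)\<close> allows row 0 to be added to the
  conditioning set of \<open>ciK i (j - 1)\<close> shifted up by one.\<close>

lemma ciK_aux: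
  assumes W: "ciW (i - 1) (j - 1)" and K: "ciK i (j - 1)" and "j \<ge> 1"
  shows "indep ({0..i-1} \<times> {0..j-1}) ({i} \<times> {1..j-1}) ({0..i-1} \<times> {j})"
proof -
  let ?C = "{0..i-1} \<times> {1..j-1}"
  have 1: "indep ?C ({0..i-1} \<times> {j}) ({i} \<times> {1..j-1})"
    using ciW_weak_union(2)[OF W K] by simp
  have 2: "indep ?C ({0..i-1} \<times> {j}) ({0..i-1} \<times> {0})"
    using indep_sym[OF _ W[unfolded ciW_def]] by simp
  have "?C \<union> {0..i-1} \<times> {0} = {0..i-1} \<times> {0..j-1}" using \<open>j \<ge> 1\<close> by auto
  then have "indep ({0..i-1} \<times> {0..j-1}) ({0..i-1} \<times> {j}) ({i} \<times> {1..j-1})"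
    using indep_weak_union[OF _ _ 2 1] by simp
  then show ?thesis by (rule indep_sym[rotated]) simp
qed

text \<open>\<open>ciK_aux\<close> and its mirror image leave a single pair open,
  \<open>(i, 0)\<close> against \<open>(0, j)\<close>. That pair is \<open>ciN i j\<close>, the
  content of u_{-i,j}.\<close>

lemma ciK_step:
  assumes "i \<ge> 1" "j \<ge> 1" "ciW (i - 1) (j - 1)" "ciZ (i - 1) (j - 1)" "ciK i (j - 1)" "ciK (i - 1) j" "ciN i j"
  shows "ciK i j"
proof -
  interpret S: pd_form "L \<circ> lswap" by (rule pd_form_swap)
  have 1: "indep ({0..i-1} \<times> {0..j-1}) ({i} \<times> {1..j-1}) ({0..i-1} \<times> {j})"
    using ciK_aux assms by blast
  have "prod.swap ` (A \<times> B) = B \<times> A" for A B :: "int set" by auto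
  then have 2: "indep ({0..i-1} \<times> {0..j-1}) ({1..i-1} \<times> {j}) ({i} \<times> {0..j-1})"
    using S.ciK_aux[of j i] assms by (simp add: ci_swap indep_swap)
  show ?thesis
    unfolding ciK_def
  proof (rule indep_pointwise; (elim SigmaE)?)
    fix a b :: "int \<times> int" and i' k l j' assume *: "a = (i', k)" "b = (l, j')" "i' \<in> {i}" "k \<in> {0..j-1}" "l \<in> {0..i-1}" "j' \<in> {j}"
    consider "k \<ge> 1" | "l \<ge> 1" | "k = 0" "l = 0" using * by atomize_elim auto
    then show "indep ({0..i-1} \<times> {0..j-1}) {a} {b}"
    proof cases
      case 1
      with * show ?thesis by (intro indep_mono[OF \<open>indep _ ({i} \<times> {1..j-1}) _\<close>]) auto
    next
      case 2
      with * have "indep ({0..i-1} \<times> {0..j-1}) {b} {a}"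
        by (intro indep_mono[OF \<open>indep _ ({1..i-1} \<times> {j}) _\<close>]) auto
      then show ?thesis by (rule indep_sym[rotated]) simp
    next
      case 3
      with * \<open>ciN i j\<close> show ?thesis by (simp add: ciN_def)
    qed
  qed auto
qed

text \<open>The pairs are points \<open>(k, 0)\<close> and \<open>(l, j+1)\<close>.
  \<open>R1\<close> treats those avoiding column \<open>i\<close>, \<open>R2\<close> those avoiding
  column 0. The two diagonals of the rectangle remain: \<open>R3\<close> comes from
  \<open>ciN\<close>, \<open>R4\<close> from \<open>ciU\<close>.\<close>

lemma ciW_step:
  assumes "i \<ge> 1" "j \<ge> 1" and W: "ciW (i - 1) j" and K: "ciK i j" and U: "ciU i (j + 1)" and N: "ciN i (j + 1)"
  shows "ciW i j"
proof -
  let ?C = "{0..i} \<times> {1..j}" and ?D = "{0..i-1} \<times> {1..j}" and ?E = "{1..i} \<times> {1..j}"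
  note R1 = ciW_weak_union(1)[OF W K]
  \<comment> \<open>\<open>ciW (i - 1) j\<close> moved right by one and enlarged by column 0, which
    the point reflection of \<open>ciK i j\<close> permits.\<close>
  have R2: "indep ?C ({1..i} \<times> {0}) ({1..i} \<times> {j+1})"
  proof -
    have "indep ?E ({0} \<times> {1..j}) ({1..i} \<times> {0})"
      using indep_reflect[OF K[unfolded ciK_def], of "(i, j)"] by (simp add: box_reflect)
    then have 1: "indep ?E ({1..i} \<times> {0}) ({0} \<times> {1..j})" by (rule indep_sym[rotated]) simp
    have 2: "indep ?E ({1..i} \<times> {0}) ({1..i} \<times> {j+1})"
      using indep_shift[OF W[unfolded ciW_def], of "(1, 0)"] by (simp add: box_shift)
    have "?E \<union> {0} \<times> {1..j} = ?C" using \<open>i \<ge> 1\<close> by auto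
    then show ?thesis using indep_weak_union[OF _ _ 1 2] by simp
  qed
  \<comment> \<open>\<open>ciN\<close> conditions on row 0 as well; contraction takes this row out,
    and weak union then puts column \<open>i\<close> in.\<close>
  have R3: "indep ?C {(0, j+1)} {(i, 0)}"
  proof -
    have 1: "indep ?D {(0, j+1)} ({0..i-1} \<times> {0})"
      proof (rule indep_mono[of ?D "{0..i-1} \<times> {j+1}" "{0..i-1} \<times> {0}"])
      show "indep ?D ({0..i-1} \<times> {j+1}) ({0..i-1} \<times> {0})"
        using W unfolding ciW_def by (rule indep_sym[rotated]) simp
    qed (use \<open>i \<ge> 1\<close> in auto)
    have "?D \<union> {0..i-1} \<times> {0} = {0..i-1} \<times> {0..j}" using \<open>j \<ge> 1\<close> by auto
    then have 2: "indep (?D \<union> {0..i-1} \<times> {0}) {(0, j+1)} {(i, 0)}"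
      using indep_sym[OF _ N[unfolded ciN_def]] by simp
    have 3: "indep ?D {(0, j+1)} ({i} \<times> {1..j})"
      by (rule indep_mono[OF ciW_weak_union(2)[OF W K]]) (use \<open>i \<ge> 1\<close> in auto)
    have "?D \<union> {i} \<times> {1..j} = ?C" using \<open>i \<ge> 1\<close> by auto
    then show ?thesis
      using indep_weak_union[OF _ _ 3 indep_contraction[OF 1 2]] by simp
  qed
  \<comment> \<open>Weak union applied to \<open>R1\<close> and \<open>R2\<close> supplies the
    premise of \<open>ciU\<close>, whose conclusion still has part of row \<open>j+1\<close> among
    the conditions; contraction with \<open>R1\<close> removes it.\<close>
  have R4: "indep ?C {(0, 0)} {(i, j+1)}"
  proof -
    let ?X = "?C \<union> {0..i-1} \<times> {j+1}"
    have R1': "indep ?C ({0..i-1} \<times> {0}) ({0..i-1} \<times> {j+1})"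
      using R1 by (rule indep_sym[rotated]) simp
    have 1: "indep ?C ({1..i-1} \<times> {0}) ({0..i-1} \<times> {j+1})"
      using R1' by (rule indep_mono) auto
    have 2: "indep ?C ({1..i-1} \<times> {0}) {(i, j+1)}"
      by (rule indep_mono[OF R2]) (use \<open>i \<ge> 1\<close> in auto)
    have "indep ?X ({1..i-1} \<times> {0}) {(i, j+1)}"
      using indep_weak_union[OF _ _ 1 2] by simp
    then have "indep ?X {(i, j+1)} ({1..i-1} \<times> {0})" by (rule indep_sym[rotated]) simp
    then have "indep ?X {(i, j+1)} {(0, 0)}" using U by (simp add: ciU_def)
    then have 3: "indep ?X {(0, 0)} {(i, j+1)}" by (rule indep_sym[rotated]) simp
    have "indep ?C {(0, 0)} ({0..i-1} \<times> {j+1})"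
      by (rule indep_mono[OF R1']) (use \<open>i \<ge> 1\<close> in auto)
    then show ?thesis using 3 by (rule indep_contraction)
  qed
  show ?thesis
    unfolding ciW_def
  proof (rule indep_pointwise; (elim SigmaE)?)
    fix a b :: "int \<times> int" and k o' l j' assume *: "a = (k, o')" "b = (l, j')" "k \<in> {0..i}" "o' \<in> {0}" "l \<in> {0..i}" "j' \<in> {j+1}"
    consider "k \<le> i - 1" "l \<le> i - 1" | "k \<ge> 1" "l \<ge> 1" | "k = 0" "l = i" | "k = i" "l = 0" using * by atomize_elim auto
    then show "indep ?C {a} {b}"
    proof cases
      case 1
      with * have "indep ?C {b} {a}" by (intro indep_mono[OF R1]) auto
      then show ?thesis by (rule indep_sym[rotated]) simp
    next
      case 2
      with * show ?thesis by (intro indep_mono[OF R2]) auto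
    next
      case 3
      with * R4 show ?thesis by simp
    next
      case 4
      with * indep_sym[OF _ R3] show ?thesis by simp
    qed
  qed auto
qed

lemma ciZ_step:
  assumes "i \<ge> 1" "j \<ge> 1" "ciZ i (j - 1)" "ciK i j" "ciU' (i + 1) j" "ciN (i + 1) j"
  shows "ciZ i j"
  using pd_form.ciW_step[OF pd_form_swap, of j i] assms by (simp add: ci_swap)

text \<open>Column by column, upwards within each column. (a) supplies the first column, (b) the
  start of every further column at height \<open>m\<close>, and \<open>D\<close> the corner
  conditions at interior indices. In each column \<open>ciK\<close> comes first; then
  \<open>ciW\<close> follows from the preceding column and \<open>ciZ\<close> from the row
  below.\<close>

lemma ci_propagate:
  assumes nm: "n \<ge> 1" "m \<ge> 1"
    and A: "\<And>j. j \<ge> m \<Longrightarrow> ciK n j" "\<And>j. j \<ge> m \<Longrightarrow> ciW (n - 1) j" "\<And>j. j \<ge> m \<Longrightarrow> ciU n (j + 1)"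
    and B: "\<And>i. i \<ge> n \<Longrightarrow> ciK i m" "\<And>i. i \<ge> n \<Longrightarrow> ciZ i (m - 1)" "\<And>i. i \<ge> n \<Longrightarrow> ciU' (i + 1) m"
    and D: "\<And>i j. i > n \<Longrightarrow> j > m \<Longrightarrow> ciU i j \<and> ciU' i j \<and> ciN i j"
    and "i \<ge> n"
  shows "\<forall>j\<ge>m. ciK i j \<and> ciW i j \<and> ciZ i j"
proof -
  \<comment> \<open>At height \<open>m\<close> the corner condition \<open>ciN (i + 1) m\<close> is
    part of \<open>ciK (i + 1) m\<close>, which \<open>B\<close> provides.\<close>
  have Zm: "ciZ i m" if "i \<ge> n" for i
    by (rule ciZ_step) (use that nm B ciK_imp_ciN[of "i + 1" m] in auto)
  have Z: "ciZ i j" if "i \<ge> n" "\<And>j. j \<ge> m \<Longrightarrow> ciK i j" "j \<ge> m" for i j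
    using \<open>j \<ge> m\<close>
  proof (induction j rule: int_ge_induct)
    case base
    show ?case using Zm that by simp
  next
    case (step j)
    show ?case
      by (rule ciZ_step) (use step that(1,2) nm D[of "i + 1" "j + 1"] in auto)
  qed
  from \<open>i \<ge> n\<close> show ?thesis
  proof (induction i rule: int_ge_induct)
    case base
    have "ciW n j" if "j \<ge> m" for j
      by (rule ciW_step) (use that nm A ciK_imp_ciN[of n "j + 1"] in auto)
    then show ?case using A(1) Z[of n] by auto
  next
    case (step i)
    have K: "ciK (i + 1) j" if "j \<ge> m" for j
      using that
    proof (induction j rule: int_ge_induct)
      case base
      show ?case using B(1) step.hyps by simp
    next
      case (step j)
      show ?case
        by (rule ciK_step) (use step nm \<open>n \<le> i\<close> \<open>\<forall>j\<ge>m. ciK i j \<and> ciW i j \<and> ciZ i j\<close> D[of "i + 1" "j + 1"] in auto)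
    qed
    have "ciW (i + 1) j" if "j \<ge> m" for j
      by (rule ciW_step) (use that nm step K D[of "i + 1" "j + 1"] in auto)
    then show ?case using K Z[of "i + 1"] step.hyps by auto
  qed
qed

end

subsection \<open>Orthonormal polynomials and coefficient matrices\<close>

abbreviation emb :: "nat \<times> nat \<Rightarrow> int \<times> int" where
  "emb \<equiv> \<lambda>(i, j). (int i, int j)"

lemma emb_Times: "emb ` (A \<times> B) = int ` A \<times> int ` B"
  by (rule image_paired_Times)

lemma inj_emb: "inj emb"
  by (auto simp: inj_def)

lemma int_image_intervals:
  "int ` {0..b} = {0..int b}" "int ` {0..<b} = {0..int b - 1}"
  by (auto simp: image_int_atLeastAtMost image_int_atLeastLessThan)

lemma mat_eq_zero_iff:
  assumes "A \<in> carrier_mat r c"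
  shows "A = 0\<^sub>m r c \<longleftrightarrow> (\<forall>i<r. \<forall>j<c. A $$ (i, j) = 0)"
  using assms by (auto intro!: eq_matI)

lemma all_less_rev: "(\<forall>r<N. P (N - Suc r)) \<longleftrightarrow> (\<forall>k<N. P k)" for N :: nat
proof
  assume *: "\<forall>r<N. P (N - Suc r)"
  show "\<forall>k<N. P k"
  proof (intro allI impI)
    fix k assume "k < N"
    then have "N - Suc (N - Suc k) = k" "N - Suc k < N" by auto
    then show "P k" using * by metis
  qed
qed auto

lemma all_less_rev2:
  "(\<forall>r<N. \<forall>c<M. P (N - Suc r) (M - Suc c)) \<longleftrightarrow> (\<forall>k<N. \<forall>l<M. P k l)" for N M :: nat
proof -
  have "(\<forall>c<M. P k (M - Suc c)) \<longleftrightarrow> (\<forall>l<M. P k l)" for k by (rule all_less_rev)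
  then show ?thesis using all_less_rev[of N "\<lambda>k. \<forall>c<M. P k (M - Suc c)"] by simp
qed

lemma int_image_intervals':
  "int ` {..b} = {0..int b}" "int ` {..<b} = {0..int b - 1}"
  by (simp_all add: atMost_atLeast0 lessThan_atLeast0 int_image_intervals)

lemma line_image:
  "(\<lambda>k. (c, g k)) ` A = {c} \<times> g ` A" "(\<lambda>k. (g k, c)) ` A = g ` A \<times> {c}"
  by auto

lemma int_diff_image:
  "(\<lambda>k. c - int k) ` {..b} = {c - int b..c}" "(\<lambda>k. c - int k) ` {..<b} = {c - int b + 1..c}"
proof -
  have *: "(\<lambda>k. c - int k) ` A = (-) c ` int ` A" for A by (simp add: image_image)
  show "(\<lambda>k. c - int k) ` {..b} = {c - int b..c}" "(\<lambda>k. c - int k) ` {..<b} = {c - int b + 1..c}"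
    unfolding * int_image_intervals' by simp_all
qed

lemmas family_image = line_image int_image_intervals' int_diff_image

lemma subset_Un_remove: "A \<subseteq> X \<union> C \<Longrightarrow> y \<notin> A \<Longrightarrow> X \<subseteq> insert y Y \<Longrightarrow> A \<subseteq> Y \<union> C"
  by blast

context pd_form
begin

lemma ip_self_pos: "f \<noteq> 0 \<Longrightarrow> ip f f > 0"
  using L_pos by (simp add: ip_def)

definition is_orthopoly :: "(int \<times> int) set \<Rightarrow> int \<times> int \<Rightarrow> laurent \<Rightarrow> bool" where
  "is_orthopoly S a p \<longleftrightarrow> exps p \<subseteq> S \<and> coef p a > 0 \<and> ip p p = 1 \<and> perp p (S - {a})"

lemma is_orthopolyD:
  assumes "is_orthopoly S a p"
  shows "exps p \<subseteq> S" "coef p a \<noteq> 0" "T \<subseteq> S - {a} \<Longrightarrow> perp p T"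
  using assms perp_mono[of p "S - {a}" T] by (auto simp: is_orthopoly_def)

lemma is_orthopoly_exists:
  assumes "finite S" "a \<in> S"
  shows "\<exists>p. is_orthopoly S a p"
proof -
  obtain r where r: "exps r \<subseteq> insert a (S - {a})" "coef r a = 1" "perp r (S - {a})"
    using residual[of "S - {a}" a] assms by blast
  have "r \<noteq> 0" using r(2) by auto
  then have pos: "Re (ip r r) > 0" using ip_self_pos[of r] by (simp add: less_complex_def)
  define c where "c = 1 / sqrt (Re (ip r r))"
  have c: "c > 0" "c * c * Re (ip r r) = 1" using pos by (auto simp: c_def)
  have "ip (cst (of_real c) * r) (cst (of_real c) * r) = of_real (c * c * Re (ip r r))"
    using ip_self_real[of r] by (simp add: ip_linear)
  then have "is_orthopoly S a (cst (of_real c) * r)"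
    using r assms c keys_subset_cst[OF r(1), of "of_real c"]
    by (auto simp: is_orthopoly_def less_complex_def insert_absorb intro!: perp_cst)
  then show ?thesis by blast
qed

text \<open>Subtracting a multiple cancels the coefficient at \<open>a\<close> and leaves a
  polynomial orthogonal to itself; so \<open>p\<close> is \<open>t\<close> times \<open>q\<close>,
  with \<open>t\<close> positive and of modulus one.\<close>

lemma is_orthopoly_unique:
  assumes "is_orthopoly S a p" "is_orthopoly S a q"
  shows "p = q"
proof -
  define t where "t = coef p a / coef q a"
  have pq: "coef p a > 0" "coef q a > 0" using assms by (auto simp: is_orthopoly_def)
  have "exps (p - cst t * q) \<subseteq> S"
    using assms unfolding is_orthopoly_def by (intro keys_subset_diff keys_subset_cst) auto
  moreover have "a \<notin> exps (p - cst t * q)"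
    using pq by (auto simp: in_keys_iff lookup_minus t_def)
  moreover have "perp (p - cst t * q) (S - {a})"
    using assms unfolding is_orthopoly_def by (intro perp_diff perp_cst) auto
  ultimately have "p - cst t * q = 0" by (intro perp_self[of _ "S - {a}"]) auto
  then have p: "p = cst t * q" by simp
  obtain x y where xy: "coef p a = of_real x" "coef q a = of_real y" "x > 0" "y > 0"
    using pq by (metis complex_is_Real_iff less_complex_def of_real_Re zero_complex.simps)
  define u where "u = x / y"
  have u: "t = of_real u" "u > 0" using xy by (auto simp: t_def u_def)
  have "1 = t * cnj t"
    using assms p by (metis is_orthopoly_def ip_cst_left ip_cst_right mult.right_neutral mult.commute)
  then have "of_real (u * u) = (1::complex)" using u by simp
  then have "u * u = 1" using of_real_eq_1_iff by blast
  then have "u = 1" using u(2) by (auto simp: square_eq_1_iff)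
  then show ?thesis using p u by simp
qed

lemma orthopoly_iff:
  "exps p \<subseteq> emb ` S \<and> coeff2 p k l > 0 \<and> L (p * ladj p) = 1 \<and>
     (\<forall>(i, j)\<in>S - {(k, l)}. L (p * ladj (monom2 i j)) = 0) \<longleftrightarrow> is_orthopoly (emb ` S) (emb (k, l)) p"
proof -
  have *: "emb ` S - {emb (k, l)} = emb ` (S - {(k, l)})"
    using image_set_diff[OF inj_emb, of S "{(k, l)}"] by simp
  show ?thesis
    unfolding is_orthopoly_def * perp_def ip_def by (simp add: case_prod_unfold)
qed

lemma orthopoly_is:
  assumes "finite S" "(k, l) \<in> S"
  shows "is_orthopoly (emb ` S) (emb (k, l)) (orthopoly L S (k, l))"
proof -
  obtain p where p: "is_orthopoly (emb ` S) (emb (k, l)) p"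
    using is_orthopoly_exists[of "emb ` S" "emb (k, l)"] assms by blast
  have "orthopoly L S (k, l) = (THE p. is_orthopoly (emb ` S) (emb (k, l)) p)"
    unfolding orthopoly_def prod.case orthopoly_iff ..
  also have "\<dots> = p" using p by (rule the_equality) (rule is_orthopoly_unique[OF _ p])
  finally show ?thesis using p by simp
qed

lemma phi_is:
  assumes "l \<le> b"
  shows "is_orthopoly ({0..int a - 1} \<times> {0..int b} \<union> {int a} \<times> {0..int l}) (int a, int l) (phi L a b l)"
proof -
  have "emb ` ({0..<a} \<times> {0..b} \<union> {a} \<times> {0..l}) = {0..int a - 1} \<times> {0..int b} \<union> {int a} \<times> {0..int l}"
    by (simp add: image_Un emb_Times int_image_intervals)
  then show ?thesis
    using orthopoly_is[of "{0..<a} \<times> {0..b} \<union> {a} \<times> {0..l}" a l] by (simp add: phi_def)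
qed

lemma phi_rev_is:
  assumes "l \<le> a"
  shows "is_orthopoly ({0..int a} \<times> {0..int b - 1} \<union> {0..int l} \<times> {int b}) (int l, int b) (phi_rev L a b l)"
proof -
  have "emb ` ({0..a} \<times> {0..<b} \<union> {0..l} \<times> {b}) = {0..int a} \<times> {0..int b - 1} \<union> {0..int l} \<times> {int b}"
    by (simp add: image_Un emb_Times int_image_intervals)
  then show ?thesis
    using orthopoly_is[of "{0..a} \<times> {0..<b} \<union> {0..l} \<times> {b}" l b] by (simp add: phi_rev_def)
qed

text \<open>Elimination along the order of the \<open>a k\<close>: a multiple of \<open>F N\<close>
  removes the exponent \<open>a N\<close> from \<open>f\<close>, and what remains is a case with one
  member fewer.\<close>

lemma triangular:
  fixes a :: "nat \<Rightarrow> int \<times> int"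
  assumes "\<And>k. k < N \<Longrightarrow> exps (F k) \<subseteq> a ` {..k} \<union> C \<and> coef (F k) (a k) \<noteq> 0 \<and> ip (F k) x = 0"
    and "perp x C" and "exps f \<subseteq> a ` {..<N} \<union> C"
  shows "ip f x = 0"
  using assms
proof (induction N arbitrary: f)
  case 0
  then show ?case by (intro perpD'[of x C]) auto
next
  case (Suc N)
  define t where "t = coef f (a N) / coef (F N) (a N)"
  have F: "exps (F N) \<subseteq> a ` {..N} \<union> C" "coef (F N) (a N) \<noteq> 0" "ip (F N) x = 0"
    using Suc.prems(1)[of N] by simp_all
  have "exps (f - cst t * F N) \<subseteq> a ` {..N} \<union> C"
    using F(1) Suc.prems(3) by (intro keys_subset_diff keys_subset_cst) (simp_all add: lessThan_Suc_atMost)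
  moreover have "a N \<notin> exps (f - cst t * F N)"
    using F(2) by (simp add: in_keys_iff lookup_minus t_def)
  moreover have "a ` {..N} \<subseteq> insert (a N) (a ` {..<N})"
    by (auto simp flip: lessThan_Suc_atMost simp: less_Suc_eq)
  ultimately have keys: "exps (f - cst t * F N) \<subseteq> a ` {..<N} \<union> C"
    by (rule subset_Un_remove)
  have "ip (f - cst t * F N) x = 0"
  proof (rule Suc.IH)
    fix k assume "k < N"
    then show "exps (F k) \<subseteq> a ` {..k} \<union> C \<and> coef (F k) (a k) \<noteq> 0 \<and> ip (F k) x = 0"
      using Suc.prems(1)[of k] by simp
  qed (rule Suc.prems(2), rule keys)
  then show ?case using F(3) by (simp add: ip_linear)
qed

text \<open>Links the coefficient matrices to \<open>indep\<close>: \<open>F\<close> and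
  \<open>G\<close> are triangular bases of the residuals of \<open>A\<close> and \<open>B\<close>
  given \<open>C\<close>, and the matrices are their Gram matrices.\<close>

lemma indep_iff_orthogonal_bases:
  fixes a b :: "nat \<Rightarrow> int \<times> int"
  assumes "\<And>k. k < N \<Longrightarrow> exps (F k) \<subseteq> a ` {..k} \<union> C \<and> coef (F k) (a k) \<noteq> 0 \<and> perp (F k) C"
    and "\<And>l. l < M \<Longrightarrow> exps (G l) \<subseteq> b ` {..l} \<union> C \<and> coef (G l) (b l) \<noteq> 0 \<and> perp (G l) C"
    and "A = a ` {..<N}" "B = b ` {..<M}"
  shows "indep C A B \<longleftrightarrow> (\<forall>k<N. \<forall>l<M. ip (F k) (G l) = 0)"
proof
  assume I: "indep C A B"
  show "\<forall>k<N. \<forall>l<M. ip (F k) (G l) = 0"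
  proof (intro allI impI)
    fix k l assume kl: "k < N" "l < M"
    have "a ` {..k} \<union> C \<subseteq> A \<union> C" "b ` {..l} \<union> C \<subseteq> B \<union> C" using kl assms(3,4) by auto
    then have keys: "exps (F k) \<subseteq> A \<union> C" "exps (G l) \<subseteq> B \<union> C"
      using assms(1,2) kl by (metis order_trans)+
    then have "perp (F k) (B \<union> C)" using indepD[OF I] assms(1)[OF kl(1)] by (simp add: perp_Un)
    then show "ip (F k) (G l) = 0" using keys(2) by (rule perpD)
  qed
next
  assume O: "\<forall>k<N. \<forall>l<M. ip (F k) (G l) = 0"
  show "indep C A B"
    unfolding indep_def
  proof (intro allI impI, elim conjE)
    fix f assume f: "exps f \<subseteq> A \<union> C" "perp f C"
    have "ip f (G l) = 0" if "l < M" for l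
    proof (rule triangular[of N F a C "G l" f])
      fix k assume "k < N"
      then show "exps (F k) \<subseteq> a ` {..k} \<union> C \<and> coef (F k) (a k) \<noteq> 0 \<and> ip (F k) (G l) = 0"
        using assms(1) O that by blast
    qed (use assms(2)[OF that] f(1) assms(3) in simp_all)
    then have fG: "ip (G l) f = 0" if "l < M" for l using that ip_commute_eq_0 by blast
    have "ip (mon c) f = 0" if "c \<in> B" for c
    proof (rule triangular[of M G b C f "mon c"])
      fix l assume "l < M"
      then show "exps (G l) \<subseteq> b ` {..l} \<union> C \<and> coef (G l) (b l) \<noteq> 0 \<and> ip (G l) f = 0"
        using assms(2) fG by blast
    qed (use that f(2) assms(4) in auto)
    then show "perp f B" using ip_commute_eq_0 by (auto simp: perp_def)
  qed
qed

lemma perp_reflect: "perp (mon t * ladj f) S \<longleftrightarrow> perp f ((-) t ` S)"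
proof -
  have "(-) t ` S = uminus ` (+) (- t) ` S" by (auto simp: image_image)
  then show ?thesis by (simp add: perp_mon perp_ladj)
qed

lemma keys_reflect: "exps (mon t * ladj f) = (-) t ` exps f"
  by (auto simp: keys_mon_mult keys_ladj image_image)

lemma mat_inner_column:
  assumes "X \<in> carrier_mat r 1" "Y \<in> carrier_mat c 1"
  shows "mat_inner L X Y \<in> carrier_mat r c"
    and "i < r \<Longrightarrow> j < c \<Longrightarrow> mat_inner L X Y $$ (i, j) = ip (X $$ (i, 0)) (Y $$ (j, 0))"
  using assms by (auto simp: mat_inner_def mat_ladj_def ip_def scalar_prod_def)

lemma transpose_reversal:
  assumes "X \<in> carrier_mat r 1"
  shows "transpose_mat (reversal a b X) \<in> carrier_mat r 1"
    and "i < r \<Longrightarrow> transpose_mat (reversal a b X) $$ (i, 0) = monom2 a b * ladj (X $$ (i, 0))"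
  using assms by (auto simp: reversal_def mat_ladj_def)

lemma Phi_carrier: "Phi L a b \<in> carrier_mat (b + 1) 1" "Phi_rev L a b \<in> carrier_mat (a + 1) 1"
  by (auto simp: Phi_def Phi_rev_def)

lemma Phi_index:
  "r < b + 1 \<Longrightarrow> Phi L a b $$ (r, 0) = phi L a b (b - r)"
  "r < a + 1 \<Longrightarrow> Phi_rev L a b $$ (r, 0) = phi_rev L a b (a - r)"
  by (auto simp: Phi_def Phi_rev_def)

lemma K_mat_index:
  assumes "i \<ge> 1" "j \<ge> 1"
  shows "K_mat L i j \<in> carrier_mat j i"
    and "r < j \<Longrightarrow> c < i \<Longrightarrow> K_mat L i j $$ (r, c) = ip (phi L i (j - 1) (j - Suc r)) (phi_rev L (i - 1) j (i - Suc c))"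
  using assms mat_inner_column[OF Phi_carrier(1)[of i "j - 1"] Phi_carrier(2)[of "i - 1" j]]
  by (auto simp: K_mat_def Phi_index)

text \<open>The entries of \<open>Phi L i (j - 1)\<close> and of \<open>Phi_rev L (i - 1) j\<close>
  are residuals with respect to one and the same rectangle; this is why the two orders are paired
  with these shifted degrees.\<close>

lemma ciK_iff_K_mat:
  assumes "i \<ge> 1" "j \<ge> 1"
  shows "K_mat L i j = 0\<^sub>m j i \<longleftrightarrow> ciK (int i) (int j)"
proof -
  let ?C = "{0..int i - 1} \<times> {0..int j - 1}"
  have "K_mat L i j = 0\<^sub>m j i \<longleftrightarrow>
      (\<forall>r<j. \<forall>c<i. ip (phi L i (j - 1) (j - Suc r)) (phi_rev L (i - 1) j (i - Suc c)) = 0)"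
    using K_mat_index[OF assms] by (auto simp: mat_eq_zero_iff)
  also have "\<dots> \<longleftrightarrow> (\<forall>k<j. \<forall>l<i. ip (phi L i (j - 1) k) (phi_rev L (i - 1) j l) = 0)"
    by (rule all_less_rev2)
  also have "\<dots> \<longleftrightarrow> indep ?C ({int i} \<times> {0..int j - 1}) ({0..int i - 1} \<times> {int j})"
  proof (rule indep_iff_orthogonal_bases[symmetric, where a = "\<lambda>k. (int i, int k)" and b = "\<lambda>l. (int l, int j)"])
    fix k assume "k < j"
    then have *: "is_orthopoly ({0..int i - 1} \<times> {0..int j - 1} \<union> {int i} \<times> {0..int k}) (int i, int k) (phi L i (j - 1) k)"
      using phi_is[of k "j - 1" i] assms by (simp add: of_nat_diff)
    then show "exps (phi L i (j - 1) k) \<subseteq> (\<lambda>k. (int i, int k)) ` {..k} \<union> ?C \<and>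
        coef (phi L i (j - 1) k) (int i, int k) \<noteq> 0 \<and> perp (phi L i (j - 1) k) ?C"
      using is_orthopolyD(1,2)[OF *] unfolding family_image
      by (intro conjI is_orthopolyD(3)[OF *]) auto
  next
    fix l assume "l < i"
    then have *: "is_orthopoly ({0..int i - 1} \<times> {0..int j - 1} \<union> {0..int l} \<times> {int j}) (int l, int j) (phi_rev L (i - 1) j l)"
      using phi_rev_is[of l "i - 1" j] assms by (simp add: of_nat_diff)
    then show "exps (phi_rev L (i - 1) j l) \<subseteq> (\<lambda>l. (int l, int j)) ` {..l} \<union> ?C \<and>
        coef (phi_rev L (i - 1) j l) (int l, int j) \<noteq> 0 \<and> perp (phi_rev L (i - 1) j l) ?C"
      using is_orthopolyD(1,2)[OF *] unfolding family_image
      by (intro conjI is_orthopolyD(3)[OF *]) auto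
  next
    show "{int i} \<times> {0..int j - 1} = (\<lambda>k. (int i, int k)) ` {..<j}"
      by (simp add: family_image)
    show "{0..int i - 1} \<times> {int j} = (\<lambda>l. (int l, int j)) ` {..<i}"
      by (simp add: family_image)
  qed
  finally show ?thesis by (simp add: ciK_def)
qed

lemma reflected_orthopoly:
  assumes "is_orthopoly S a p" "T = (-) t ` S" "b = t - a"
  shows "exps (mon t * ladj p) \<subseteq> T" "coef (mon t * ladj p) b \<noteq> 0"
    "perp (mon t * ladj p) (T - {b})"
proof -
  have p: "exps p \<subseteq> S" "coef p a > 0" "perp p (S - {a})"
    using assms(1) by (auto simp: is_orthopoly_def)
  have inj: "inj ((-) t)" by (auto simp: inj_def)
  show "exps (mon t * ladj p) \<subseteq> T"
    unfolding keys_reflect assms(2) using p(1) by (rule image_mono)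
  show "coef (mon t * ladj p) b \<noteq> 0" using p(2) assms(3) by auto
  have "T - {b} = (-) t ` (S - {a})"
    unfolding assms(2,3) by (simp add: image_set_diff[OF inj])
  then have "(-) t ` (T - {b}) = S - {a}" by (simp add: image_image)
  then show "perp (mon t * ladj p) (T - {b})" using p(3) by (simp add: perp_reflect)
qed

lemma shifted_orthopoly:
  assumes "is_orthopoly S a p" "T = (+) t ` S" "b = t + a"
  shows "exps (mon t * p) \<subseteq> T" "coef (mon t * p) b \<noteq> 0"
    "perp (mon t * p) (T - {b})"
proof -
  have p: "exps p \<subseteq> S" "coef p a > 0" "perp p (S - {a})"
    using assms(1) by (auto simp: is_orthopoly_def)
  have inj: "inj ((+) t)" by (auto simp: inj_def)
  show "exps (mon t * p) \<subseteq> T"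
    unfolding keys_mon_mult assms(2) using p(1) by (rule image_mono)
  show "coef (mon t * p) b \<noteq> 0" using p(2) assms(3) by auto
  have "T - {b} = (+) t ` (S - {a})"
    unfolding assms(2,3) by (simp add: image_set_diff[OF inj])
  then have "(+) (- t) ` (T - {b}) = S - {a}" by (simp add: image_image)
  then show "perp (mon t * p) (T - {b})" using p(3) by (simp add: perp_mon)
qed

lemma E_hat_index:
  "E_hat L (Suc i) j \<in> carrier_mat (Suc j) (Suc j)"
  "r < Suc j \<Longrightarrow> c < Suc j \<Longrightarrow> E_hat L (Suc i) j $$ (r, c) =
     ip (mon (1, 0) * phi L i j (Suc j - Suc r)) (mon (int i, int j) * ladj (phi L i j (Suc j - Suc c)))"
proof -
  have a: "mon (1, 0) \<cdot>\<^sub>m Phi L i j \<in> carrier_mat (Suc j) 1" using Phi_carrier(1)[of i j] by simp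
  have c: "Phi L i j \<in> carrier_mat (Suc j) 1" using Phi_carrier(1)[of i j] by simp
  note * = mat_inner_column[OF a transpose_reversal(1)[OF c, of i j]]
  show "E_hat L (Suc i) j \<in> carrier_mat (Suc j) (Suc j)"
    using * Phi_carrier(1)[of i j] by (simp add: E_hat_def)
  show "r < Suc j \<Longrightarrow> c < Suc j \<Longrightarrow> E_hat L (Suc i) j $$ (r, c) =
     ip (mon (1, 0) * phi L i j (Suc j - Suc r)) (mon (int i, int j) * ladj (phi L i j (Suc j - Suc c)))"
    using * Phi_carrier(1)[of i j] transpose_reversal(2)[of "Phi L i j" "Suc j" c i j]
    by (simp add: E_hat_def Phi_index)
qed

text \<open>Multiplication by z moves the residuals of column \<open>i\<close> to column
  \<open>i + 1\<close>, reversal moves them to column 0, and both then have columns 1 to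
  \<open>i\<close> as conditioning set. Reversal also turns the order around, hence the exponents
  \<open>int j - int l\<close>.\<close>

lemma ciZ_iff_E_hat: "E_hat L (Suc i) j = 0\<^sub>m (Suc j) (Suc j) \<longleftrightarrow> ciZ (int i) (int j)"
proof -
  let ?C = "{1..int i} \<times> {0..int j}"
  let ?F = "\<lambda>k. mon (1, 0) * phi L i j k" and ?G = "\<lambda>l. mon (int i, int j) * ladj (phi L i j l)"
  have "E_hat L (Suc i) j = 0\<^sub>m (Suc j) (Suc j) \<longleftrightarrow>
      (\<forall>r<Suc j. \<forall>c<Suc j. ip (?F (Suc j - Suc r)) (?G (Suc j - Suc c)) = 0)"
    using E_hat_index by (auto simp: mat_eq_zero_iff)
  also have "\<dots> \<longleftrightarrow> (\<forall>k<Suc j. \<forall>l<Suc j. ip (?F k) (?G l) = 0)"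
    by (rule all_less_rev2)
  also have "\<dots> \<longleftrightarrow> indep ?C ({int i + 1} \<times> {0..int j}) ({0} \<times> {0..int j})"
  proof (rule indep_iff_orthogonal_bases[symmetric, where a = "\<lambda>k. (int i + 1, int k)" and b = "\<lambda>l. (0, int j - int l)"])
    fix k assume "k < Suc j"
    then have p: "is_orthopoly ({0..int i - 1} \<times> {0..int j} \<union> {int i} \<times> {0..int k}) (int i, int k) (phi L i j k)"
      by (intro phi_is) simp
    have "?C \<union> {int i + 1} \<times> {0..int k} = (+) (1, 0) ` ({0..int i - 1} \<times> {0..int j} \<union> {int i} \<times> {0..int k})"
      by (simp add: box_shift image_Un)
    note * = shifted_orthopoly[OF p this, of "(int i + 1, int k)"]
    show "exps (?F k) \<subseteq> (\<lambda>k. (int i + 1, int k)) ` {..k} \<union> ?C \<and>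
        coef (?F k) (int i + 1, int k) \<noteq> 0 \<and> perp (?F k) ?C"
      using *(1,2) unfolding family_image by (intro conjI perp_mono[OF *(3)]) auto
  next
    fix l assume "l < Suc j"
    then have p: "is_orthopoly ({0..int i - 1} \<times> {0..int j} \<union> {int i} \<times> {0..int l}) (int i, int l) (phi L i j l)"
      by (intro phi_is) simp
    have "?C \<union> {0} \<times> {int j - int l..int j} = (-) (int i, int j) ` ({0..int i - 1} \<times> {0..int j} \<union> {int i} \<times> {0..int l})"
      by (simp add: box_reflect image_Un)
    note * = reflected_orthopoly[OF p this, of "(0, int j - int l)"]
    show "exps (?G l) \<subseteq> (\<lambda>l. (0, int j - int l)) ` {..l} \<union> ?C \<and>
        coef (?G l) (0, int j - int l) \<noteq> 0 \<and> perp (?G l) ?C"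
      using *(1,2) unfolding family_image by (intro conjI perp_mono[OF *(3)]) auto
  qed (simp_all add: family_image)
  also have "\<dots> \<longleftrightarrow> indep ?C ({0} \<times> {0..int j}) ({int i + 1} \<times> {0..int j})"
    using indep_sym[of ?C] by auto
  finally show ?thesis by (simp add: ciZ_def)
qed

lemma E_hat_rev_index:
  "E_hat_rev L i (Suc j) \<in> carrier_mat (Suc i) (Suc i)"
  "r < Suc i \<Longrightarrow> c < Suc i \<Longrightarrow> E_hat_rev L i (Suc j) $$ (r, c) =
     ip (mon (0, 1) * phi_rev L i j (Suc i - Suc r)) (mon (int i, int j) * ladj (phi_rev L i j (Suc i - Suc c)))"
proof -
  have a: "mon (0, 1) \<cdot>\<^sub>m Phi_rev L i j \<in> carrier_mat (Suc i) 1" using Phi_carrier(2)[of i j] by simp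
  have c: "Phi_rev L i j \<in> carrier_mat (Suc i) 1" using Phi_carrier(2)[of i j] by simp
  note * = mat_inner_column[OF a transpose_reversal(1)[OF c, of i j]]
  show "E_hat_rev L i (Suc j) \<in> carrier_mat (Suc i) (Suc i)"
    using * Phi_carrier(2)[of i j] by (simp add: E_hat_rev_def)
  show "r < Suc i \<Longrightarrow> c < Suc i \<Longrightarrow> E_hat_rev L i (Suc j) $$ (r, c) =
     ip (mon (0, 1) * phi_rev L i j (Suc i - Suc r)) (mon (int i, int j) * ladj (phi_rev L i j (Suc i - Suc c)))"
    using * Phi_carrier(2)[of i j] transpose_reversal(2)[of "Phi_rev L i j" "Suc i" c i j]
    by (simp add: E_hat_rev_def Phi_index)
qed

lemma ciW_iff_E_hat_rev: "E_hat_rev L i (Suc j) = 0\<^sub>m (Suc i) (Suc i) \<longleftrightarrow> ciW (int i) (int j)"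
proof -
  let ?C = "{0..int i} \<times> {1..int j}"
  let ?F = "\<lambda>k. mon (0, 1) * phi_rev L i j k" and ?G = "\<lambda>l. mon (int i, int j) * ladj (phi_rev L i j l)"
  have "E_hat_rev L i (Suc j) = 0\<^sub>m (Suc i) (Suc i) \<longleftrightarrow>
      (\<forall>r<Suc i. \<forall>c<Suc i. ip (?F (Suc i - Suc r)) (?G (Suc i - Suc c)) = 0)"
    using E_hat_rev_index by (auto simp: mat_eq_zero_iff)
  also have "\<dots> \<longleftrightarrow> (\<forall>k<Suc i. \<forall>l<Suc i. ip (?F k) (?G l) = 0)"
    by (rule all_less_rev2)
  also have "\<dots> \<longleftrightarrow> indep ?C ({0..int i} \<times> {int j + 1}) ({0..int i} \<times> {0})"
  proof (rule indep_iff_orthogonal_bases[symmetric, where a = "\<lambda>k. (int k, int j + 1)" and b = "\<lambda>l. (int i - int l, 0)"])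
    fix k assume "k < Suc i"
    then have p: "is_orthopoly ({0..int i} \<times> {0..int j - 1} \<union> {0..int k} \<times> {int j}) (int k, int j) (phi_rev L i j k)"
      by (intro phi_rev_is) simp
    have "?C \<union> {0..int k} \<times> {int j + 1} = (+) (0, 1) ` ({0..int i} \<times> {0..int j - 1} \<union> {0..int k} \<times> {int j})"
      by (simp add: box_shift image_Un)
    note * = shifted_orthopoly[OF p this, of "(int k, int j + 1)"]
    show "exps (?F k) \<subseteq> (\<lambda>k. (int k, int j + 1)) ` {..k} \<union> ?C \<and>
        coef (?F k) (int k, int j + 1) \<noteq> 0 \<and> perp (?F k) ?C"
      using *(1,2) unfolding family_image by (intro conjI perp_mono[OF *(3)]) auto
  next
    fix l assume "l < Suc i"
    then have p: "is_orthopoly ({0..int i} \<times> {0..int j - 1} \<union> {0..int l} \<times> {int j}) (int l, int j) (phi_rev L i j l)"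
      by (intro phi_rev_is) simp
    have "?C \<union> {int i - int l..int i} \<times> {0} = (-) (int i, int j) ` ({0..int i} \<times> {0..int j - 1} \<union> {0..int l} \<times> {int j})"
      by (simp add: box_reflect image_Un)
    note * = reflected_orthopoly[OF p this, of "(int i - int l, 0)"]
    show "exps (?G l) \<subseteq> (\<lambda>l. (int i - int l, 0)) ` {..l} \<union> ?C \<and>
        coef (?G l) (int i - int l, 0) \<noteq> 0 \<and> perp (?G l) ?C"
      using *(1,2) unfolding family_image by (intro conjI perp_mono[OF *(3)]) auto
  qed (simp_all add: family_image)
  also have "\<dots> \<longleftrightarrow> indep ?C ({0..int i} \<times> {0}) ({0..int i} \<times> {int j + 1})"
    using indep_sym[of ?C] by auto
  finally show ?thesis by (simp add: ciW_def)
qed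

end

section \<open>Triangular matrices and the scalar parameters\<close>

lemma index_mult_mat_sum:
  assumes "A \<in> carrier_mat a b" "B \<in> carrier_mat b c" "i < a" "j < c"
  shows "(A * B) $$ (i, j) = (\<Sum>k = 0..<b. A $$ (i, k) * B $$ (k, j))"
  using assms by (simp add: scalar_prod_def)

lemma triangular_mat_inverse:
  fixes A :: "complex mat"
  assumes A: "A \<in> carrier_mat n n" and d: "\<And>i. i < n \<Longrightarrow> A $$ (i, i) \<noteq> 0"
    and tri: "(\<forall>i j. i < j \<longrightarrow> j < n \<longrightarrow> A $$ (i, j) = 0) \<or> (\<forall>i j. j < i \<longrightarrow> i < n \<longrightarrow> A $$ (i, j) = 0)"
  obtains B where "mat_inverse A = Some B" "B \<in> carrier_mat n n" "A * B = 1\<^sub>m n" "B * A = 1\<^sub>m n"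
proof -
  have "det A = prod_list (diag_mat A)"
    using tri
  proof
    assume "\<forall>i j. i < j \<longrightarrow> j < n \<longrightarrow> A $$ (i, j) = 0"
    then show ?thesis by (intro det_lower_triangular[OF _ A]) auto
  next
    assume "\<forall>i j. j < i \<longrightarrow> i < n \<longrightarrow> A $$ (i, j) = 0"
    then show ?thesis using A by (intro det_upper_triangular[OF _ A]) auto
  qed
  moreover have "0 \<notin> set (diag_mat A)"
    using A d by (auto simp: diag_mat_def)
  ultimately have "det A \<noteq> 0" by (simp add: prod_list_zero_iff)
  then have "A \<in> Units (ring_mat TYPE(complex) n ())" by (rule det_non_zero_imp_unit[OF A])
  then obtain B where "mat_inverse A = Some B"
    using mat_inverse(1)[OF A, of "()"] by (cases "mat_inverse A") auto
  then show ?thesis using mat_inverse(2)[OF A] that by blast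
qed

text \<open>Only the last row of this inverse enters the bottom right entry in \<open>u_neg\<close>.
  In the last row of \<open>A * B = 1\<close>, triangularity leaves one term.\<close>

lemma upper_triangular_inverse_last_row:
  fixes A :: "complex mat"
  assumes A: "A \<in> carrier_mat (Suc n) (Suc n)" and d: "\<And>i. i \<le> n \<Longrightarrow> A $$ (i, i) \<noteq> 0"
    and tri: "\<And>i j. j < i \<Longrightarrow> i \<le> n \<Longrightarrow> A $$ (i, j) = 0"
  shows "the (mat_inverse A) \<in> carrier_mat (Suc n) (Suc n)"
    and "c \<le> n \<Longrightarrow> the (mat_inverse A) $$ (n, c) = (if c = n then 1 / A $$ (n, n) else 0)"
proof -
  obtain B where B: "mat_inverse A = Some B" "B \<in> carrier_mat (Suc n) (Suc n)" "A * B = 1\<^sub>m (Suc n)"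
    using triangular_mat_inverse[OF A] d tri by (metis less_Suc_eq_le)
  then show "the (mat_inverse A) \<in> carrier_mat (Suc n) (Suc n)" by simp
  assume c: "c \<le> n"
  have "(A * B) $$ (n, c) = (\<Sum>k = 0..<Suc n. A $$ (n, k) * B $$ (k, c))"
    using c by (intro index_mult_mat_sum[OF A B(2)]) simp_all
  also have "\<dots> = A $$ (n, n) * B $$ (n, c)"
    using tri by (subst sum.atLeast0_lessThan_Suc) (auto intro: sum.neutral)
  finally show "the (mat_inverse A) $$ (n, c) = (if c = n then 1 / A $$ (n, n) else 0)"
    using B c d[of n] by (auto simp: field_simps)
qed

lemma lower_triangular_inverse_last_col:
  fixes A :: "complex mat"
  assumes A: "A \<in> carrier_mat (Suc n) (Suc n)" and d: "\<And>i. i \<le> n \<Longrightarrow> A $$ (i, i) \<noteq> 0"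
    and tri: "\<And>i j. i < j \<Longrightarrow> j \<le> n \<Longrightarrow> A $$ (i, j) = 0"
  shows "the (mat_inverse A) \<in> carrier_mat (Suc n) (Suc n)"
    and "r \<le> n \<Longrightarrow> the (mat_inverse A) $$ (r, n) = (if r = n then 1 / A $$ (n, n) else 0)"
proof -
  obtain B where B: "mat_inverse A = Some B" "B \<in> carrier_mat (Suc n) (Suc n)" "B * A = 1\<^sub>m (Suc n)"
    using triangular_mat_inverse[OF A] d tri by (metis less_Suc_eq_le)
  then show "the (mat_inverse A) \<in> carrier_mat (Suc n) (Suc n)" by simp
  assume r: "r \<le> n"
  have "(B * A) $$ (r, n) = (\<Sum>k = 0..<Suc n. B $$ (r, k) * A $$ (k, n))"
    using r by (intro index_mult_mat_sum[OF B(2) A]) simp_all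
  also have "\<dots> = B $$ (r, n) * A $$ (n, n)"
    using tri by (subst sum.atLeast0_lessThan_Suc) (auto intro: sum.neutral)
  finally show "the (mat_inverse A) $$ (r, n) = (if r = n then 1 / A $$ (n, n) else 0)"
    using B r d[of n] by (auto simp: field_simps)
qed

lemma last_entry_triple_product:
  fixes X K Y :: "complex mat"
  assumes "X \<in> carrier_mat (Suc n) (Suc n)" "K \<in> carrier_mat (Suc n) (Suc m)" "Y \<in> carrier_mat (Suc m) (Suc m)"
    and "\<And>c. c < n \<Longrightarrow> X $$ (n, c) = 0" "\<And>r. r < m \<Longrightarrow> Y $$ (r, m) = 0"
  shows "(X * K * Y) $$ (n, m) = X $$ (n, n) * K $$ (n, m) * Y $$ (m, m)"
proof -
  have XK: "(X * K) $$ (n, k) = X $$ (n, n) * K $$ (n, k)" if "k < Suc m" for k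
  proof -
    have "(X * K) $$ (n, k) = (\<Sum>l = 0..<Suc n. X $$ (n, l) * K $$ (l, k))"
      using that by (intro index_mult_mat_sum[OF assms(1,2)]) simp_all
    then show ?thesis using assms(4) by (subst (asm) sum.atLeast0_lessThan_Suc) (simp add: sum.neutral)
  qed
  have "(X * K * Y) $$ (n, m) = (\<Sum>k = 0..<Suc m. (X * K) $$ (n, k) * Y $$ (k, m))"
    by (intro index_mult_mat_sum[OF mult_carrier_mat[OF assms(1,2)] assms(3)]) simp_all
  then show ?thesis using assms(5) XK by (subst (asm) sum.atLeast0_lessThan_Suc) (simp add: sum.neutral)
qed

context pd_form
begin

text \<open>Under the premise the residual \<open>\<alpha>\<close> is orthogonal to all of
  \<open>Y\<close>, so \<open>ip \<alpha> \<beta>\<close> reduces to a nonzero multiple of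
  \<open>ip \<alpha> (mon q)\<close>. Every other residual of \<open>p\<close> given
  \<open>X\<close> is a multiple of \<open>\<alpha>\<close>.\<close>

lemma residual_conditions:
  assumes "exps \<alpha> \<subseteq> insert p X" "coef \<alpha> p \<noteq> 0" "perp \<alpha> X"
    and "exps \<beta> \<subseteq> insert q Y" "coef \<beta> q \<noteq> 0" "Y \<subseteq> X \<union> D" "q \<notin> Y"
    and "ip \<alpha> \<beta> = 0"
  shows "indep X {p} D \<longrightarrow> indep X {p} {q}"
proof
  assume I: "indep X {p} D"
  have "perp \<alpha> (X \<union> D)"
    using indepD[OF I, of \<alpha>] assms(1,3) by (auto simp: perp_Un)
  then have Y: "perp \<alpha> Y" using assms(6) by (rule perp_mono)
  let ?b = "coef \<beta> q"
  have "exps (\<beta> - cst ?b * mon q) \<subseteq> insert q Y"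
    using assms(4) by (intro keys_subset_diff keys_subset_cst) auto
  moreover have "q \<notin> exps (\<beta> - cst ?b * mon q)"
    by (simp add: in_keys_iff lookup_minus)
  ultimately have "exps (\<beta> - cst ?b * mon q) \<subseteq> Y" by auto
  then have "ip \<alpha> (\<beta> - cst ?b * mon q) = 0" by (rule perpD[OF Y])
  then have "ip \<alpha> (mon q) = 0" using assms(5,8) by (simp add: ip_linear)
  then have "ip (mon q) \<alpha> = 0" using ip_commute_eq_0 by blast
  show "indep X {p} {q}"
    unfolding indep_def
  proof (intro allI impI, elim conjE)
    fix f assume f: "exps f \<subseteq> {p} \<union> X" "perp f X"
    define t where "t = coef f p / coef \<alpha> p"
    have "exps (f - cst t * \<alpha>) \<subseteq> insert p X"
      using f(1) assms(1) by (intro keys_subset_diff keys_subset_cst) auto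
    moreover have "p \<notin> exps (f - cst t * \<alpha>)"
      using assms(2) by (simp add: in_keys_iff lookup_minus t_def)
    ultimately have "exps (f - cst t * \<alpha>) \<subseteq> X" by auto
    moreover have "perp (f - cst t * \<alpha>) X" using f(2) assms(3) by (intro perp_diff perp_cst)
    ultimately have "f - cst t * \<alpha> = 0" by (intro perp_self)
    then have "f = cst t * \<alpha>" by simp
    then show "perp f {q}" using \<open>ip \<alpha> (mon q) = 0\<close> by (simp add: perp_def ip_linear)
  qed
qed

text \<open>\<open>ip f (ladj g) = L (f * g)\<close> is symmetric in \<open>f\<close> and
  \<open>g\<close>. Hence u_{i,j} is at once a pairing in the w-direction and one in the
  z-direction, and its vanishing yields both \<open>ciU\<close> and \<open>ciU'\<close>.\<close>

lemma ip_mon_reflect_swap: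
  assumes "s - t = s' - t'"
  shows "ip (mon s * f) (mon t * ladj g) = ip (mon s' * g) (mon t' * ladj f)"
proof -
  have *: "ip (mon s * f) (mon t * ladj g) = L (mon (s - t) * (f * g))" for s t f g
  proof -
    have "mon s * f * (mon (- t) * g) = mon s * mon (- t) * (f * g)" by (simp only: ac_simps)
    then show ?thesis by (simp add: ip_def ladj_mult_single mult_single)
  qed
  show ?thesis unfolding * assms by (simp only: mult.commute)
qed

lemma u_pos_eq_0_iff:
  "u_pos L (Suc i) (Suc j) = 0 \<longleftrightarrow>
     ip (mon (0, 1) * phi L (Suc i) j j) (mon (int i, int (Suc j)) * ladj (phi_rev L i (Suc j) i)) = 0"
proof -
  have a: "mon (0, 1) \<cdot>\<^sub>m Phi L (Suc i) j \<in> carrier_mat (Suc j) 1" using Phi_carrier(1)[of "Suc i" j] by simp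
  have c: "Phi_rev L i (Suc j) \<in> carrier_mat (Suc i) 1" using Phi_carrier(2)[of i "Suc j"] by simp
  have "K1_mat L (Suc i) (Suc j) $$ (0, 0) =
      ip (mon (0, 1) * phi L (Suc i) j j) (mon (int i, int (Suc j)) * ladj (phi_rev L i (Suc j) i))"
    using mat_inner_column(2)[OF a transpose_reversal(1)[OF c, of i "Suc j"], of 0 0]
      transpose_reversal(2)[OF c, of 0 i "Suc j"] Phi_carrier(1)[of "Suc i" j]
    by (simp add: K1_mat_def Phi_index)
  then show ?thesis by (simp add: u_pos_def)
qed

lemma u_pos_imp_ciU:
  assumes "u_pos L (Suc i) (Suc j) = 0"
  shows "ciU (int i + 1) (int j + 1)" "ciU' (int i + 1) (int j + 1)"
proof -
  let ?S = "{0..int i} \<times> {0..int j} \<union> {int i + 1} \<times> {0..int j}"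
  let ?S' = "{0..int i} \<times> {0..int j} \<union> {0..int i} \<times> {int j + 1}"
  have f: "is_orthopoly ?S (int i + 1, int j) (phi L (Suc i) j j)"
    using phi_is[of j j "Suc i"] by (simp add: add.commute)
  have g: "is_orthopoly ?S' (int i, int j + 1) (phi_rev L i (Suc j) i)"
    using phi_rev_is[of i i "Suc j"] by (simp add: add.commute)
  have ip1: "ip (mon (0, 1) * phi L (Suc i) j j) (mon (int i, int j + 1) * ladj (phi_rev L i (Suc j) i)) = 0"
    using assms u_pos_eq_0_iff[of i j] by (simp add: add.commute)
  then have ip2: "ip (mon (1, 0) * phi_rev L i (Suc j) i) (mon (int i + 1, int j) * ladj (phi L (Suc i) j j)) = 0"
    using ip_mon_reflect_swap[of "(0, 1)" "(int i, int j + 1)" "(1, 0)" "(int i + 1, int j)"] by simp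
  show "ciU (int i + 1) (int j + 1)"
  proof -
    let ?T = "{0..int i} \<times> {1..int j + 1} \<union> {int i + 1} \<times> {1..int j + 1}"
    let ?T' = "{0..int i} \<times> {1..int j + 1} \<union> {0..int i} \<times> {0}"
    have T: "?T = (+) (0, 1) ` ?S" "?T' = (-) (int i, int j + 1) ` ?S'"
      by (simp_all add: image_Un box_shift box_reflect)
    have b: "(int i + 1, int j + 1) = (0, 1) + (int i + 1, int j)" "(0, 0) = (int i, int j + 1) - (int i, int j + 1)"
      by (simp_all add: zero_prod_def)
    note * = shifted_orthopoly[OF f T(1) b(1)] reflected_orthopoly[OF g T(2) b(2)]
    have X: "?T - {(int i + 1, int j + 1)} = {0..int i + 1} \<times> {1..int j} \<union> {0..int i} \<times> {int j + 1}" (is "_ = ?X")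
      by auto
    \<comment> \<open>The set \<open>D\<close> of the criterion consists of the exponents available
      to the reversed polynomial that are neither in \<open>?X\<close> nor the origin.\<close>
    have "indep ?X {(int i + 1, int j + 1)} ({1..int i} \<times> {0}) \<longrightarrow> indep ?X {(int i + 1, int j + 1)} {(0, 0)}"
    proof (rule residual_conditions[OF _ *(2) _ _ *(5) _ _ ip1, where Y = "?T' - {(0, 0)}"])
      show "exps (mon (0, 1) * phi L (Suc i) j j) \<subseteq> insert (int i + 1, int j + 1) ?X"
        unfolding X[symmetric] insert_Diff_single using *(1) by (rule subset_insertI2)
      show "perp (mon (0, 1) * phi L (Suc i) j j) ?X"
        unfolding X[symmetric] by (rule *(3))
      show "exps (mon (int i, int j + 1) * ladj (phi_rev L i (Suc j) i)) \<subseteq> insert (0, 0) (?T' - {(0, 0)})"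
        unfolding insert_Diff_single by (rule subset_insertI2[OF *(4)])
    qed auto
    then show ?thesis by (simp add: ciU_def)
  qed
  show "ciU' (int i + 1) (int j + 1)"
  proof -
    let ?T = "{1..int i + 1} \<times> {0..int j} \<union> {1..int i + 1} \<times> {int j + 1}"
    let ?T' = "{1..int i + 1} \<times> {0..int j} \<union> {0} \<times> {0..int j}"
    have T: "?T = (+) (1, 0) ` ?S'" "?T' = (-) (int i + 1, int j) ` ?S"
      by (simp_all add: image_Un box_shift box_reflect)
    have b: "(int i + 1, int j + 1) = (1, 0) + (int i, int j + 1)" "(0, 0) = (int i + 1, int j) - (int i + 1, int j)"
      by (simp_all add: zero_prod_def)
    note * = shifted_orthopoly[OF g T(1) b(1)] reflected_orthopoly[OF f T(2) b(2)]
    have X: "?T - {(int i + 1, int j + 1)} = {1..int i} \<times> {0..int j + 1} \<union> {int i + 1} \<times> {0..int j}" (is "_ = ?X")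
      by auto
    have "indep ?X {(int i + 1, int j + 1)} ({0} \<times> {1..int j}) \<longrightarrow> indep ?X {(int i + 1, int j + 1)} {(0, 0)}"
    proof (rule residual_conditions[OF _ *(2) _ _ *(5) _ _ ip2, where Y = "?T' - {(0, 0)}"])
      show "exps (mon (1, 0) * phi_rev L i (Suc j) i) \<subseteq> insert (int i + 1, int j + 1) ?X"
        unfolding X[symmetric] insert_Diff_single using *(1) by (rule subset_insertI2)
      show "perp (mon (1, 0) * phi_rev L i (Suc j) i) ?X"
        unfolding X[symmetric] by (rule *(3))
      show "exps (mon (int i + 1, int j) * ladj (phi L (Suc i) j j)) \<subseteq> insert (0, 0) (?T' - {(0, 0)})"
        unfolding insert_Diff_single by (rule subset_insertI2[OF *(4)])
    qed auto
    then show ?thesis by (simp add: ciU'_def)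
  qed
qed

text \<open>The inverses only scale the corner entry of \<open>K_mat\<close> by nonzero numbers.
  \<open>Phi\<close> lists its indices in descending order, which makes \<open>lead_mat\<close>
  upper triangular and the adjoint of \<open>lead_mat_rev\<close> lower triangular.\<close>

lemma u_neg_eq_0_iff:
  assumes "(i, j) \<noteq> (0, 0)"
  shows "u_neg L (Suc i) (Suc j) = 0 \<longleftrightarrow> ip (phi L (Suc i) j 0) (phi_rev L i (Suc j) 0) = 0"
proof -
  let ?A = "lead_mat L (Suc i) j" and ?B = "mat_adjoint (lead_mat_rev L i (Suc j))"
  have A: "?A \<in> carrier_mat (Suc j) (Suc j)" by (simp add: lead_mat_def)
  have A_index: "?A $$ (r, c) = coeff2 (phi L (Suc i) j (j - r)) (Suc i) (j - c)" if "r \<le> j" "c \<le> j" for r c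
    using that by (simp add: lead_mat_def Phi_index)
  have A_diag: "?A $$ (r, r) \<noteq> 0" if "r \<le> j" for r
    using is_orthopolyD(2)[OF phi_is[of "j - r" j "Suc i"]] that by (simp add: A_index)
  have A_tri: "?A $$ (r, c) = 0" if "c < r" "r \<le> j" for r c
    using lookup_outside[OF is_orthopolyD(1)[OF phi_is[of "j - r" j "Suc i"]], of "(int (Suc i), int (j - c))"] that
    by (simp add: A_index)
  have B: "?B \<in> carrier_mat (Suc i) (Suc i)"
    by (rule carrier_matI) (simp_all add: lead_mat_rev_def mat_adjoint_def)
  have B_index: "?B $$ (r, c) = cnj (coeff2 (phi_rev L i (Suc j) (i - c)) (i - r) (Suc j))" if "r \<le> i" "c \<le> i" for r c
    using that by (simp add: lead_mat_rev_def mat_adjoint_def mat_of_rows_index Phi_index)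
  have B_diag: "?B $$ (r, r) \<noteq> 0" if "r \<le> i" for r
    using is_orthopolyD(2)[OF phi_rev_is[of "i - r" i "Suc j"]] that by (simp add: B_index)
  have B_tri: "?B $$ (r, c) = 0" if "r < c" "c \<le> i" for r c
    using lookup_outside[OF is_orthopolyD(1)[OF phi_rev_is[of "i - c" i "Suc j"]], of "(int (i - r), int (Suc j))"] that
    by (simp add: B_index)
  note A' = upper_triangular_inverse_last_row[OF A A_diag A_tri]
  note B' = lower_triangular_inverse_last_col[OF B B_diag B_tri]
  have K: "K_mat L (Suc i) (Suc j) \<in> carrier_mat (Suc j) (Suc i)"
    "K_mat L (Suc i) (Suc j) $$ (j, i) = ip (phi L (Suc i) j 0) (phi_rev L i (Suc j) 0)"
    using K_mat_index[of "Suc i" "Suc j"] by simp_all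
  have "u_neg L (Suc i) (Suc j) = (the (mat_inverse ?A) * K_mat L (Suc i) (Suc j) * the (mat_inverse ?B)) $$ (j, i)"
    using assms by (auto simp: u_neg_def)
  also have "\<dots> = the (mat_inverse ?A) $$ (j, j) * K_mat L (Suc i) (Suc j) $$ (j, i) * the (mat_inverse ?B) $$ (i, i)"
    by (rule last_entry_triple_product[OF A'(1) K(1) B'(1)]) (use A'(2) B'(2) in auto)
  also have "\<dots> = 1 / ?A $$ (j, j) * ip (phi L (Suc i) j 0) (phi_rev L i (Suc j) 0) * (1 / ?B $$ (i, i))"
    using A'(2)[of j] B'(2)[of i] K(2) by simp
  finally show ?thesis using A_diag[of j] B_diag[of i] by simp
qed

lemma ciN_iff:
  "ciN (int i + 1) (int j + 1) \<longleftrightarrow> ip (phi L (Suc i) j 0) (phi_rev L i (Suc j) 0) = 0"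
proof -
  let ?C = "{0..int i} \<times> {0..int j}"
  have f: "is_orthopoly (?C \<union> {int i + 1} \<times> {0..0}) (int i + 1, 0) (phi L (Suc i) j 0)"
    using phi_is[of 0 j "Suc i"] by (simp add: add.commute)
  have g: "is_orthopoly (?C \<union> {0..0} \<times> {int j + 1}) (0, int j + 1) (phi_rev L i (Suc j) 0)"
    using phi_rev_is[of 0 i "Suc j"] by (simp add: add.commute)
  have "indep ?C {(int i + 1, 0)} {(0, int j + 1)} \<longleftrightarrow>
      (\<forall>k<Suc 0. \<forall>l<Suc 0. ip ((\<lambda>_. phi L (Suc i) j 0) k) ((\<lambda>_. phi_rev L i (Suc j) 0) l) = 0)"
  proof (rule indep_iff_orthogonal_bases[where a = "\<lambda>_. (int i + 1, 0)" and b = "\<lambda>_. (0, int j + 1)"])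
    show "exps (phi L (Suc i) j 0) \<subseteq> (\<lambda>_. (int i + 1, 0)) ` {..k} \<union> ?C \<and>
        coef (phi L (Suc i) j 0) (int i + 1, 0) \<noteq> 0 \<and> perp (phi L (Suc i) j 0) ?C" for k :: nat
      using is_orthopolyD(1,2)[OF f] by (intro conjI is_orthopolyD(3)[OF f]) auto
    show "exps (phi_rev L i (Suc j) 0) \<subseteq> (\<lambda>_. (0, int j + 1)) ` {..l} \<union> ?C \<and>
        coef (phi_rev L i (Suc j) 0) (0, int j + 1) \<noteq> 0 \<and> perp (phi_rev L i (Suc j) 0) ?C" for l :: nat
      using is_orthopolyD(1,2)[OF g] by (intro conjI is_orthopolyD(3)[OF g]) auto
  qed (simp_all add: lessThan_Suc)
  then show ?thesis by (simp add: ciN_def)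
qed

end

text \<open>The support would be closed under subtracting \<open>t\<close>, which is impossible for
  a nonempty finite set.\<close>

lemma fixed_by_shift_eq_0:
  fixes f :: laurent
  assumes f: "f = cst c * (mon t * f)" and t: "fst t > 0 \<or> snd t > 0"
  shows "f = 0"
proof (rule ccontr)
  assume "f \<noteq> 0"
  then have ne: "exps f \<noteq> {}" by simp
  have step: "a - t \<in> exps f" if "a \<in> exps f" for a
  proof -
    have "coef f a = c * coef f (a - t)"
      using arg_cong[OF f, of "\<lambda>g. coef g a"] by simp
    then show ?thesis using that by (auto simp: in_keys_iff)
  qed
  from t obtain g :: "int \<times> int \<Rightarrow> int" where g: "\<And>a. g (a - t) < g a"
  proof (cases "fst t > 0")
    case True
    then show ?thesis using that[of fst] by simp
  next
    case False
    then show ?thesis using that[of snd] t by simp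
  qed
  have "finite (g ` exps f)" by simp
  then obtain a where a: "a \<in> exps f" "g a = Min (g ` exps f)"
    using Min_in[of "g ` exps f"] ne by (auto simp del: Min_in)
  then have "g a \<le> g (a - t)" using step by auto
  with g[of a] show False by simp
qed

lemma keys_mon_mult_subset:
  "exps f \<subseteq> {a..b} \<times> {c..d} \<Longrightarrow> exps (mon (s, t) * f) \<subseteq> {a + s..b + s} \<times> {c + t..d + t}"
  unfolding keys_mon_mult box_shift(1)[symmetric] by (rule image_mono)

context pd_form
begin

subsection \<open>Orthogonality from the vanishing conditions\<close>

definition top_orthogonal :: "int \<Rightarrow> int \<Rightarrow> laurent \<Rightarrow> bool" where
  "top_orthogonal i j f \<longleftrightarrow>
     exps f \<subseteq> {0..i} \<times> {0..j} \<and> perp f ({0..i} \<times> {0..j} - {(i, j)})"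

text \<open>Multiplication by w clears row 0 of the support, and \<open>ciW\<close> then extends the
  orthogonality from rows 1 to \<open>j\<close> to row 0.\<close>

lemma top_orthogonal_w:
  assumes "ciW i j" "top_orthogonal i j f" "i \<ge> 0" "j \<ge> 0"
  shows "top_orthogonal i (j + 1) (mon (0, 1) * f)"
proof -
  let ?f = "mon (0, 1) * f"
  have f: "exps f \<subseteq> {0..i} \<times> {0..j}" "perp f ({0..i} \<times> {0..j} - {(i, j)})"
    using assms(2) by (auto simp: top_orthogonal_def)
  have keys: "exps ?f \<subseteq> {0..i} \<times> {1..j + 1}"
    using keys_mon_mult_subset[OF f(1), of 0 1] by simp
  have "(+) (- (0, 1)) ` ({0..i} \<times> {1..j + 1} - {(i, j + 1)}) \<subseteq> {0..i} \<times> {0..j} - {(i, j)}"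
    by auto
  then have 1: "perp ?f ({0..i} \<times> {1..j + 1} - {(i, j + 1)})"
    unfolding perp_mon using f(2) perp_mono by blast
  have "perp ?f ({0..i} \<times> {0})"
  proof (rule indepD[OF indep_sym[OF _ assms(1)[unfolded ciW_def]]])
    show "exps ?f \<subseteq> {0..i} \<times> {j + 1} \<union> {0..i} \<times> {1..j}"
      by (rule order_trans[OF keys]) auto
    show "perp ?f ({0..i} \<times> {1..j})" by (rule perp_mono[OF 1]) auto
  qed simp
  then have "perp ?f (({0..i} \<times> {1..j + 1} - {(i, j + 1)}) \<union> {0..i} \<times> {0})"
    using 1 by (simp add: perp_Un)
  then have "perp ?f ({0..i} \<times> {0..j + 1} - {(i, j + 1)})" by (rule perp_mono) auto
  moreover have "exps ?f \<subseteq> {0..i} \<times> {0..j + 1}"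
    by (rule order_trans[OF keys]) auto
  ultimately show ?thesis by (simp add: top_orthogonal_def)
qed

lemma top_orthogonal_swap:
  "pd_form.top_orthogonal (L \<circ> lswap) j i (lswap f) \<longleftrightarrow> top_orthogonal i j f"
proof -
  have s: "prod.swap ` ({0..j} \<times> {0..i}) = {0..i} \<times> {0..j}" by auto
  have s': "prod.swap ` ({0..j} \<times> {0..i} - {(j, i)}) = {0..i} \<times> {0..j} - {(i, j)}" by auto
  have "exps (lswap f) \<subseteq> {0..j} \<times> {0..i} \<longleftrightarrow> exps f \<subseteq> {0..i} \<times> {0..j}"
    unfolding keys_lswap by auto
  then show ?thesis
    unfolding pd_form.top_orthogonal_def[OF pd_form_swap] top_orthogonal_def perp_swap s' by simp
qed

lemma top_orthogonal_z:
  assumes "ciZ i j" "top_orthogonal i j f" "i \<ge> 0" "j \<ge> 0"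
  shows "top_orthogonal (i + 1) j (mon (1, 0) * f)"
proof -
  have "pd_form.top_orthogonal (L \<circ> lswap) j (i + 1) (mon (0, 1) * lswap f)"
    using assms by (intro pd_form.top_orthogonal_w[OF pd_form_swap]) (auto simp: ci_swap top_orthogonal_swap)
  then show ?thesis
    using top_orthogonal_swap[of j "i + 1" "mon (1, 0) * f"] by (simp add: lswap_mult)
qed

lemma top_orthogonal_shift:
  assumes H: "\<And>i j. i \<ge> n \<Longrightarrow> j \<ge> m \<Longrightarrow> ciW i j \<and> ciZ i j"
    and "top_orthogonal n m p" "n \<ge> 0" "m \<ge> 0"
  shows "top_orthogonal (n + int t) (m + int s) (mon (int t, int s) * p)"
proof -
  have 1: "top_orthogonal n (m + int s) (mon (0, int s) * p)"
  proof (induction s)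
    case 0
    then show ?case using assms(2) by (simp flip: zero_prod_def)
  next
    case (Suc s)
    have "top_orthogonal n (m + int s + 1) (mon (0, 1) * (mon (0, int s) * p))"
      using Suc H[of n "m + int s"] assms(3,4) by (intro top_orthogonal_w) auto
    then show ?case by (simp add: mult_single add.commute add.left_commute flip: mult.assoc)
  qed
  show ?thesis
  proof (induction t)
    case 0
    then show ?case using 1 by simp
  next
    case (Suc t)
    have "top_orthogonal (n + int t + 1) (m + int s) (mon (1, 0) * (mon (int t, int s) * p))"
      using Suc H[of "n + int t" "m + int s"] assms(3,4) by (intro top_orthogonal_z) auto
    then show ?case by (simp add: mult_single add.commute add.left_commute flip: mult.assoc)
  qed
qed

text \<open>Once \<open>f\<close> is orthogonal to columns 0 to \<open>i-1\<close> up to height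
  \<open>j'\<close>, it is a residual in the sense of \<open>ciK i (j' + 1)\<close>, which adds one
  more row.\<close>

lemma top_orthogonal_half_strip:
  assumes K: "\<And>j'. j' \<ge> j \<Longrightarrow> ciK i (j' + 1)" and f: "top_orthogonal i j f" and "i \<ge> 0" "j \<ge> 0"
  shows "perp f ({0..i-1} \<times> {0..})"
proof -
  have keys: "exps f \<subseteq> {0..i} \<times> {0..j}" using f by (simp add: top_orthogonal_def)
  have *: "perp f ({0..i-1} \<times> {0..j'})" if "j' \<ge> j" for j'
    using that
  proof (induction j' rule: int_ge_induct)
    case base
    show ?case by (rule perp_mono[of _ "{0..i} \<times> {0..j} - {(i, j)}"]) (use f in \<open>auto simp: top_orthogonal_def\<close>)
  next
    case (step j')
    have "perp f ({0..i-1} \<times> {j' + 1})"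
    proof (rule indepD[OF K[OF step.hyps, unfolded ciK_def]])
      show "exps f \<subseteq> {i} \<times> {0..j' + 1 - 1} \<union> {0..i - 1} \<times> {0..j' + 1 - 1}"
        by (rule order_trans[OF keys]) (use step.hyps in auto)
      show "perp f ({0..i - 1} \<times> {0..j' + 1 - 1})" using step.IH by simp
    qed
    then have "perp f ({0..i-1} \<times> {0..j'} \<union> {0..i-1} \<times> {j' + 1})" using step.IH by (simp add: perp_Un)
    then show ?case by (rule perp_mono) auto
  qed
  show ?thesis
    unfolding perp_def
  proof
    fix a :: "int \<times> int" assume "a \<in> {0..i-1} \<times> {0..}"
    then have "a \<in> {0..i-1} \<times> {0..max j (snd a)}" by auto
    then show "ip f (mon a) = 0" using *[OF max.cobounded1, of "snd a"] unfolding perp_def by (rule bspec[rotated])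
  qed
qed

text \<open>A translation by \<open>(|k|, |l|)\<close> makes the exponents nonnegative at the price
  of raising the degree of \<open>p\<close>; by \<open>top_orthogonal_shift\<close> the translate is
  again orthogonal to its larger rectangle without the top corner.\<close>

lemma perp_everything:
  assumes H: "\<And>i j. i \<ge> n \<Longrightarrow> j \<ge> m \<Longrightarrow> ciK i j \<and> ciW i j \<and> ciZ i j"
    and p: "top_orthogonal n m p" "n \<ge> 0" "m \<ge> 0"
  shows "perp p {(k, l). k < n \<or> l < m}"
  unfolding perp_def
proof clarify
  fix k l :: int assume kl: "k < n \<or> l < m"
  define t s where "t = nat \<bar>k\<bar>" and "s = nat \<bar>l\<bar>"
  let ?f = "mon (int t, int s) * p"
  have top: "top_orthogonal (n + int t) (m + int s) ?f"
    using H p by (intro top_orthogonal_shift) auto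
  have "ip ?f (mon (k + int t, l + int s)) = 0"
    using kl
  proof
    assume "k < n"
    have "perp ?f ({0..n + int t - 1} \<times> {0..})"
      using H p by (intro top_orthogonal_half_strip[OF _ top]) auto
    then show ?thesis using \<open>k < n\<close> by (auto simp: perp_def t_def s_def)
  next
    assume "l < m"
    have "pd_form.perp (L \<circ> lswap) (lswap ?f) ({0..m + int s - 1} \<times> {0..})"
      using H p top
      by (intro pd_form.top_orthogonal_half_strip[OF pd_form_swap, where j = "n + int t"])
         (auto simp: ci_swap top_orthogonal_swap)
    then have "perp ?f (prod.swap ` ({0..m + int s - 1} \<times> {0..}))" by (simp add: perp_swap)
    moreover have "(k + int t, l + int s) \<in> prod.swap ` ({0..m + int s - 1} \<times> {0..})"
      using \<open>l < m\<close> by (intro image_eqI[of _ _ "(l + int s, k + int t)"]) (auto simp: t_def s_def)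
    ultimately show ?thesis unfolding perp_def by blast
  qed
  then show "ip p (mon (k, l)) = 0" by (simp add: ip_mon_left mult_single)
qed

subsection \<open>Stability of the reversed polynomial\<close>

text \<open>The squared norm of \<open>f - c z^t f\<close> is |c|^2 - 1 times that of
  \<open>f\<close>, so it cannot be positive. This includes |c| = 1, the case of a point on the
  torus.\<close>

lemma contraction_eq_0:
  assumes eq: "ip f f = c * ip (mon t * f) f" and c: "norm c \<le> 1" and t: "fst t > 0 \<or> snd t > 0"
  shows "f = 0"
proof -
  define D where "D = f - cst c * (mon t * f)"
  have eq': "ip f f = cnj c * ip f (mon t * f)"
    using arg_cong[OF eq, of cnj] by (simp add: ip_cnj)
  have "ip D D = ip f f - cnj c * ip f (mon t * f) - (c * ip (mon t * f) f - c * (cnj c * ip f f))"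
    unfolding D_def ip_linear ip_mon by (simp add: algebra_simps)
  also have "\<dots> = - ip f f + c * cnj c * ip f f" using eq eq' by simp
  also have "\<dots> = of_real (- Re (ip f f) + (norm c)\<^sup>2 * Re (ip f f))"
    unfolding of_real_add of_real_minus of_real_mult complex_norm_square ip_self_real[symmetric] ..
  finally have "Re (ip D D) = - Re (ip f f) + (norm c)\<^sup>2 * Re (ip f f)" by (simp only: Re_complex_of_real)
  also have "\<dots> \<le> 0"
  proof -
    have "(norm c)\<^sup>2 \<le> 1" using c by (simp add: power_le_one)
    moreover have "Re (ip f f) \<ge> 0" using ip_self_nonneg[of f] by (simp add: less_eq_complex_def)
    ultimately show ?thesis using mult_right_mono[of "(norm c)\<^sup>2" 1 "Re (ip f f)"] by simp
  qed
  finally have "Re (ip D D) \<le> 0" .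
  moreover have "Re (ip D D) > 0" if "D \<noteq> 0"
    using ip_self_pos[OF that] by (simp add: less_complex_def)
  ultimately have "D = 0" by force
  then have "f = cst c * (mon t * f)" by (simp add: D_def)
  then show ?thesis using t by (rule fixed_by_shift_eq_0)
qed

end

section \<open>Division by a linear factor and comparison of functionals\<close>

definition laurent_of :: "(int \<times> int) set \<Rightarrow> (int \<times> int \<Rightarrow> complex) \<Rightarrow> laurent" where
  "laurent_of S h = (\<Sum>a\<in>S. cst (h a) * mon a)"

lemma lookup_laurent_of: "finite S \<Longrightarrow> coef (laurent_of S h) a = (if a \<in> S then h a else 0)"
proof -
  assume "finite S"
  have "coef (laurent_of S h) a = (\<Sum>b\<in>S. if b = a then h b else 0)"
    unfolding laurent_of_def by (simp add: lookup_sum lookup_single when_def if_distrib cong: if_cong)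
  then show ?thesis using \<open>finite S\<close> by simp
qed

lemma keys_laurent_of: "exps (laurent_of S h) \<subseteq> S"
  unfolding laurent_of_def by (rule keys_subset_sum, rule keys_subset_cst) auto

text \<open>\<open>horner c f (Suc i) j\<close> is the coefficient of z^i w^j in the power series f
  / (1 - c z); the counter is ahead by one so that the recursion starts from 0.\<close>

fun horner :: "complex \<Rightarrow> laurent \<Rightarrow> nat \<Rightarrow> int \<Rightarrow> complex" where
  "horner c f 0 j = 0"
| "horner c f (Suc i) j = coef f (int i, j) + c * horner c f i j"

text \<open>The series h = f / (1 - c z) satisfies (1 - c' w) h = - g. In z-degree n the right side
  is zero, so each coefficient of h is c' times the one below it, and there are none below row 0;
  hence h stops before degree n.\<close>

lemma divide_by_linear:
  assumes eq: "f - cst c' * (mon (0, 1) * f) = - (g - cst c * (mon (1, 0) * g))"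
    and f: "exps f \<subseteq> {0..int n} \<times> {0..b}" and g: "exps g \<subseteq> {0..int n - 1} \<times> {0..b'}"
  obtains h where "exps h \<subseteq> {0..int n - 1} \<times> {0..b}" "f = h - cst c * (mon (1, 0) * h)"
proof -
  have coeffs: "coef f (i, j) - c' * coef f (i, j - 1) =
      - coef g (i, j) + c * coef g (i - 1, j)" for i j
    using arg_cong[OF eq, of "\<lambda>h. coef h (i, j)"] by (simp add: lookup_minus)
  have *: "horner c f k j - c' * horner c f k (j - 1) = - coef g (int k - 1, j)" for k j
  proof (induction k)
    case 0
    have "coef g (- 1, j) = 0" by (rule lookup_outside[OF g]) simp
    then show ?case by simp
  next
    case (Suc k)
    have "horner c f (Suc k) j - c' * horner c f (Suc k) (j - 1) =
        (coef f (int k, j) - c' * coef f (int k, j - 1)) +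
        c * (horner c f k j - c' * horner c f k (j - 1))"
      by (simp add: right_diff_distrib distrib_left mult.left_commute)
    also have "\<dots> = - coef g (int k, j)"
      unfolding Suc.IH coeffs by simp
    finally show ?case by simp
  qed
  have neg: "horner c f k j = 0" if "j \<notin> {0..b}" for k j
  proof (induction k)
    case (Suc k)
    have "coef f (int k, j) = 0" by (rule lookup_outside[OF f]) (use that in simp)
    then show ?case using Suc by simp
  qed simp
  \<comment> \<open>This is the coefficient of z^n in the series. The induction starts at row -1,
    where \<open>f\<close> has no terms.\<close>
  have top: "horner c f (Suc n) j = 0" if "j \<ge> - 1" for j
    using that
  proof (induction j rule: int_ge_induct)
    case base
    show ?case by (rule neg) simp
  next
    case (step j)
    have "coef g (int (Suc n) - 1, j + 1) = 0" by (rule lookup_outside[OF g]) simp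
    then show ?case using *[of "Suc n" "j + 1"] step.IH by simp
  qed
  define h where "h = laurent_of ({0..int n - 1} \<times> {0..b}) (\<lambda>(i, j). horner c f (Suc (nat i)) j)"
  have h: "coef h (i, j) = (if 0 \<le> i \<and> i < int n then horner c f (Suc (nat i)) j else 0)" for i j
    using neg[of j "Suc (nat i)"] by (auto simp: h_def lookup_laurent_of simp del: horner.simps)
  have "f = h - cst c * (mon (1, 0) * h)"
  proof (rule poly_mapping_eqI)
    fix a :: "int \<times> int"
    obtain i j where a: "a = (i, j)" by (cases a)
    have "coef f (i, j) = coef h (i, j) - c * coef h (i - 1, j)"
    proof -
      consider "i < 0 \<or> i > int n" | "i = 0" "n = 0" | "i = 0" "n > 0" | "0 < i" "i < int n" | "i = int n" "n > 0"
        by linarith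
      then show ?thesis
      proof cases
        case 1
        have "coef f (i, j) = 0" by (rule lookup_outside[OF f]) (use 1 in auto)
        then show ?thesis using 1 by (auto simp: h)
      next
        case 2
        have "horner c f (Suc n) j = 0" using top[of j] neg[of j "Suc n"] by (cases "j \<ge> - 1") auto
        then show ?thesis using 2 by (simp add: h)
      next
        case 3
        then show ?thesis by (simp add: h)
      next
        case 4
        then have "nat i = Suc (nat (i - 1))" by simp
        with 4 show ?thesis by (simp add: h)
      next
        case 5
        have "horner c f (Suc n) j = 0" using top[of j] neg[of j "Suc n"] by (cases "j \<ge> - 1") auto
        moreover have "n = Suc (nat (i - 1))" using 5 by simp
        ultimately have "coef f (i, j) + c * horner c f (Suc (nat (i - 1))) j = 0"
          using 5 by (metis horner.simps(2))
        then show ?thesis using 5 by (simp add: h eq_neg_iff_add_eq_0 del: horner.simps)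
      qed
    qed
    then show "coef f a = coef (h - cst c * (mon (1, 0) * h)) a"
      by (simp add: a lookup_minus)
  qed
  moreover have "exps h \<subseteq> {0..int n - 1} \<times> {0..b}"
    unfolding h_def by (rule keys_laurent_of)
  ultimately show ?thesis using that by blast
qed

text \<open>\<open>S1\<close> and \<open>S2\<close> cover all exponents of \<open>S\<close> except
  possibly \<open>a\<close>; \<open>p\<close> is the one extra test vector that accounts for
  it.\<close>

lemma linear_functionals_agree:
  fixes u v :: "laurent \<Rightarrow> complex"
  assumes u: "\<And>f g. u (f + g) = u f + u g" "\<And>c f. u (cst c * f) = c * u f"
    and v: "\<And>f g. v (f + g) = v f + v g" "\<And>c f. v (cst c * f) = c * v f"
    and p: "exps p \<subseteq> S" "coef p a \<noteq> 0" "u p = v p"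
    and S: "S - {a} \<subseteq> S1 \<union> S2"
    and "\<And>f. exps f \<subseteq> S1 \<Longrightarrow> u f = v f" "\<And>f. exps f \<subseteq> S2 \<Longrightarrow> u f = v f"
    and f: "exps f \<subseteq> S"
  shows "u f = v f"
proof -
  define t where "t = coef f a / coef p a"
  define r where "r = f - cst t * p"
  have "exps r \<subseteq> S"
    unfolding r_def by (rule keys_subset_diff[OF f keys_subset_cst[OF p(1)]])
  moreover have "a \<notin> exps r"
    using p(2) by (simp add: r_def t_def in_keys_iff lookup_minus)
  ultimately have "exps r \<subseteq> S1 \<union> S2" using S by blast
  then obtain g h where gh: "r = g + h" "exps g \<subseteq> S1" "exps h \<subseteq> S2"
    by (rule keys_Un_split)
  have f: "f = cst t * p + (g + h)" using gh(1) by (simp add: r_def algebra_simps)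
  have "u g = v g" "u h = v h" using assms(9,10) gh by blast+
  then show ?thesis unfolding f u v p(3) by simp
qed

context pd_form
begin

lemma perpI: "(\<And>f. exps f \<subseteq> S \<Longrightarrow> ip f g = 0) \<Longrightarrow> perp g S"
  unfolding perp_def using ip_commute_eq_0 by (metis empty_subsetI insert_subset keys_single zero_neq_one)

lemma cross_orthogonal:
  assumes "indep C A B" "S = A \<union> C" "T = B \<union> C"
    and "exps f \<subseteq> S" "perp f C" "exps g \<subseteq> T"
  shows "ip f g = 0"
proof -
  have "perp f B" using assms by (intro indepD[OF assms(1)]) auto
  then have "perp f T" using assms(3,5) by (simp add: perp_Un)
  then show ?thesis using assms(6) by (rule perpD)
qed

text \<open>The point evaluation \<open>ev\<close> at \<open>(z, w)\<close> is represented by \<open>A\<close>, \<open>B\<close>, \<open>C\<close> on the polynomials of degree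
  at most \<open>(n, m - 1)\<close>, \<open>(n - 1, m)\<close>, \<open>(n - 1, m - 1)\<close>. The hypothesis \<open>ciK n m\<close> gives two expressions for its
  representer in degree \<open>(n, m)\<close>; their equality is a Christoffel--Darboux formula for \<open>p\<close> and its reversal.\<close>

lemma reversal_no_zero:
  fixes ev :: "laurent \<Rightarrow> complex" and n m :: nat
  assumes nm: "n \<ge> 1" "m \<ge> 1" and K: "ciK (int n) (int m)"
    and p: "is_orthopoly ({0..int n} \<times> {0..int m}) (int n, int m) p"
    and ev_add: "\<And>f g. ev (f + g) = ev f + ev g" and ev_cst: "\<And>c f. ev (cst c * f) = c * ev f"
    and ev_z: "\<And>f. exps f \<subseteq> {0..} \<times> {0..} \<Longrightarrow> ev (mon (1, 0) * f) = z * ev f"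
    and ev_w: "\<And>f. exps f \<subseteq> {0..} \<times> {0..} \<Longrightarrow> ev (mon (0, 1) * f) = w * ev f"
    and ev_1: "ev 1 = 1" and zw: "norm z \<le> 1" "norm w \<le> 1"
  shows "ev (mon (int n, int m) * ladj p) \<noteq> 0"
proof
  assume zero: "ev (mon (int n, int m) * ladj p) = 0"
  define N M where "N = int n" and "M = int m"
  have NM: "N \<ge> 1" "M \<ge> 1" using nm by (simp_all add: N_def M_def)
  let ?X = "{0..N} \<times> {0..M - 1}" and ?Y = "{0..N - 1} \<times> {0..M}" and ?Z = "{0..N - 1} \<times> {0..M - 1}"
  let ?X' = "{0..N} \<times> {1..M}" and ?Y' = "{1..N} \<times> {0..M}" and ?Z' = "{1..N} \<times> {1..M}"
  have X: "?X = {N} \<times> {0..M - 1} \<union> ?Z" and Y: "?Y = {0..N - 1} \<times> {M} \<union> ?Z"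
    and X': "?X' = {0} \<times> {1..M} \<union> ?Z'" and Y': "?Y' = {1..N} \<times> {0} \<union> ?Z'"
    using NM by auto
  have K0: "indep ?Z ({N} \<times> {0..M - 1}) ({0..N - 1} \<times> {M})" using K by (simp add: ciK_def N_def M_def)
  have K1: "indep ?Z' ({0} \<times> {1..M}) ({1..N} \<times> {0})"
    using indep_reflect[OF K0, of "(N, M)"] by (simp add: box_reflect)
  have XY: "ip f g = 0" if "exps f \<subseteq> ?X" "perp f ?Z" "exps g \<subseteq> ?Y" for f g
    by (rule cross_orthogonal[OF K0 X Y that])
  have YX: "ip f g = 0" if "exps f \<subseteq> ?Y" "perp f ?Z" "exps g \<subseteq> ?X" for f g
    by (rule cross_orthogonal[OF indep_sym[OF _ K0] Y X that]) simp
  have XY': "ip f g = 0" if "exps f \<subseteq> ?X'" "perp f ?Z'" "exps g \<subseteq> ?Y'" for f g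
    by (rule cross_orthogonal[OF K1 X' Y' that])
  have YX': "ip f g = 0" if "exps f \<subseteq> ?Y'" "perp f ?Z'" "exps g \<subseteq> ?X'" for f g
    by (rule cross_orthogonal[OF indep_sym[OF _ K1] Y' X' that]) simp
  have p: "exps p \<subseteq> {0..N} \<times> {0..M}" "coef p (N, M) \<noteq> 0" "ip p p = 1"
    "perp p ({0..N} \<times> {0..M} - {(N, M)})"
    using p by (auto simp: is_orthopoly_def N_def M_def)
  have pX: "ip f p = 0" if "exps f \<subseteq> ?X" for f
    by (rule perpD'[OF p(4)]) (rule order_trans[OF that], auto)
  have pY: "ip f p = 0" if "exps f \<subseteq> ?Y" for f
    by (rule perpD'[OF p(4)]) (rule order_trans[OF that], auto)
  define q where "q = mon (N, M) * ladj p"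
  have ev_q: "ev q = 0" using zero by (simp add: q_def N_def M_def)
  have q: "exps q \<subseteq> {0..N} \<times> {0..M}" "coef q (0, 0) \<noteq> 0" "perp q ({0..N} \<times> {0..M} - {(0, 0)})"
  proof -
    have "(-) (N, M) ` exps p \<subseteq> (-) (N, M) ` ({0..N} \<times> {0..M})" using p(1) by (rule image_mono)
    then show "exps q \<subseteq> {0..N} \<times> {0..M}" by (simp add: q_def keys_reflect box_reflect)
    show "coef q (0, 0) \<noteq> 0" using p(2) by (simp add: q_def)
    have "(-) (N, M) ` ({0..N} \<times> {0..M} - {(0, 0)}) \<subseteq> {0..N} \<times> {0..M} - {(N, M)}" by auto
    then show "perp q ({0..N} \<times> {0..M} - {(0, 0)})"
      unfolding q_def perp_reflect by (rule perp_mono[OF p(4)])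
  qed
  have qX: "ip q f = 0" if "exps f \<subseteq> ?X'" for f
    by (rule perpD[OF q(3)]) (rule order_trans[OF that], auto)
  have qY: "ip q f = 0" if "exps f \<subseteq> ?Y'" for f
    by (rule perpD[OF q(3)]) (rule order_trans[OF that], auto)
  obtain A where A: "exps A \<subseteq> ?X" "\<And>f. exps f \<subseteq> ?X \<Longrightarrow> ip f A = ev f"
    using riesz[of ?X ev] ev_add ev_cst by auto
  obtain B where B: "exps B \<subseteq> ?Y" "\<And>f. exps f \<subseteq> ?Y \<Longrightarrow> ip f B = ev f"
    using riesz[of ?Y ev] ev_add ev_cst by auto
  obtain C where C: "exps C \<subseteq> ?Z" "\<And>f. exps f \<subseteq> ?Z \<Longrightarrow> ip f C = ev f"
    using riesz[of ?Z ev] ev_add ev_cst by auto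
  have ZX: "?Z \<subseteq> ?X" and ZY: "?Z \<subseteq> ?Y" by auto
  have nonneg: "?X \<subseteq> {0..} \<times> {0..}" "?Y \<subseteq> {0..} \<times> {0..}" "?Z \<subseteq> {0..} \<times> {0..}" by auto
  \<comment> \<open>Since \<open>ev (w g) = w ev g\<close> and the form is antilinear on the right,
    representers pick up conjugates.\<close>
  define w' z' where "w' = cnj w" and "z' = cnj z"
  define F where "F = A - C"
  define F' where "F' = A - cst z' * (mon (1, 0) * C)"
  define G where "G = B - cst w' * (mon (0, 1) * C)"
  define G' where "G' = B - C"
  have zC: "exps (mon (1, 0) * C) \<subseteq> {1..N} \<times> {0..M - 1}"
    using keys_mon_mult_subset[OF C(1), of 1 0] by simp
  have wC: "exps (mon (0, 1) * C) \<subseteq> {0..N - 1} \<times> {1..M}"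
    using keys_mon_mult_subset[OF C(1), of 0 1] by simp
  have F: "exps F \<subseteq> ?X" unfolding F_def
    by (rule keys_subset_diff[OF A(1) order_trans[OF C(1) ZX]])
  have G'Y: "exps G' \<subseteq> ?Y" unfolding G'_def
    by (rule keys_subset_diff[OF B(1) order_trans[OF C(1) ZY]])
  have F'X: "exps F' \<subseteq> ?X" unfolding F'_def
    by (rule keys_subset_diff[OF A(1) keys_subset_cst[OF order_trans[OF zC]]]) auto
  have G: "exps G \<subseteq> ?Y" unfolding G_def
    by (rule keys_subset_diff[OF B(1) keys_subset_cst[OF order_trans[OF wC]]]) auto
  have perpF: "perp F ?Z"
  proof (rule perpI)
    fix f :: laurent assume "exps f \<subseteq> ?Z"
    then show "ip f F = 0" using A(2)[OF order_trans[OF _ ZX]] C(2) by (simp add: F_def ip_linear)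
  qed
  have perpG': "perp G' ?Z"
  proof (rule perpI)
    fix f :: laurent assume "exps f \<subseteq> ?Z"
    then show "ip f G' = 0" using B(2)[OF order_trans[OF _ ZY]] C(2) by (simp add: G'_def ip_linear)
  qed
  have perpG: "perp G ({0..N - 1} \<times> {1..M})"
  proof (rule perpI)
    fix f :: laurent assume f: "exps f \<subseteq> {0..N - 1} \<times> {1..M}"
    define g where "g = mon (0, - 1) * f"
    have fg: "f = mon (0, 1) * g" by (simp add: g_def mult_single flip: mult.assoc zero_prod_def)
    have g: "exps g \<subseteq> ?Z"
      using keys_mon_mult_subset[OF f, of 0 "- 1"] by (simp add: g_def)
    have "ip f B = w * ev g"
      using B(2)[of f] ev_w[OF order_trans[OF g nonneg(3)]] f by (subst B(2)) (auto simp: fg)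
    moreover have "ip f (mon (0, 1) * C) = ev g" unfolding fg ip_mon by (rule C(2)[OF g])
    ultimately show "ip f G = 0" by (simp add: G_def ip_linear w'_def)
  qed
  have perpF': "perp F' ({1..N} \<times> {0..M - 1})"
  proof (rule perpI)
    fix f :: laurent assume f: "exps f \<subseteq> {1..N} \<times> {0..M - 1}"
    define g where "g = mon (- 1, 0) * f"
    have fg: "f = mon (1, 0) * g" by (simp add: g_def mult_single flip: mult.assoc zero_prod_def)
    have g: "exps g \<subseteq> ?Z"
      using keys_mon_mult_subset[OF f, of "- 1" 0] by (simp add: g_def)
    have "ip f A = z * ev g"
      using ev_z[OF order_trans[OF g nonneg(3)]] f by (subst A(2)) (auto simp: fg)
    moreover have "ip f (mon (1, 0) * C) = ev g" unfolding fg ip_mon by (rule C(2)[OF g])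
    ultimately show "ip f F' = 0" by (simp add: F'_def ip_linear z'_def)
  qed
  \<comment> \<open>Inclusion-exclusion for the representer of \<open>ev\<close> in degree (n, m):
    \<open>?X\<close> and \<open>?Y\<close> are independent given \<open>?Z\<close>, which gives
    \<open>A + B - C\<close>, and \<open>p\<close> supplies the one remaining dimension.\<close>
  define M1 where "M1 = cst (cnj (ev p)) * p + A + B - C"
  \<comment> \<open>The same on the translated rectangles, where \<open>w' w A\<close>,
    \<open>z' z B\<close> and \<open>z' w' z w C\<close> represent \<open>ev\<close>. The remaining
    direction is that of \<open>q\<close>, whose term is absent because
    \<open>ev q = 0\<close>.\<close>
  define M2 where "M2 = cst w' * (mon (0, 1) * A) + cst z' * (mon (1, 0) * G)"
  have M2_alt: "M2 = cst z' * (mon (1, 0) * B) + cst w' * (mon (0, 1) * F')"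
  proof -
    have "mon (1, 0) * (cst w' * (mon (0, 1) * C)) = cst w' * (mon (1, 1) * C)"
      "mon (0, 1) * (cst z' * (mon (1, 0) * C)) = cst z' * (mon (1, 1) * C)"
      by (simp_all add: mult.left_commute[of _ "cst _"] mult_single flip: mult.assoc)
    then show ?thesis
      unfolding M2_def G_def F'_def right_diff_distrib by (simp add: mult.left_commute)
  qed
  have M1: "ip f M1 = ev f" if "exps f \<subseteq> {0..N} \<times> {0..M}" for f
  proof (rule linear_functionals_agree[of "\<lambda>f. ip f M1" ev p "{0..N} \<times> {0..M}" "(N, M)" ?X ?Y f])
    have "ip p A = 0" "ip p B = 0" "ip p C = 0"
      using pX[OF A(1)] pY[OF B(1)] pX[OF order_trans[OF C(1) ZX]] ip_commute_eq_0[of p] by blast+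
    then show "ip p M1 = ev p" using p(3) by (simp add: M1_def ip_linear)
    show "ip f M1 = ev f" if f: "exps f \<subseteq> ?X" for f
    proof -
      have "M1 = cst (cnj (ev p)) * p + A + G'" by (simp add: M1_def G'_def)
      moreover have "ip f G' = 0" using YX[OF G'Y perpG' f] ip_commute_eq_0 by blast
      ultimately show ?thesis using pX[OF f] A(2)[OF f] by (simp add: ip_linear)
    qed
    show "ip f M1 = ev f" if f: "exps f \<subseteq> ?Y" for f
    proof -
      have "M1 = cst (cnj (ev p)) * p + B + F" by (simp add: M1_def F_def)
      moreover have "ip f F = 0" using XY[OF F perpF f] ip_commute_eq_0 by blast
      ultimately show ?thesis using pY[OF f] B(2)[OF f] by (simp add: ip_linear)
    qed
    show "{0..N} \<times> {0..M} - {(N, M)} \<subseteq> ?X \<union> ?Y" by auto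
  qed (use p that ev_add ev_cst in \<open>auto simp: ip_linear\<close>)
  have wA: "exps (mon (0, 1) * A) \<subseteq> ?X'"
    using keys_mon_mult_subset[OF A(1), of 0 1] by simp
  have zB: "exps (mon (1, 0) * B) \<subseteq> ?Y'"
    using keys_mon_mult_subset[OF B(1), of 1 0] by simp
  have zG: "exps (mon (1, 0) * G) \<subseteq> ?Y'"
    using keys_mon_mult_subset[OF G, of 1 0] by simp
  have wF': "exps (mon (0, 1) * F') \<subseteq> ?X'"
    using keys_mon_mult_subset[OF F'X, of 0 1] by simp
  have M2: "ip f M2 = ev f" if "exps f \<subseteq> {0..N} \<times> {0..M}" for f
  proof (rule linear_functionals_agree[of "\<lambda>f. ip f M2" ev q "{0..N} \<times> {0..M}" "(0, 0)" ?X' ?Y' f])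
    show "ip q M2 = ev q"
      using qX[OF wA] qY[OF zG] ev_q by (simp add: M2_def ip_linear)
    show "ip f M2 = ev f" if f: "exps f \<subseteq> ?X'" for f
    proof -
      define g where "g = mon (0, - 1) * f"
      have fg: "f = mon (0, 1) * g" by (simp add: g_def mult_single flip: mult.assoc zero_prod_def)
      have g: "exps g \<subseteq> ?X"
        using keys_mon_mult_subset[OF f, of 0 "- 1"] by (simp add: g_def)
      have "(+) (- (1, 0)) ` ?Z' \<subseteq> {0..N - 1} \<times> {1..M}" by auto
      then have "perp (mon (1, 0) * G) ?Z'" unfolding perp_mon by (rule perp_mono[OF perpG])
      then have "ip (mon (1, 0) * G) f = 0" using f by (intro YX'[OF zG])
      then have "ip f (mon (1, 0) * G) = 0" using ip_commute_eq_0 by blast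
      moreover have "ip f (mon (0, 1) * A) = ev g" unfolding fg ip_mon by (rule A(2)[OF g])
      ultimately show ?thesis
        using ev_w[OF order_trans[OF g nonneg(1)]] by (simp add: M2_def ip_linear w'_def fg)
    qed
    show "ip f M2 = ev f" if f: "exps f \<subseteq> ?Y'" for f
    proof -
      define g where "g = mon (- 1, 0) * f"
      have fg: "f = mon (1, 0) * g" by (simp add: g_def mult_single flip: mult.assoc zero_prod_def)
      have g: "exps g \<subseteq> ?Y"
        using keys_mon_mult_subset[OF f, of "- 1" 0] by (simp add: g_def)
      have "(+) (- (0, 1)) ` ?Z' \<subseteq> {1..N} \<times> {0..M - 1}" by auto
      then have "perp (mon (0, 1) * F') ?Z'" unfolding perp_mon by (rule perp_mono[OF perpF'])
      then have "ip (mon (0, 1) * F') f = 0" using f by (intro XY'[OF wF'])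
      then have "ip f (mon (0, 1) * F') = 0" using ip_commute_eq_0 by blast
      moreover have "ip f (mon (1, 0) * B) = ev g" unfolding fg ip_mon by (rule B(2)[OF g])
      ultimately show ?thesis
        using ev_z[OF order_trans[OF g nonneg(2)]] by (simp add: M2_alt ip_linear z'_def fg)
    qed
    show "{0..N} \<times> {0..M} - {(0, 0)} \<subseteq> ?X' \<union> ?Y'" by auto
  qed (use q that ev_add ev_cst in \<open>auto simp: ip_linear\<close>)
  have "M1 - M2 = 0"
  proof (rule perp_self[of _ "{0..N} \<times> {0..M}"])
    show "perp (M1 - M2) ({0..N} \<times> {0..M})"
      by (rule perpI) (simp add: ip_linear M1 M2)
    have sub: "?X \<subseteq> {0..N} \<times> {0..M}" "?Y \<subseteq> {0..N} \<times> {0..M}" "?X' \<subseteq> {0..N} \<times> {0..M}" "?Y' \<subseteq> {0..N} \<times> {0..M}"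
      by auto
    show "exps (M1 - M2) \<subseteq> {0..N} \<times> {0..M}"
      unfolding M1_def M2_def
      by (intro keys_subset_diff keys_subset_add keys_subset_cst p(1)
        order_trans[OF A(1) sub(1)] order_trans[OF B(1) sub(2)] order_trans[OF C(1) order_trans[OF ZX sub(1)]]
        order_trans[OF wA sub(3)] order_trans[OF zG sub(4)])
  qed
  then have CD: "cst (cnj (ev p)) * p + (F - cst w' * (mon (0, 1) * F)) + (G - cst z' * (mon (1, 0) * G)) = 0"
    unfolding M1_def M2_def F_def by (simp add: G_def right_diff_distrib algebra_simps)
  have ip_real: "ip f f = of_real (Re (ip f f))" "Re (ip f f) \<ge> 0" for f
    using ip_self_real[of f] ip_self_nonneg[of f] by (auto simp: less_eq_complex_def)
  have evF: "ev F = ip F F"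
  proof -
    have "ip F C = 0" by (rule perpD[OF perpF C(1)])
    then have "ip F F = ip F A" by (simp add: F_def[of] ip_diff_right)
    then show ?thesis using A(2)[OF F] by simp
  qed
  have evG: "ev G = ip G G"
  proof -
    have "ip G (mon (0, 1) * C) = 0" by (rule perpD[OF perpG wC])
    then have "ip G G = ip G B" using ip_diff_right[of G B "cst w' * (mon (0, 1) * C)"] by (simp add: ip_linear flip: G_def)
    then show ?thesis using B(2)[OF G] by simp
  qed
  have ev_diff: "ev (f - g) = ev f - ev g" for f g
    using ev_add[of "f - g" g] by simp
  \<comment> \<open>\<open>ev\<close> is applied to the identity itself. As \<open>ev F\<close> and
    \<open>ev G\<close> are squared norms, three nonnegative terms add up to zero.\<close>
  have "ev p * cnj (ev p) + (1 - w * w') * ip F F + (1 - z * z') * ip G G = ev 0"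
    unfolding CD[symmetric] ev_add ev_diff ev_cst ev_w[OF order_trans[OF F nonneg(1)]] ev_z[OF order_trans[OF G nonneg(2)]] evF evG
    by (simp add: algebra_simps)
  moreover have "ev 0 = 0" using ev_cst[of 0 0] by simp
  moreover have "ev p * cnj (ev p) + (1 - w * w') * ip F F + (1 - z * z') * ip G G =
      of_real ((norm (ev p))\<^sup>2 + (1 - (norm w)\<^sup>2) * Re (ip F F) + (1 - (norm z)\<^sup>2) * Re (ip G G))"
    unfolding of_real_add of_real_mult of_real_diff of_real_1 complex_norm_square ip_real(1)[symmetric] w'_def z'_def ..
  ultimately have "(norm (ev p))\<^sup>2 + (1 - (norm w)\<^sup>2) * Re (ip F F) + (1 - (norm z)\<^sup>2) * Re (ip G G) = 0"
    by (metis of_real_eq_0_iff)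
  moreover have "(1 - (norm w)\<^sup>2) * Re (ip F F) \<ge> 0" "(1 - (norm z)\<^sup>2) * Re (ip G G) \<ge> 0"
    using zw ip_real(2) by (simp_all add: power_le_one)
  ultimately have "(norm (ev p))\<^sup>2 = 0" using zero_le_power2[of "norm (ev p)"] by linarith
  then have "ev p = 0" by simp
  then have "(F - cst w' * (mon (0, 1) * F)) + (G - cst z' * (mon (1, 0) * G)) = 0"
    using CD by simp
  then have FG: "F - cst w' * (mon (0, 1) * F) = - (G - cst z' * (mon (1, 0) * G))"
    by (simp only: eq_neg_iff_add_eq_0)
  have norms: "norm w' \<le> 1" "norm z' \<le> 1" using zw by (simp_all add: w'_def z'_def)
  \<comment> \<open>On the torus the weights vanish and \<open>F\<close>, \<open>G\<close> are not
    yet known to be zero. The identity makes \<open>1 - z' z\<close> divide \<open>F\<close>, and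
    the quotient \<open>H\<close> is orthogonal to \<open>F\<close>, so the contraction argument
    applies to \<open>H\<close>.\<close>
  have "F = 0"
  proof -
    obtain H where H: "exps H \<subseteq> ?Z" "F = H - cst z' * (mon (1, 0) * H)"
      using divide_by_linear[OF FG, of n "M - 1" M] F G unfolding N_def by blast
    have "ip F H = 0" by (rule perpD[OF perpF H(1)])
    then have "ip H H = z' * ip (mon (1, 0) * H) H" unfolding H(2) by (simp add: ip_linear)
    then have "H = 0" using norms by (intro contraction_eq_0[of H z' "(1, 0)"]) auto
    then show ?thesis using H(2) by simp
  qed
  with FG have "G = cst z' * (mon (1, 0) * G)" by simp
  then have "G = 0" by (rule fixed_by_shift_eq_0) simp
  \<comment> \<open>\<open>B\<close> now has two descriptions, \<open>w' w C\<close> and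
    \<open>C\<close> plus an orthogonal \<open>G'\<close>. Comparing norms with |w| \<le> 1 forces
    \<open>G' = 0\<close> and then \<open>C = 0\<close>, although \<open>C\<close> represents
    \<open>ev\<close> and \<open>ev 1 = 1\<close>.\<close>
  then have B_eq: "B = cst w' * (mon (0, 1) * C)" by (simp add: G_def)
  have G'_C: "ip G' C = 0" by (rule perpD[OF perpG' C(1)])
  have "ip B B = w' * cnj w' * ip C C" unfolding B_eq by (simp add: ip_linear)
  moreover have "ip B B = ip G' G' + ip C C"
  proof -
    have "B = G' + C" by (simp add: G'_def)
    moreover have "ip C G' = 0" using G'_C ip_commute_eq_0 by blast
    ultimately show ?thesis using G'_C by (simp add: ip_linear)
  qed
  ultimately have "of_real (Re (ip G' G')) = (of_real (((norm w')\<^sup>2 - 1) * Re (ip C C)) :: complex)"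
    unfolding of_real_mult of_real_diff complex_norm_square ip_real(1)[symmetric] by (simp add: algebra_simps)
  then have "Re (ip G' G') = ((norm w')\<^sup>2 - 1) * Re (ip C C)" by (simp only: of_real_eq_iff)
  also have "\<dots> \<le> 0" using norms ip_real(2)[of C] by (simp add: mult_nonpos_nonneg power_le_one)
  finally have "G' = 0" using ip_real[of G'] by simp
  then have "C = cst w' * (mon (0, 1) * C)" using B_eq by (simp add: G'_def)
  then have "C = 0" by (rule fixed_by_shift_eq_0) simp
  moreover have "ip 1 C = 1" using C(2)[of 1] ev_1 NM by (simp add: zero_prod_def)
  ultimately show False by simp
qed

end

lemma keys_mult_box:
  fixes f g :: laurent
  assumes "exps f \<subseteq> {a..b} \<times> {c..d}" "exps g \<subseteq> {a'..b'} \<times> {c'..d'}"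
  shows "exps (f * g) \<subseteq> {a + a'..b + b'} \<times> {c + c'..d + d'}"
proof
  fix x assume "x \<in> exps (f * g)"
  then obtain y z where "x = y + z" "y \<in> exps f" "z \<in> exps g"
    using keys_mult[of f g] by blast
  moreover from this have "y \<in> {a..b} \<times> {c..d}" "z \<in> {a'..b'} \<times> {c'..d'}" using assms by blast+
  ultimately show "x \<in> {a + a'..b + b'} \<times> {c + c'..d + d'}" by auto
qed

definition zslice :: "int \<Rightarrow> laurent \<Rightarrow> int \<Rightarrow> laurent" where
  "zslice m f i = laurent_of ({0} \<times> {0..m}) (\<lambda>(_, l). coef f (i, l))"

lemma zslice_sum:
  assumes f: "exps f \<subseteq> {0..n} \<times> {0..m}"
  shows "f = (\<Sum>i\<in>{0..n}. mon (i, 0) * zslice m f i)"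
proof (rule poly_mapping_eqI)
  fix a :: "int \<times> int"
  obtain x y where a: "a = (x, y)" by (cases a)
  have "coef (\<Sum>i\<in>{0..n}. mon (i, 0) * zslice m f i) a =
      (\<Sum>i\<in>{0..n}. if i = x then (if y \<in> {0..m} then coef f (x, y) else 0) else 0)"
    unfolding lookup_sum by (rule sum.cong) (auto simp: a zslice_def lookup_laurent_of)
  also have "\<dots> = coef f a"
    using lookup_outside[OF f, of a] by (auto simp: a)
  finally show "coef f a = coef (\<Sum>i\<in>{0..n}. mon (i, 0) * zslice m f i) a" by simp
qed

lemma keys_zslice: "exps (zslice m f i) \<subseteq> {0..0} \<times> {0..m}"
  unfolding zslice_def using keys_laurent_of by fastforce

lemma keys_ladj_zslice: "exps (ladj (zslice m f i)) \<subseteq> {0..0} \<times> {-m..0}"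
  using keys_zslice[of m f i] by (fastforce simp: keys_ladj)

context pd_form
begin

definition nrm :: "laurent \<Rightarrow> real" where
  "nrm f = sqrt (Re (ip f f))"

lemma Re_ip_self_nonneg: "Re (ip f f) \<ge> 0"
  using ip_self_nonneg[of f] by (simp add: less_eq_complex_def)

lemma nrm_nonneg: "nrm f \<ge> 0"
  using Re_ip_self_nonneg by (simp add: nrm_def)

lemma nrm_square: "(nrm f)\<^sup>2 = Re (ip f f)"
  using Re_ip_self_nonneg by (simp add: nrm_def)

lemma nrm_mon: "nrm (mon a * f) = nrm f"
  by (simp add: nrm_def)

lemma ip_Cauchy_Schwarz: "norm (ip f g) \<le> nrm f * nrm g"
proof (cases "g = 0")
  case True
  then show ?thesis by (simp add: nrm_def)
next
  case False
  define x y s where "x = Re (ip f f)" and "y = Re (ip g g)" and "s = ip f g"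
  have xy: "ip f f = of_real x" "ip g g = of_real y" using ip_self_real x_def y_def by simp_all
  have y: "y > 0" using ip_self_pos[OF False] by (simp add: y_def less_complex_def)
  define t where "t = s / of_real y"
  have s': "ip g f = cnj s" by (simp add: s_def ip_cnj)
  have "ip (f - cst t * g) (f - cst t * g) = of_real x - cnj t * s - (t * cnj s - t * (cnj t * of_real y))"
    unfolding ip_linear xy s' s_def[symmetric] by (simp add: algebra_simps)
  also have "\<dots> = of_real x - s * cnj s / of_real y"
    using y by (simp add: t_def)
  also have "\<dots> = of_real (x - (norm s)\<^sup>2 / y)"
    unfolding of_real_diff of_real_divide complex_norm_square ..
  finally have "x - (norm s)\<^sup>2 / y \<ge> 0"
    using Re_ip_self_nonneg[of "f - cst t * g"] by simp
  then have "(norm s)\<^sup>2 \<le> x * y" using y by (simp add: field_simps)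
  then have "norm s \<le> sqrt (x * y)" by (rule real_le_rsqrt)
  then show ?thesis by (simp add: s_def x_def y_def nrm_def real_sqrt_mult)
qed

lemma ip_mult_ladj: "ip (f * ladj g) h = ip f (g * h)"
  by (simp add: ip_def ladj_mult mult.assoc)

subsection \<open>Bernstein--Szego polynomials\<close>

text \<open>The algebraic substitute for a density 1 / |p|^2 with stable reversal: orthogonality to
  every monomial outside a quadrant, negative exponents included. By \<open>bs_norm\<close> it gives
  |p|^2 d\<mu> the moments of normalized Lebesgue measure.\<close>

definition bs :: "int \<Rightarrow> int \<Rightarrow> laurent \<Rightarrow> bool" where
  "bs n m p \<longleftrightarrow> exps p \<subseteq> {0..n} \<times> {0..m} \<and> perp p {(k, l). k < n \<or> l < m} \<and> ip p p = 1"

text \<open>Monomials have modulus one on the torus, so \<open>z^a w^b p\<close> belongs to the same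
  weight. This carries statements from degree (n, m) to all larger degrees.\<close>

lemma bs_shift:
  assumes "bs n m p" "a \<ge> 0" "b \<ge> 0"
  shows "bs (n + a) (m + b) (mon (a, b) * p)"
proof -
  have p: "exps p \<subseteq> {0..n} \<times> {0..m}" "perp p {(k, l). k < n \<or> l < m}" "ip p p = 1"
    using assms(1) by (auto simp: bs_def)
  have "exps (mon (a, b) * p) \<subseteq> {0..n + a} \<times> {0..m + b}"
    by (rule order_trans[OF keys_mon_mult_subset[OF p(1)]]) (use assms in auto)
  moreover have "(+) (- (a, b)) ` {(k, l). k < n + a \<or> l < m + b} \<subseteq> {(k, l). k < n \<or> l < m}" by auto
  then have "perp (mon (a, b) * p) {(k, l). k < n + a \<or> l < m + b}"
    unfolding perp_mon by (rule perp_mono[OF p(2)])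
  ultimately show ?thesis using p(3) by (simp add: bs_def)
qed

lemma bs_swap: "bs n m p \<Longrightarrow> pd_form.bs (L \<circ> lswap) m n (lswap p)"
proof -
  assume "bs n m p"
  then have p: "exps p \<subseteq> {0..n} \<times> {0..m}" "perp p {(k, l). k < n \<or> l < m}" "ip p p = 1"
    by (auto simp: bs_def)
  have "exps (lswap p) \<subseteq> {0..m} \<times> {0..n}" unfolding keys_lswap using p(1) by auto
  moreover have "prod.swap ` {(k, l). k < m \<or> l < n} \<subseteq> {(k, l). k < n \<or> l < m}" by auto
  then have "perp p (prod.swap ` {(k, l). k < m \<or> l < n})" by (rule perp_mono[OF p(2)])
  ultimately show ?thesis
    unfolding pd_form.bs_def[OF pd_form_swap] perp_swap ip_swap using p(3) by simp
qed

text \<open>For a nonzero shift, moved to a suitable side of the product, one copy of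
  \<open>p\<close> is supported where the other is orthogonal.\<close>

lemma bs_norm:
  assumes "bs n m p"
  shows "L (mon a * (p * ladj p)) = (if a = 0 then 1 else 0)"
proof -
  have p: "exps p \<subseteq> {0..n} \<times> {0..m}" "perp p {(k, l). k < n \<or> l < m}" "ip p p = 1"
    using assms by (auto simp: bs_def)
  obtain x y where a: "a = (x, y)" by (cases a)
  have L: "L (mon a * (p * ladj p)) = ip (mon a * p) p" by (simp add: ip_def mult.assoc)
  consider "a = 0" | "x < 0 \<or> y < 0" | "x > 0 \<or> y > 0" by atomize_elim (use a in \<open>auto simp: zero_prod_def\<close>)
  then show ?thesis
  proof cases
    case 1
    then show ?thesis using p(3) by (simp add: ip_def)
  next
    case 2
    have "{0 + x..n + x} \<times> {0 + y..m + y} \<subseteq> {(k, l). k < n \<or> l < m}" using 2 by auto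
    then have "ip (mon a * p) p = 0"
      unfolding a by (intro perpD'[OF p(2)] order_trans[OF keys_mon_mult_subset[OF p(1)]])
    then show ?thesis unfolding L using 2 by (auto simp: a zero_prod_def)
  next
    case 3
    have "{0 + - x..n + - x} \<times> {0 + - y..m + - y} \<subseteq> {(k, l). k < n \<or> l < m}" using 3 by auto
    then have "ip p (mon (- x, - y) * p) = 0"
      by (intro perpD[OF p(2)] order_trans[OF keys_mon_mult_subset[OF p(1)]])
    then show ?thesis unfolding L ip_mon_left using 3 by (auto simp: a zero_prod_def ip_commute_eq_0)
  qed
qed

text \<open>\<open>d k\<close> is read off from the Christoffel--Darboux kernel in \<open>z\<close> of \<open>p\<close>, as in the Gohberg--Semencul
  formula. What matters is its finite support.\<close>

lemma dual_basis:
  assumes p: "bs n m p"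
  obtains d where "\<And>k. 0 \<le> k \<Longrightarrow> k < n \<Longrightarrow> exps (d k) \<subseteq> {0..n-1} \<times> {-m..m}"
    and "\<And>k b. 0 \<le> k \<Longrightarrow> k < n \<Longrightarrow> 0 \<le> fst b \<Longrightarrow> fst b < n \<Longrightarrow> ip (d k) (mon b) = (if b = (k, 0) then 1 else 0)"
proof -
  have p': "exps p \<subseteq> {0..n} \<times> {0..m}" "perp p {(k, l). k < n \<or> l < m}"
    using p by (auto simp: bs_def)
  define q where "q = mon (n, m) * ladj p"
  have q: "exps q \<subseteq> {0..n} \<times> {0..m}"
  proof -
    have "(-) (n, m) ` exps p \<subseteq> (-) (n, m) ` ({0..n} \<times> {0..m})" using p'(1) by (rule image_mono)
    then show ?thesis by (simp add: q_def keys_reflect box_reflect)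
  qed
  have "(-) (n, m) ` {(k, l). k > 0 \<or> l > 0} \<subseteq> {(k, l). k < n \<or> l < m}" by auto
  then have perp_q: "perp q {(k, l). k > 0 \<or> l > 0}"
    unfolding q_def perp_reflect by (rule perp_mono[OF p'(2)])
  have "mon (n, m) * mon (- (n, m)) = 1" by (simp add: mult_single flip: zero_prod_def)
  moreover have "mon (n, m) * ladj p * (mon (- (n, m)) * p) = mon (n, m) * mon (- (n, m)) * (p * ladj p)"
    by (simp only: ac_simps)
  ultimately have qq: "q * ladj q = p * ladj p"
    by (simp add: q_def ladj_mult_single)
  let ?P = "\<lambda>k a. mon (k - a, 0) * (p * ladj (zslice m p a))"
  let ?Q = "\<lambda>k a. mon (k - a, 0) * (q * ladj (zslice m q a))"
  have ladj_sum_zslice: "ladj f = (\<Sum>a\<in>{0..n}. mon (- a, 0) * ladj (zslice m f a))"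
    if "exps f \<subseteq> {0..n} \<times> {0..m}" for f
    using arg_cong[OF zslice_sum[OF that], of ladj] by (simp add: ladj_sum ladj_mult_single)
  have sum: "(\<Sum>a\<in>{0..n}. mon (k - a, 0) * (f * ladj (zslice m f a))) = mon (k, 0) * (f * ladj f)"
    if "exps f \<subseteq> {0..n} \<times> {0..m}" for k f
  proof -
    have "mon (k - a, 0) * (f * ladj (zslice m f a)) = mon (k, 0) * (f * (mon (- a, 0) * ladj (zslice m f a)))" for a
    proof -
      have "mon (k - a, 0) = mon (k, 0) * mon (- a, 0)" by (simp add: mult_single)
      then show ?thesis by (simp only: ac_simps)
    qed
    then have "(\<Sum>a\<in>{0..n}. mon (k - a, 0) * (f * ladj (zslice m f a))) =
        mon (k, 0) * (f * (\<Sum>a\<in>{0..n}. mon (- a, 0) * ladj (zslice m f a)))"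
      by (simp add: sum_distrib_left)
    then show ?thesis unfolding ladj_sum_zslice[OF that, symmetric] .
  qed
  \<comment> \<open>In the full sum over \<open>a\<close> the products \<open>q * ladj q\<close> and
    \<open>p * ladj p\<close> cancel. So \<open>d k\<close> is this partial sum as well as minus the
    complementary one: the first form bounds the z-degree from below, the second from above.\<close>
  define d where "d k = (\<Sum>a\<in>{0..k}. ?Q k a - ?P k a)" for k
  have d_alt: "d k = - (\<Sum>a\<in>{k+1..n}. ?Q k a - ?P k a)" if "0 \<le> k" "k < n" for k
  proof -
    have "{0..n} = {0..k} \<union> {k+1..n}" using that by auto
    then have "(\<Sum>a\<in>{0..n}. ?Q k a - ?P k a) = d k + (\<Sum>a\<in>{k+1..n}. ?Q k a - ?P k a)"
      unfolding d_def by (simp add: sum.union_disjoint)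
    moreover have "(\<Sum>a\<in>{0..n}. ?Q k a - ?P k a) = 0"
      unfolding sum_subtractf sum[OF p'(1)] sum[OF q] qq by simp
    ultimately show ?thesis by (simp add: eq_neg_iff_add_eq_0)
  qed
  have keys_term: "exps (?Q k a - ?P k a) \<subseteq> {k - a..n + k - a} \<times> {-m..m}" for k a
  proof -
    have *: "exps (mon (k - a, 0) * (f * ladj (zslice m f a))) \<subseteq> {k - a..n + k - a} \<times> {-m..m}"
      if "exps f \<subseteq> {0..n} \<times> {0..m}" for f
      using keys_mon_mult_subset[OF keys_mult_box[OF that keys_ladj_zslice[of m f a]], of "k - a" 0] by (simp add: algebra_simps)
    show ?thesis using *[OF q] *[OF p'(1)] by (rule keys_subset_diff)
  qed
  have keys: "exps (d k) \<subseteq> {0..n-1} \<times> {-m..m}" if k: "0 \<le> k" "k < n" for k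
  proof -
    have "exps (d k) \<subseteq> {0..} \<times> {-m..m}"
      unfolding d_def
    proof (rule keys_subset_sum)
      fix a assume "a \<in> {0..k}"
      then show "exps (?Q k a - ?P k a) \<subseteq> {0..} \<times> {-m..m}"
        by (intro order_trans[OF keys_term]) auto
    qed
    moreover have "exps (\<Sum>a\<in>{k+1..n}. ?Q k a - ?P k a) \<subseteq> {..n-1} \<times> {-m..m}"
    proof (rule keys_subset_sum)
      fix a assume "a \<in> {k+1..n}"
      then show "exps (?Q k a - ?P k a) \<subseteq> {..n-1} \<times> {-m..m}"
        by (intro order_trans[OF keys_term]) auto
    qed
    then have "exps (d k) \<subseteq> {..n-1} \<times> {-m..m}"
      unfolding d_alt[OF k] by (auto simp: in_keys_iff)
    ultimately have "exps (d k) \<subseteq> {0..} \<times> {-m..m} \<inter> {..n-1} \<times> {-m..m}" by blast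
    then show ?thesis by (rule order_trans) auto
  qed
  have shifted: "exps (zslice m f a * mon (b - (k - a, 0))) \<subseteq> {fst b - k + a..fst b - k + a} \<times> {snd b..m + snd b}" for f a b k
  proof -
    have "exps (mon (fst b - (k - a), snd b) * zslice m f a) \<subseteq> {0 + (fst b - (k - a))..0 + (fst b - (k - a))} \<times> {0 + snd b..m + snd b}"
      by (rule keys_mon_mult_subset[OF keys_zslice])
    moreover have *: "b - (k - a, 0) = (fst b - (k - a), snd b)" by (cases b) simp
    ultimately show ?thesis unfolding * by (simp add: mult.commute algebra_simps)
  qed
  have termf: "ip (mon (k - a, 0) * (f * ladj (zslice m f a))) (mon b) = ip f (zslice m f a * mon (b - (k - a, 0)))" for f k a b
    by (simp only: ip_mon_left ip_mult_ladj mult_single mult_1 uminus_add_conv_diff)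
  have biorth: "ip (d k) (mon b) = (if b = (k, 0) then 1 else 0)" if k: "0 \<le> k" "k < n" and b: "0 \<le> fst b" "fst b < n" for k b
  proof -
    \<comment> \<open>For \<open>b\<close> in the window the \<open>p\<close>-terms die when
      \<open>a \<le> k\<close> and the \<open>q\<close>-terms when \<open>a > k\<close>. So the
      partial sum of \<open>q\<close>-terms may be completed to
      \<open>mon (k, 0) * (q * ladj q)\<close>, whose pairings are known from
      \<open>bs_norm\<close>.\<close>
    have P0: "ip (?P k a) (mon b) = 0" if "a \<in> {0..k}" for a
      unfolding termf by (rule perpD[OF p'(2)], rule order_trans[OF shifted]) (use that b in auto)
    have Q0: "ip (?Q k a) (mon b) = 0" if "a \<in> {k+1..n}" for a
      unfolding termf by (rule perpD[OF perp_q], rule order_trans[OF shifted]) (use that b in auto)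
    have "ip (d k) (mon b) = (\<Sum>a\<in>{0..k}. ip (?Q k a) (mon b))"
      unfolding d_def ip_sum_left ip_diff_left using P0 by simp
    also have "\<dots> = (\<Sum>a\<in>{0..n}. ip (?Q k a) (mon b))"
      by (rule sum.mono_neutral_left) (use k Q0 in auto)
    also have "\<dots> = ip (mon (k, 0) * (q * ladj q)) (mon b)"
      unfolding ip_sum_left[symmetric] sum[OF q] ..
    also have "\<dots> = L (mon ((k, 0) - b) * (p * ladj p))"
    proof -
      have "mon (k, 0) * (p * ladj p) * mon (- b) = mon (k, 0) * mon (- b) * (p * ladj p)" by (simp only: ac_simps)
      then show ?thesis by (simp add: qq ip_def ladj_single mult_single)
    qed
    also have "\<dots> = (if b = (k, 0) then 1 else 0)"
      unfolding bs_norm[OF p] by auto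
    finally show ?thesis .
  qed
  show ?thesis using that[OF keys biorth] by blast
qed

text \<open>Markov property. The auxiliary \<open>G N\<close> has the inner products \<open>x\<close> of \<open>f\<close> on the window \<open>m < l \<le> N\<close>. As \<open>f\<close>
  has no coefficients there, \<open>f\<close> is orthogonal to \<open>G N\<close>, so that the norm of \<open>G N\<close> is controlled by the
  values of \<open>x\<close> near \<open>N\<close>.\<close>

lemma bs_ciW:
  assumes p: "bs n m p" and nm: "m \<ge> 0"
    and RL: "\<And>f k. (\<lambda>N. ip f (mon (k, int N))) \<longlonglongrightarrow> 0"
  shows "ciW (n - 1) m"
  unfolding ciW_def indep_def
proof (intro allI impI, elim conjE)
  fix f :: laurent
  let ?I = "{0..n - 1}"
  assume f: "exps f \<subseteq> ?I \<times> {0} \<union> ?I \<times> {1..m}" "perp f (?I \<times> {1..m})"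
  obtain d where d: "\<And>k. 0 \<le> k \<Longrightarrow> k < n \<Longrightarrow> exps (d k) \<subseteq> ?I \<times> {-m..m}"
    "\<And>k b. 0 \<le> k \<Longrightarrow> k < n \<Longrightarrow> 0 \<le> fst b \<Longrightarrow> fst b < n \<Longrightarrow> ip (d k) (mon b) = (if b = (k, 0) then 1 else 0)"
    by (rule dual_basis[OF p]) blast
  \<comment> \<open>Translation in w makes the family dual to the monomials of the whole strip;
    pairing with \<open>e a\<close> reads off coefficients.\<close>
  define e where "e a = mon (0, snd a) * d (fst a)" for a
  have keys_e: "exps (e a) \<subseteq> ?I \<times> {- m + snd a..m + snd a}" if "fst a \<in> ?I" for a
    using keys_mon_mult_subset[OF d(1)[of "fst a"], of 0 "snd a"] that by (simp add: e_def)
  have e_mon: "ip (e a) (mon b) = (if b = a then 1 else 0)" if "fst a \<in> ?I" "fst b \<in> ?I" for a b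
  proof -
    have "- (0, snd a) + b = (fst b, snd b - snd a)" by (cases b) simp
    then have "ip (e a) (mon b) = ip (d (fst a)) (mon (fst b, snd b - snd a))"
      by (simp add: e_def ip_mon_left mult_single)
    also have "\<dots> = (if (fst b, snd b - snd a) = (fst a, 0) then 1 else 0)"
      using that by (intro d(2)) auto
    finally show ?thesis by (auto simp: prod_eq_iff)
  qed
  have lookup: "ip h (e a) = coef h a"
    if h: "exps h \<subseteq> ?I \<times> {c..c'}" and a: "fst a \<in> ?I" for h a c c'
  proof -
    have "ip h (e a) = (\<Sum>b\<in>?I \<times> {c..c'}. coef h b * ip (mon b) (e a))"
      by (subst laurent_expand[OF _ h]) (auto simp: ip_linear)
    also have "\<dots> = (\<Sum>b\<in>?I \<times> {c..c'}. if b = a then coef h b else 0)"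
    proof (rule sum.cong)
      fix b assume "b \<in> ?I \<times> {c..c'}"
      then have "cnj (ip (e a) (mon b)) = (if b = a then 1 else 0)" using e_mon[OF a, of b] by auto
      then show "coef h b * ip (mon b) (e a) = (if b = a then coef h b else 0)"
        by (simp add: ip_cnj)
    qed simp
    also have "\<dots> = coef h a"
      using lookup_outside[OF h, of a] by (simp add: sum.delta)
    finally show ?thesis .
  qed
  define x where "x a = ip f (mon a)" for a
  have keys_f: "exps f \<subseteq> ?I \<times> {0..m}"
    by (rule order_trans[OF f(1)]) (use nm in auto)
  have x0: "x a = 0" if "a \<in> ?I \<times> {1..m}" for a
    using f(2) that unfolding perp_def x_def by blast
  define G where "G N = (\<Sum>a\<in>?I \<times> {m+1..int N}. cst (x a) * e a)" for N
  have keys_G: "exps (G N) \<subseteq> ?I \<times> {1..int N + m}" for N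
    unfolding G_def
  proof (rule keys_subset_sum, rule keys_subset_cst)
    fix a assume a: "a \<in> ?I \<times> {m+1..int N}"
    then have "fst a \<in> ?I" by auto
    show "exps (e a) \<subseteq> ?I \<times> {1..int N + m}"
      by (rule order_trans[OF keys_e[OF \<open>fst a \<in> ?I\<close>]]) (use a in auto)
  qed
  have G_mon: "ip (G N) (mon b) = (if b \<in> ?I \<times> {m+1..int N} then x b else 0)" if "fst b \<in> ?I" for N b
  proof -
    have "ip (G N) (mon b) = (\<Sum>a\<in>?I \<times> {m+1..int N}. if a = b then x a else 0)"
      unfolding G_def ip_sum_left ip_cst_left
    proof (rule sum.cong)
      fix a assume "a \<in> ?I \<times> {m+1..int N}"
      then have "fst a \<in> ?I" by auto
      then show "x a * ip (e a) (mon b) = (if a = b then x a else 0)" using e_mon[of a b] that by auto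
    qed simp
    then show ?thesis by (simp add: sum.delta)
  qed
  have f_G: "ip f (G N) = 0" for N
    unfolding G_def ip_sum_right ip_cst_right
  proof (rule sum.neutral, rule ballI)
    fix a assume a: "a \<in> ?I \<times> {m+1..int N}"
    have "ip f (e a) = coef f a" by (rule lookup[OF keys_f]) (use a in auto)
    also have "\<dots> = 0" by (rule lookup_outside[OF keys_f]) (use a in auto)
    finally show "cnj (x a) * ip f (e a) = 0" by simp
  qed
  \<comment> \<open>Only the \<open>m\<close> rows of \<open>x\<close> just above \<open>N\<close>
    enter, with weights independent of \<open>N\<close>.\<close>
  define \<epsilon> where "\<epsilon> N = (\<Sum>a\<in>?I \<times> {1..m}. nrm (d (fst a)) * norm (x (fst a, int N + snd a)))" for N
  have G_le: "nrm (G N) \<le> \<epsilon> N" if N: "int N \<ge> m" for N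
  proof -
    let ?g = "coef (G N)"
    have expand: "ip h (G N) = (\<Sum>b\<in>?I \<times> {1..int N + m}. cnj (?g b) * ip h (mon b))" for h
      by (subst laurent_expand[OF _ keys_G]) (auto simp: ip_linear)
    \<comment> \<open>Subtracting \<open>ip f (G N) = 0\<close> makes terms cancel wherever
      \<open>G N\<close> and \<open>f\<close> have equal inner products, that is on rows 1 to
      \<open>N\<close>; on rows 1 to \<open>m\<close> both are zero.\<close>
    have "ip (G N) (G N) = ip (G N) (G N) - ip f (G N)" by (simp add: f_G)
    also have "\<dots> = (\<Sum>b\<in>?I \<times> {1..int N + m}. cnj (?g b) * (ip (G N) (mon b) - x b))"
      unfolding expand x_def by (simp add: sum_subtractf right_diff_distrib)
    also have "\<dots> = (\<Sum>b\<in>?I \<times> {int N + 1..int N + m}. cnj (?g b) * (ip (G N) (mon b) - x b))"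
    proof (rule sum.mono_neutral_right)
      show "\<forall>b\<in>?I \<times> {1..int N + m} - ?I \<times> {int N + 1..int N + m}. cnj (?g b) * (ip (G N) (mon b) - x b) = 0"
      proof
        fix b assume b: "b \<in> ?I \<times> {1..int N + m} - ?I \<times> {int N + 1..int N + m}"
        then have "fst b \<in> ?I" by auto
        have "x b = 0" if "b \<notin> ?I \<times> {m+1..int N}"
          by (rule x0) (use b that N in auto)
        then show "cnj (?g b) * (ip (G N) (mon b) - x b) = 0"
          using G_mon[OF \<open>fst b \<in> ?I\<close>, of N] by auto
      qed
    qed (use N in auto)
    also have "\<dots> = (\<Sum>b\<in>?I \<times> {int N + 1..int N + m}. - (cnj (?g b) * x b))"
    proof (rule sum.cong)
      fix b assume b: "b \<in> ?I \<times> {int N + 1..int N + m}"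
      then have "b \<notin> ?I \<times> {m+1..int N}" "fst b \<in> ?I" by auto
      then show "cnj (?g b) * (ip (G N) (mon b) - x b) = - (cnj (?g b) * x b)" by (simp add: G_mon)
    qed simp
    finally have "norm (ip (G N) (G N)) \<le> (\<Sum>b\<in>?I \<times> {int N + 1..int N + m}. norm (?g b) * norm (x b))"
      by (simp only:) (rule order_trans[OF norm_sum], simp add: norm_mult)
    also have "\<dots> \<le> (\<Sum>b\<in>?I \<times> {int N + 1..int N + m}. nrm (G N) * (nrm (d (fst b)) * norm (x b)))"
    proof (rule sum_mono)
      fix b assume "b \<in> ?I \<times> {int N + 1..int N + m}"
      \<comment> \<open>Duality bounds a coefficient of \<open>G N\<close> by
        \<open>nrm (G N)\<close>; one factor \<open>nrm (G N)\<close> then cancels from the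
        estimate.\<close>
      then have "?g b = ip (G N) (e b)" by (intro lookup[OF keys_G, symmetric]) auto
      then have "norm (?g b) \<le> nrm (G N) * nrm (d (fst b))"
        using ip_Cauchy_Schwarz[of "G N" "e b"] by (simp add: e_def nrm_mon)
      then show "norm (?g b) * norm (x b) \<le> nrm (G N) * (nrm (d (fst b)) * norm (x b))"
        by (simp add: mult_right_mono flip: mult.assoc)
    qed
    also have "\<dots> = nrm (G N) * (\<Sum>b\<in>?I \<times> {int N + 1..int N + m}. nrm (d (fst b)) * norm (x b))"
      by (simp add: sum_distrib_left)
    also have "(\<Sum>b\<in>?I \<times> {int N + 1..int N + m}. nrm (d (fst b)) * norm (x b)) = \<epsilon> N"
      unfolding \<epsilon>_def
      by (rule sum.reindex_bij_witness[of _ "\<lambda>a. (fst a, int N + snd a)" "\<lambda>b. (fst b, snd b - int N)"]) auto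
    finally have "norm (ip (G N) (G N)) \<le> nrm (G N) * \<epsilon> N" .
    moreover have "norm (ip (G N) (G N)) = (nrm (G N))\<^sup>2"
      using ip_self_real[of "G N"] Re_ip_self_nonneg[of "G N"] by (metis nrm_square norm_of_real abs_of_nonneg)
    ultimately have "nrm (G N) * nrm (G N) \<le> nrm (G N) * \<epsilon> N" by (simp add: power2_eq_square)
    moreover have "\<epsilon> N \<ge> 0" unfolding \<epsilon>_def by (intro sum_nonneg mult_nonneg_nonneg nrm_nonneg norm_ge_zero)
    ultimately show ?thesis using nrm_nonneg[of "G N"] by (cases "nrm (G N) = 0") (auto simp: mult_le_cancel_left)
  qed
  have "\<epsilon> \<longlonglongrightarrow> (\<Sum>a\<in>?I \<times> {1..m}. nrm (d (fst a)) * 0)"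
    unfolding \<epsilon>_def
  proof (intro tendsto_sum tendsto_mult tendsto_const)
    fix a assume "a \<in> ?I \<times> {1..m}"
    then have "int N + snd a = int (N + nat (snd a))" for N by auto
    then show "(\<lambda>N. norm (x (fst a, int N + snd a))) \<longlonglongrightarrow> 0"
      using LIMSEQ_ignore_initial_segment[OF RL[of f "fst a"], of "nat (snd a)"]
      unfolding x_def by (simp add: tendsto_norm_zero)
  qed
  then have \<epsilon>: "\<epsilon> \<longlonglongrightarrow> 0" by simp
  show "perp f (?I \<times> {m + 1})"
    unfolding perp_def
  proof
    fix b assume b: "b \<in> ?I \<times> {m + 1}"
    \<comment> \<open>\<open>x b\<close> is the inner product of \<open>G N\<close> with a fixed
      monomial for every large \<open>N\<close>, hence bounded by a null sequence.\<close>
    have "norm (x b) \<le> \<epsilon> N * nrm (mon b)" if "N \<ge> nat (m + 1)" for N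
    proof -
      have "x b = ip (G N) (mon b)" using b that by (subst G_mon) auto
      then have "norm (x b) \<le> nrm (G N) * nrm (mon b)" using ip_Cauchy_Schwarz by simp
      also have "\<dots> \<le> \<epsilon> N * nrm (mon b)" using that by (intro mult_right_mono G_le nrm_nonneg) auto
      finally show ?thesis .
    qed
    moreover have "(\<lambda>N. \<epsilon> N * nrm (mon b)) \<longlonglongrightarrow> 0 * nrm (mon b)"
      using \<epsilon> by (intro tendsto_mult tendsto_const)
    ultimately have "norm (x b) \<le> 0 * nrm (mon b)"
      by (intro LIMSEQ_le_const[where X = "\<lambda>N. \<epsilon> N * nrm (mon b)"]) auto
    then show "ip f (mon b) = 0" by (simp add: x_def)
  qed
qed


text \<open>Translated up by \<open>s + 1\<close>, \<open>f\<close> reaches row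
  \<open>m + s + 1\<close> and is orthogonal to rows 1 to \<open>m + s\<close>. The independence
  then gives row 0, which was row \<open>-(s + 1)\<close> before the translation.\<close>

lemma ciW_below:
  assumes W: "\<And>j. j \<ge> m \<Longrightarrow> ciW i j" and f: "exps f \<subseteq> {0..i} \<times> {0..m}" "perp f ({0..i} \<times> {0..m-1})"
    and "m \<ge> 0"
  shows "perp f ({0..i} \<times> {- int s..m-1})"
proof (induction s)
  case 0
  then show ?case using f(2) by simp
next
  case (Suc s)
  let ?f = "mon (0, int s + 1) * f"
  have keys: "exps ?f \<subseteq> {0..i} \<times> {int s + 1..m + int s + 1}"
    using keys_mon_mult_subset[OF f(1), of 0 "int s + 1"] by (simp add: algebra_simps)
  have "perp ?f ({0..i} \<times> {1..m + int s})"
  proof -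
    have "(+) (- (0, int s + 1)) ` ({0..i} \<times> {1..m + int s}) \<subseteq> {0..i} \<times> {- int s..m-1}" by auto
    then show ?thesis unfolding perp_mon by (rule perp_mono[OF Suc])
  qed
  moreover have "ciW i (m + int s)" using W by simp
  ultimately have "perp ?f ({0..i} \<times> {0})"
    unfolding ciW_def
    by (intro indepD[OF indep_sym[of "{0..i} \<times> {1..m + int s}" "{0..i} \<times> {0}" "{0..i} \<times> {m + int s + 1}"]]
       order_trans[OF keys]) auto
  moreover have "{0..i} \<times> {- int (Suc s)} \<subseteq> (+) (- (0, int s + 1)) ` ({0..i} \<times> {0})"
  proof
    fix a assume "a \<in> {0..i} \<times> {- int (Suc s)}"
    then show "a \<in> (+) (- (0, int s + 1)) ` ({0..i} \<times> {0})"
      by (intro image_eqI[of _ _ "(fst a, 0)"]) auto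
  qed
  ultimately have "perp f ({0..i} \<times> {- int (Suc s)})" unfolding perp_mon by (rule perp_mono)
  then have "perp f ({0..i} \<times> {- int (Suc s)} \<union> {0..i} \<times> {- int s..m-1})" using Suc by (simp add: perp_Un)
  then show ?case by (rule perp_mono) auto
qed

text \<open>For \<open>g\<close> over \<open>?Y\<close> orthogonal to \<open>?C\<close>, let
  \<open>h\<close> be its projection to \<open>?X\<close>. As \<open>g - h\<close> has no terms in
  column \<open>n\<close> (by \<open>top\<close>), \<open>h\<close> lies over \<open>?C\<close>; so
  it is orthogonal to both \<open>g\<close> and \<open>g - h\<close> and vanishes.\<close>

lemma bs_ciK:
  assumes p: "bs n m p" and nm: "n \<ge> 1" "m \<ge> 1" and W: "\<And>j. j \<ge> m \<Longrightarrow> ciW n j"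
  shows "ciK n m"
proof -
  have p': "exps p \<subseteq> {0..n} \<times> {0..m}" "perp p {(k, l). k < n \<or> l < m}" "ip p p = 1"
    using p by (auto simp: bs_def)
  let ?C = "{0..n-1} \<times> {0..m-1}" and ?X = "{0..n} \<times> {0..m-1}" and ?Y = "{0..n-1} \<times> {0..m}"
  have X: "?X = {n} \<times> {0..m-1} \<union> ?C" and Y: "?Y = {0..n-1} \<times> {m} \<union> ?C" using nm by auto
  have top: "coef f (n, l) = 0"
    if f: "exps f \<subseteq> {0..n} \<times> {0..m}" "perp f ?X" "ip f p = 0" for f l
  proof (cases "l \<in> {0..m}")
    case False
    then show ?thesis by (intro lookup_outside[OF f(1)]) auto
  next
    case True
    \<comment> \<open>For positive \<open>b\<close> the orthogonality of \<open>p\<close> suffices;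
      for negative \<open>b\<close> the translate of \<open>p\<close> lies below row
      \<open>m\<close>, where \<open>ciW_below\<close> applies.\<close>
    have shifts: "ip f (mon (0, b) * p) = 0" if "b \<in> {-m..m}" for b
    proof -
      consider "b = 0" | "b > 0" | "b < 0" by linarith
      then show ?thesis
      proof cases
        case 1
        then show ?thesis using f(3) by (simp flip: zero_prod_def)
      next
        case 2
        have "exps (mon (0, - b) * f) \<subseteq> {(k, l). k < n \<or> l < m}"
          by (rule order_trans[OF keys_mon_mult_subset[OF f(1)]]) (use 2 in auto)
        then have "ip (mon (0, - b) * f) p = 0" by (rule perpD'[OF p'(2)])
        then show ?thesis by (simp add: ip_mon_left)
      next
        case 3
        have "perp f ({0..n} \<times> {- int (nat m)..m-1})"
          using W f(1,2) nm by (intro ciW_below) auto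
        moreover have "exps (mon (0, b) * p) \<subseteq> {0..n} \<times> {- int (nat m)..m-1}"
          by (rule order_trans[OF keys_mon_mult_subset[OF p'(1)]]) (use 3 that in auto)
        ultimately show ?thesis by (rule perpD)
      qed
    qed
    \<comment> \<open>\<open>P\<close> is the coefficient of z^n in \<open>p\<close>. The product
      \<open>w^l p (ladj P)\<close> combines the translates in \<open>shifts\<close>, yet its
      pairing reads off the coefficient at \<open>(n, l)\<close>.\<close>
    define P where "P = zslice m p n"
    have "ip f (mon (0, l) * (p * ladj P)) = 0"
    proof -
      define c where "c = coef (ladj P)"
      have P: "ladj P = (\<Sum>a\<in>{0..0} \<times> {-m..0}. cst (c a) * mon a)"
        unfolding P_def c_def by (rule laurent_expand[OF _ keys_ladj_zslice]) simp
      have "mon (0, l) * (p * ladj P) = (\<Sum>a\<in>{0..0} \<times> {-m..0}. cst (c a) * (mon (0, l) * (mon a * p)))"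
        unfolding P sum_distrib_left by (rule sum.cong) (simp_all only: ac_simps)
      moreover have "ip f (mon (0, l) * (mon a * p)) = 0" if "a \<in> {0..0} \<times> {-m..0}" for a
      proof -
        have "mon (0, l) * (mon a * p) = mon (0, l + snd a) * p"
          using that by (auto simp: mult_single simp flip: mult.assoc)
        then show ?thesis using shifts[of "l + snd a"] that True by auto
      qed
      ultimately show ?thesis by (simp add: ip_linear)
    qed
    moreover have "ip (mon a) (mon (0, l) * (p * ladj P)) = (if a = (n, l) then 1 else 0)" if a: "a \<in> {0..n} \<times> {0..m}" for a
    proof -
      have "ip (mon (0, l) * (p * ladj P)) (mon a) = ip p (P * mon (fst a, snd a - l))"
        by (cases a) (simp add: ip_mon_left ip_mult_ladj mult_single)
      also have "\<dots> = (if a = (n, l) then 1 else 0)"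
      proof (cases "fst a = n")
        case False
        have "exps (mon (fst a, snd a - l) * P) \<subseteq> {(k, l). k < n \<or> l < m}"
          unfolding P_def by (rule order_trans[OF keys_mon_mult_subset[OF keys_zslice]]) (use False a in auto)
        then have "ip p (P * mon (fst a, snd a - l)) = 0" unfolding mult.commute[of P] by (rule perpD[OF p'(2)])
        then show ?thesis using False by auto
      next
        case True
        \<comment> \<open>Up to lower columns \<open>r\<close>, whose vertical translates are
          orthogonal to \<open>p\<close>, \<open>z^n P\<close> is \<open>p\<close> itself, so the
          pairing reduces to a moment of \<open>p * ladj p\<close>.\<close>
        define r where "r = (\<Sum>i\<in>{0..n-1}. mon (i, 0) * zslice m p i)"
        have "{0..n} = insert n {0..n-1}" using nm by auto
        then have pr: "p = mon (n, 0) * P + r"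
          unfolding P_def r_def by (subst zslice_sum[OF p'(1)]) simp
        have keys_r: "exps r \<subseteq> {0..n-1} \<times> {0..m}"
          unfolding r_def
        proof (rule keys_subset_sum)
          fix i assume "i \<in> {0..n-1}"
          then show "exps (mon (i, 0) * zslice m p i) \<subseteq> {0..n-1} \<times> {0..m}"
            by (intro order_trans[OF keys_mon_mult_subset[OF keys_zslice]]) auto
        qed
        have "exps (mon (0, snd a - l) * r) \<subseteq> {(k, l). k < n \<or> l < m}"
          by (rule order_trans[OF keys_mon_mult_subset[OF keys_r]]) auto
        then have "ip p (mon (0, snd a - l) * r) = 0" by (rule perpD[OF p'(2)])
        moreover have "mon (0, snd a - l) * p = P * mon (n, snd a - l) + mon (0, snd a - l) * r"
        proof -
          have "mon (0, snd a - l) * (mon (n, 0) * P) = mon (n, snd a - l) * P"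
            by (simp add: mult_single flip: mult.assoc)
          then show ?thesis by (subst pr) (simp add: distrib_left mult.commute)
        qed
        ultimately have "ip p (P * mon (n, snd a - l)) = ip p (mon (0, snd a - l) * p)"
          by (simp add: ip_linear)
        also have "\<dots> = cnj (L (mon (0, snd a - l) * (p * ladj p)))"
          by (subst ip_cnj[symmetric]) (simp add: ip_def mult.assoc)
        also have "\<dots> = (if a = (n, l) then 1 else 0)"
          unfolding bs_norm[OF p] using True by (cases a) (auto simp: zero_prod_def)
        finally show ?thesis using True by simp
      qed
      finally have "cnj (ip (mon (0, l) * (p * ladj P)) (mon a)) = (if a = (n, l) then 1 else 0)" by simp
      then show ?thesis by (simp add: ip_cnj)
    qed
    then have "(\<Sum>a\<in>{0..n} \<times> {0..m}. coef f a * ip (mon a) (mon (0, l) * (p * ladj P))) =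
        (\<Sum>a\<in>{0..n} \<times> {0..m}. if a = (n, l) then coef f a else 0)"
      by (intro sum.cong) auto
    moreover have "ip f (mon (0, l) * (p * ladj P)) =
        (\<Sum>a\<in>{0..n} \<times> {0..m}. coef f a * ip (mon a) (mon (0, l) * (p * ladj P)))"
      by (subst laurent_expand[OF _ f(1)]) (simp_all add: ip_linear)
    ultimately show ?thesis using True nm by (simp add: sum.delta)
  qed
  have "indep ?C ({0..n-1} \<times> {m}) ({n} \<times> {0..m-1})"
    unfolding indep_def
  proof (intro allI impI, elim conjE)
    fix g assume g: "exps g \<subseteq> {0..n-1} \<times> {m} \<union> ?C" "perp g ?C"
    then have gY: "exps g \<subseteq> ?Y" by (simp only: Y)
    obtain h where h: "exps h \<subseteq> ?X" "perp (g - h) ?X" using projection[of ?X] by auto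
    have "ip g p = 0" by (rule perpD'[OF p'(2)]) (rule order_trans[OF gY], auto)
    moreover have "ip h p = 0" by (rule perpD'[OF p'(2)]) (rule order_trans[OF h(1)], auto)
    ultimately have gp: "ip (g - h) p = 0" by (simp add: ip_linear)
    have keys: "exps (g - h) \<subseteq> {0..n} \<times> {0..m}"
      by (rule keys_subset_diff[OF order_trans[OF gY] order_trans[OF h(1)]]) auto
    have "coef g (n, l) = 0" for l by (rule lookup_outside[OF gY]) simp
    then have "coef h (n, l) = 0" for l
      using top[OF keys h(2) gp, of l] by (simp add: lookup_minus)
    then have "(n, l) \<notin> exps h" for l by (simp add: in_keys_iff)
    then have "exps h \<subseteq> {0..n} \<times> {0..m-1} - {n} \<times> UNIV" using h(1) by blast
    then have hC: "exps h \<subseteq> ?C" by (rule order_trans) auto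
    have "ip g h = 0" by (rule perpD[OF g(2) hC])
    moreover have "ip (g - h) h = 0" by (rule perpD[OF h(2,1)])
    ultimately have "h = 0" by (simp add: ip_linear)
    then show "perp g ({n} \<times> {0..m-1})" using h(2) by (simp add: X perp_Un)
  qed
  then show ?thesis unfolding ciK_def by (rule indep_sym[rotated]) simp
qed

text \<open>The polynomial \<open>z^(i-n) w^(j-m) p\<close> has degree \<open>(i, j)\<close> and the
  same weight. \<open>bs_ciK\<close> needs \<open>ciW\<close> with first index \<open>i\<close>
  itself, obtained by raising the z-degree once more.\<close>

lemma bs_imp_ci:
  assumes p: "bs n m p" and nm: "n \<ge> 1" "m \<ge> 1"
    and RL: "\<And>f k. (\<lambda>N. ip f (mon (k, int N))) \<longlonglongrightarrow> 0" "\<And>f k. (\<lambda>N. ip f (mon (int N, k))) \<longlonglongrightarrow> 0"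
    and ij: "i \<ge> n" "j \<ge> m"
  shows "ciK i j" "ciW (i - 1) j" "ciZ i (j - 1)"
proof -
  have bs: "bs i j (mon (i - n, j - m) * p)" if "i \<ge> n" "j \<ge> m" for i j
    using bs_shift[OF p, of "i - n" "j - m"] that by simp
  have W: "ciW (i - 1) j" if "i \<ge> n" "j \<ge> m" for i j
    using bs_ciW[OF bs[OF that] _ RL(1)] that nm by simp
  show "ciW (i - 1) j" using W ij by blast
  show "ciK i j"
    using W[of "i + 1"] ij nm by (intro bs_ciK[OF bs[OF ij]]) auto
  have "pd_form.ciW (L \<circ> lswap) (j - 1) i"
  proof (rule pd_form.bs_ciW[OF pd_form_swap bs_swap[OF bs[OF ij]]])
    show "(\<lambda>N. pd_form.ip (L \<circ> lswap) f (mon (k, int N))) \<longlonglongrightarrow> 0" for f k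
      unfolding ip_swap using RL(2)[of "lswap f" k] by simp
  qed (use ij nm in simp)
  then show "ciZ i (j - 1)" by (simp add: ci_swap)
qed

text \<open>Both polynomials are orthogonal to the rectangle without its top corner, so they are
  proportional, and the orthogonality of \<open>p\<close> beyond the rectangle passes to
  \<open>f\<close>.\<close>

lemma bs_orthopoly:
  assumes p: "bs i j p" and f: "is_orthopoly ({0..i} \<times> {0..j}) (i, j) f" and ij: "i \<ge> 0" "j \<ge> 0"
  shows "bs i j f"
proof -
  have p': "exps p \<subseteq> {0..i} \<times> {0..j}" "perp p {(k, l). k < i \<or> l < j}" "ip p p = 1"
    using p by (auto simp: bs_def)
  have f': "exps f \<subseteq> {0..i} \<times> {0..j}" "coef f (i, j) \<noteq> 0"
     "perp f ({0..i} \<times> {0..j} - {(i, j)})" "ip f f = 1"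
    using f by (auto simp: is_orthopoly_def)
  define t where "t = coef p (i, j) / coef f (i, j)"
  define r where "r = p - cst t * f"
  have "exps r \<subseteq> {0..i} \<times> {0..j}"
    unfolding r_def by (rule keys_subset_diff[OF p'(1) keys_subset_cst[OF f'(1)]])
  moreover have "(i, j) \<notin> exps r"
    using f'(2) by (simp add: r_def t_def in_keys_iff lookup_minus)
  ultimately have keys: "exps r \<subseteq> {0..i} \<times> {0..j} - {(i, j)}" by blast
  have "perp p ({0..i} \<times> {0..j} - {(i, j)})" by (rule perp_mono[OF p'(2)]) auto
  then have "perp r ({0..i} \<times> {0..j} - {(i, j)})"
    unfolding r_def using f'(3) by (intro perp_diff perp_cst)
  then have "r = 0" using keys by (rule perp_self)
  then have pf: "p = cst t * f" by (simp add: r_def)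
  have "t \<noteq> 0" using pf p'(3) by auto
  have "cst (1 / t) * p = f"
    unfolding pf using \<open>t \<noteq> 0\<close> by (simp add: mult_single flip: mult.assoc)
  then have "perp f {(k, l). k < i \<or> l < j}" using perp_cst[OF p'(2), of "1 / t"] by simp
  then show ?thesis using f'(1,4) by (simp add: bs_def)
qed

text \<open>At the edge of the region only one of the two polynomials in the parameter has degree at
  least \<open>(n, m)\<close>. Its orthogonality to a half plane is enough, since the other one is
  supported there.\<close>

lemma bs_imp_u_pos_0:
  assumes p: "bs n m p" and nm: "n \<ge> 1" "m \<ge> 1"
    and ij: "n \<le> int i + 1 \<and> m \<le> int j \<or> n \<le> int i \<and> m \<le> int j + 1"
  shows "u_pos L (Suc i) (Suc j) = 0"
proof -
  have bs: "bs i j (mon (i - n, j - m) * p)" if "i \<ge> n" "j \<ge> m" for i j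
    using bs_shift[OF p, of "i - n" "j - m"] that by simp
  have f: "is_orthopoly ({0..int i + 1} \<times> {0..int j}) (int i + 1, int j) (phi L (Suc i) j j)"
  proof -
    have "{0..int i} \<times> {0..int j} \<union> {int i + 1} \<times> {0..int j} = {0..int i + 1} \<times> {0..int j}" by auto
    then show ?thesis using phi_is[of j j "Suc i"] by (simp add: add.commute)
  qed
  have g: "is_orthopoly ({0..int i} \<times> {0..int j + 1}) (int i, int j + 1) (phi_rev L i (Suc j) i)"
  proof -
    have "{0..int i} \<times> {0..int j} \<union> {0..int i} \<times> {int j + 1} = {0..int i} \<times> {0..int j + 1}" by auto
    then show ?thesis using phi_rev_is[of i i "Suc j"] by (simp add: add.commute)
  qed
  have keys_f: "exps (mon (0, 1) * phi L (Suc i) j j) \<subseteq> {0..int i + 1} \<times> {1..int j + 1}"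
    using keys_mon_mult_subset[OF is_orthopolyD(1)[OF f], of 0 1] by simp
  have keys_g: "exps (mon (int i, int j + 1) * ladj (phi_rev L i (Suc j) i)) \<subseteq> {0..int i} \<times> {0..int j + 1}"
    using image_mono[OF is_orthopolyD(1)[OF g], of "(-) (int i, int j + 1)"] by (simp add: keys_reflect box_reflect)
  have "ip (mon (0, 1) * phi L (Suc i) j j) (mon (int i, int j + 1) * ladj (phi_rev L i (Suc j) i)) = 0"
    using ij
  proof (elim disjE conjE)
    assume "n \<le> int i + 1" "m \<le> int j"
    then have "bs (int i + 1) (int j) (phi L (Suc i) j j)"
      by (intro bs_orthopoly[OF bs f]) auto
    then have "perp (phi L (Suc i) j j) {(k, l). k < int i + 1 \<or> l < int j}" by (simp add: bs_def)
    moreover have "(+) (- (0, 1)) ` {(k, l). k < int i + 1} \<subseteq> {(k, l). k < int i + 1 \<or> l < int j}" by auto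
    ultimately have "perp (mon (0, 1) * phi L (Suc i) j j) {(k, l). k < int i + 1}"
      unfolding perp_mon by (rule perp_mono)
    then show ?thesis by (rule perpD) (rule order_trans[OF keys_g], auto)
  next
    assume "n \<le> int i" "m \<le> int j + 1"
    then have "bs (int i) (int j + 1) (phi_rev L i (Suc j) i)"
      by (intro bs_orthopoly[OF bs g]) auto
    then have "perp (phi_rev L i (Suc j) i) {(k, l). k < int i \<or> l < int j + 1}" by (simp add: bs_def)
    moreover have "(-) (int i, int j + 1) ` {(k, l). l > 0} \<subseteq> {(k, l). k < int i \<or> l < int j + 1}" by auto
    ultimately have "perp (mon (int i, int j + 1) * ladj (phi_rev L i (Suc j) i)) {(k, l). l > 0}"
      unfolding perp_reflect by (rule perp_mono)
    then show ?thesis by (rule perpD') (rule order_trans[OF keys_f], auto)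
  qed
  then show ?thesis unfolding u_pos_eq_0_iff by (simp add: add.commute)
qed

end

subsection \<open>Evaluation and the functional of a measure\<close>

definition pw :: "int \<times> int \<Rightarrow> complex \<times> complex \<Rightarrow> complex" where
  "pw a x = fst x powi fst a * snd x powi snd a"

lemma leval_sum:
  assumes "finite S" "exps f \<subseteq> S"
  shows "leval f x = (\<Sum>a\<in>S. coef f a * pw a x)"
proof -
  have "leval f x = (\<Sum>a\<in>exps f. coef f a * pw a x)"
    by (simp add: leval_def pw_def case_prod_unfold mult.assoc)
  also have "\<dots> = (\<Sum>a\<in>S. coef f a * pw a x)"
    using assms by (intro sum.mono_neutral_left) (auto simp: in_keys_iff)
  finally show ?thesis .
qed

lemma leval_add: "leval (f + g) x = leval f x + leval g x"
proof -
  let ?S = "exps f \<union> exps g"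
  have "exps (f + g) \<subseteq> ?S" by (rule keys_add)
  then show ?thesis by (simp add: leval_sum[of ?S] lookup_add distrib_right sum.distrib)
qed

lemma leval_cst: "leval (cst c * f) x = c * leval f x"
  using keys_cst_mult[of c f] by (simp add: leval_sum[of "exps f"] sum_distrib_left mult.assoc)

lemma leval_mon: "leval (mon a) x = pw a x"
  by (simp add: leval_sum[of "{a}"])

text \<open>Additivity of exponents is a hypothesis because it can fail at a zero argument. It holds
  off the axes, and for nonnegative exponents everywhere; stability needs the latter.\<close>

lemma leval_mon_mult:
  assumes "\<And>b. b \<in> exps f \<Longrightarrow> pw (a + b) x = pw a x * pw b x"
  shows "leval (mon a * f) x = pw a x * leval f x"
proof -
  have "leval (mon a * f) x = (\<Sum>b\<in>(+) a ` exps f. coef f (b - a) * pw b x)"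
    by (subst leval_sum[of "(+) a ` exps f"]) (simp_all add: keys_mon_mult)
  also have "\<dots> = (\<Sum>b\<in>exps f. coef f b * pw (a + b) x)"
    by (subst sum.reindex) (auto simp: inj_on_def)
  also have "\<dots> = pw a x * leval f x"
    using assms by (simp add: leval_sum[of "exps f"] sum_distrib_left mult.left_commute)
  finally show ?thesis .
qed

lemma pw_add: "fst x \<noteq> 0 \<Longrightarrow> snd x \<noteq> 0 \<Longrightarrow> pw (a + b) x = pw a x * pw b x"
  by (simp add: pw_def power_int_add)

lemma leval_mult:
  assumes "fst x \<noteq> 0" "snd x \<noteq> 0"
  shows "leval (f * g) x = leval f x * leval g x"
proof (induction f rule: laurent_induct)
  case (monom c a)
  have "leval (cst c * mon a * g) x = c * leval (mon a * g) x" by (simp add: leval_cst mult.assoc)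
  also have "leval (mon a * g) x = pw a x * leval g x"
    using assms by (intro leval_mon_mult pw_add)
  finally show ?case by (simp add: leval_cst leval_mon)
next
  case (add p q)
  then show ?case by (simp add: distrib_right leval_add)
qed

lemma leval_z:
  assumes "exps f \<subseteq> {0..} \<times> {0..}"
  shows "leval (mon (1, 0) * f) (z, w) = z * leval f (z, w)"
    and "leval (mon (0, 1) * f) (z, w) = w * leval f (z, w)"
proof -
  have *: "z powi (1 + i) = z * z powi i" if "i \<ge> 0" for z :: complex and i
  proof -
    have "nat (1 + i) = Suc (nat i)" using that by simp
    then show ?thesis using that by (simp add: power_int_def)
  qed
  have "leval (mon (1, 0) * f) (z, w) = pw (1, 0) (z, w) * leval f (z, w)"
    by (rule leval_mon_mult) (use assms * in \<open>auto simp: pw_def\<close>)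
  then show "leval (mon (1, 0) * f) (z, w) = z * leval f (z, w)" by (simp add: pw_def)
  have "leval (mon (0, 1) * f) (z, w) = pw (0, 1) (z, w) * leval f (z, w)"
    by (rule leval_mon_mult) (use assms * in \<open>auto simp: pw_def\<close>)
  then show "leval (mon (0, 1) * f) (z, w) = w * leval f (z, w)" by (simp add: pw_def)
qed

lemma bicircle_nz: "x \<in> bicircle \<Longrightarrow> fst x \<noteq> 0 \<and> snd x \<noteq> 0"
  by (auto simp: bicircle_def)

lemma pw_cnj: "x \<in> bicircle \<Longrightarrow> cnj (pw a x) = pw (- a) x"
proof -
  assume x: "x \<in> bicircle"
  have *: "cnj z powi k = z powi (- k)" if "norm z = 1" for z :: complex and k
  proof -
    have "z * cnj z = 1" using that by (metis complex_norm_square of_real_1 power_one)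
    then have "cnj z = inverse z" by (metis inverse_unique)
    then show ?thesis by (simp add: power_int_minus power_int_inverse)
  qed
  show ?thesis using x by (auto simp: pw_def bicircle_def *)
qed

lemma norm_pw: "x \<in> bicircle \<Longrightarrow> norm (pw a x) = 1"
  by (auto simp: pw_def bicircle_def norm_mult norm_power_int)

lemma leval_ladj: "x \<in> bicircle \<Longrightarrow> leval (ladj f) x = cnj (leval f x)"
proof (induction f rule: laurent_induct)
  case (monom c a)
  then show ?case
    using leval_cst[of "cnj c" "mon (- a)" x] leval_cst[of c "mon a" x]
    by (simp add: mult_single ladj_single leval_mon pw_cnj)
next
  case (add p q)
  then show ?case by (simp add: ladj_add leval_add)
qed

lemma compact_bicircle: "compact bicircle"
  unfolding bicircle_def by (intro compact_Times) auto

lemma continuous_pw: "continuous_on bicircle (pw a)"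
  unfolding pw_def[abs_def] using bicircle_nz by (intro continuous_intros) auto

lemma continuous_leval: "continuous_on bicircle (leval f)"
proof -
  have "leval f = (\<lambda>x. \<Sum>a\<in>exps f. coef f a * pw a x)"
    by (rule ext) (simp add: leval_sum[of "exps f"])
  then show ?thesis by (auto intro!: continuous_intros continuous_pw)
qed

lemma bicircle_measure_finite: "bicircle_measure M \<Longrightarrow> finite_measure M"
  by (simp add: bicircle_measure_def)

lemma bicircle_space: "bicircle_measure M \<Longrightarrow> space M = bicircle"
  using sets_eq_imp_space_eq[of M "restrict_space borel bicircle"]
  by (simp add: bicircle_measure_def space_restrict_space)

lemma bicircle_measurable:
  fixes f :: "complex \<times> complex \<Rightarrow> 'a::topological_space"
  assumes "bicircle_measure M" "continuous_on bicircle f"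
  shows "f \<in> borel_measurable M"
  using borel_measurable_continuous_on_restrict[OF assms(2)] assms(1)
  by (simp add: bicircle_measure_def cong: measurable_cong_sets)

lemma bicircle_bounded:
  fixes f :: "complex \<times> complex \<Rightarrow> 'a::real_normed_vector"
  assumes "continuous_on bicircle f"
  obtains B where "B > 0" "\<And>x. x \<in> bicircle \<Longrightarrow> norm (f x) \<le> B"
proof -
  have "bounded (f ` bicircle)"
    using compact_continuous_image[OF assms compact_bicircle] by (rule compact_imp_bounded)
  then show ?thesis using that unfolding bounded_pos by auto
qed

lemma bicircle_integrable:
  fixes f :: "complex \<times> complex \<Rightarrow> 'a::{banach, second_countable_topology}"
  assumes "bicircle_measure M" "continuous_on bicircle f"
  shows "integrable M f"
proof -
  obtain B where "\<And>x. x \<in> bicircle \<Longrightarrow> norm (f x) \<le> B" using bicircle_bounded[OF assms(2)] by blast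
  then have "AE x in M. norm (f x) \<le> B" using bicircle_space[OF assms(1)] by auto
  then show ?thesis
    using bicircle_measurable[OF assms] finite_measure.integrable_const_bound[OF bicircle_measure_finite[OF assms(1)]] by blast
qed

lemma bicircle_integral_cong:
  assumes "bicircle_measure M" "\<And>x. x \<in> bicircle \<Longrightarrow> f x = g x"
  shows "(LINT x|M. f x) = (LINT x|M. g x)"
  by (rule Bochner_Integration.integral_cong) (use assms bicircle_space in auto)

text \<open>\<open>positive_definite\<close> speaks of polynomials only. A high power of zw turns
  any Laurent polynomial into one and cancels in \<open>p * ladj p\<close>.\<close>

lemma pd_form_Lfun:
  assumes M: "bicircle_measure M" and pd: "positive_definite (Lfun M)"
  shows "pd_form (Lfun M)"
proof
  note int = bicircle_integrable[OF M continuous_leval]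
  show add: "Lfun M (p + q) = Lfun M p + Lfun M q" for p q
    unfolding Lfun_def leval_add by (simp add: int distrib_left)
  show "Lfun M (cst c * p) = c * Lfun M p" for c p
    unfolding Lfun_def leval_cst by simp
  show "Lfun M (ladj p) = cnj (Lfun M p)" for p
  proof -
    have "(LINT x|M. leval (ladj p) x) = (LINT x|M. cnj (leval p x))"
      using M by (rule bicircle_integral_cong) (rule leval_ladj)
    then show ?thesis by (simp add: Lfun_def)
  qed
  show "0 < Lfun M (p * ladj p)" if "p \<noteq> 0" for p
  proof -
    obtain N :: int where N: "\<And>a. a \<in> exps p \<Longrightarrow> \<bar>fst a\<bar> \<le> N \<and> \<bar>snd a\<bar> \<le> N"
    proof -
      let ?N = "Max ((\<lambda>a. max \<bar>fst a\<bar> \<bar>snd a\<bar>) ` exps p)"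
      have "max \<bar>fst a\<bar> \<bar>snd a\<bar> \<le> ?N" if "a \<in> exps p" for a
        using that by (intro Max_ge) auto
      then show ?thesis using that[of ?N] by fastforce
    qed
    define r where "r = mon (N, N) * p"
    have "exps r \<subseteq> {0..} \<times> {0..}"
      unfolding r_def keys_mon_mult using N by (fastforce simp: abs_le_iff)
    moreover have "r \<noteq> 0"
    proof
      assume "r = 0"
      then have "mon (- N, - N) * r = 0" by simp
      then show False using that by (simp add: r_def mult_single flip: mult.assoc zero_prod_def)
    qed
    ultimately have "0 < Lfun M (r * ladj r)" using pd by (simp add: positive_definite_def)
    moreover have "r * ladj r = p * ladj p"
    proof -
      have "mon (N, N) * mon (- (N, N)) = 1" by (simp add: mult_single flip: zero_prod_def)
      moreover have "mon (N, N) * p * (mon (- (N, N)) * ladj p) = mon (N, N) * mon (- (N, N)) * (p * ladj p)"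
        by (simp only: ac_simps)
      ultimately show ?thesis by (simp add: r_def ladj_mult_single)
    qed
    ultimately show ?thesis by simp
  qed
qed

subsection \<open>Uniqueness of the measure with given moments\<close>

text \<open>On the unit circle the conjugate of z is 1/z, so real and imaginary parts are Laurent
  polynomials, and real Stone-Weierstrass approximation becomes Laurent approximation.\<close>

lemma real_polynomial_on_bicircle:
  assumes "real_polynomial_function h"
  shows "\<exists>Q. \<forall>x\<in>bicircle. of_real (h x) = leval Q x"
  using assms
proof (induction rule: real_polynomial_function.induct)
  case (linear h)
  interpret bounded_linear h by fact
  have Re: "of_real (Re z) = (z + inverse z) / 2" "of_real (Im z) = (z - inverse z) / (2 * \<i>)" if "norm z = 1" for z :: complex
  proof -
    have "z * cnj z = 1" using that by (metis complex_norm_square of_real_1 power_one)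
    then have "inverse z = cnj z" by (metis inverse_unique)
    then show "of_real (Re z) = (z + inverse z) / 2" "of_real (Im z) = (z - inverse z) / (2 * \<i>)"
      by (simp_all add: complex_eq_iff)
  qed
  \<comment> \<open>\<open>P a c d\<close> is the Laurent form of c Re + d Im of the coordinate
    \<open>mon a\<close>; \<open>c\<close> and \<open>d\<close> will be the values of
    \<open>h\<close> on the real basis.\<close>
  define P where "P a c d = cst (c / 2) * (mon a + mon (- a)) + cst (d / (2 * \<i>)) * (mon a - mon (- a))" for a c d
  define Q where "Q = P (1, 0) (of_real (h (1, 0))) (of_real (h (\<i>, 0))) + P (0, 1) (of_real (h (0, 1))) (of_real (h (0, \<i>)))"
  have sub: "leval (f - g) x = leval f x - leval g x" for f g x
    using leval_add[of "f - g" g x] by simp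
  have "of_real (h x) = leval Q x" if "x \<in> bicircle" for x
  proof -
    obtain z w where x: "x = (z, w)" by (cases x)
    have n: "norm z = 1" "norm w = 1" using that by (auto simp: x bicircle_def)
    have "x = Re z *\<^sub>R (1, 0) + Im z *\<^sub>R (\<i>, 0) + (Re w *\<^sub>R (0, 1) + Im w *\<^sub>R (0, \<i>))"
      by (simp add: x complex_eq_iff)
    then have "h x = Re z * h (1, 0) + Im z * h (\<i>, 0) + (Re w * h (0, 1) + Im w * h (0, \<i>))"
      by (metis add scaleR real_scaleR_def)
    then have "of_real (h x) = of_real (Re z) * of_real (h (1, 0)) + of_real (Im z) * of_real (h (\<i>, 0)) +
        (of_real (Re w) * of_real (h (0, 1)) + of_real (Im w) * (of_real (h (0, \<i>)) :: complex))" by simp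
    also have "\<dots> = leval Q x"
      unfolding Re[OF n(1)] Re[OF n(2)]
      by (simp add: Q_def P_def leval_add leval_cst leval_mon sub x pw_def power_int_minus)
         (simp add: mult.commute mult.left_commute)
    finally show ?thesis .
  qed
  then show ?case by blast
next
  case (const c)
  have "of_real c = leval (cst (of_real c) * mon 0) x" for x
    unfolding leval_cst leval_mon by (simp add: pw_def)
  then show ?case by blast
next
  case (add f g)
  then obtain P Q where "\<forall>x\<in>bicircle. of_real (f x) = leval P x" "\<forall>x\<in>bicircle. of_real (g x) = leval Q x" by blast
  then have "\<forall>x\<in>bicircle. of_real (f x + g x) = leval (P + Q) x" by (simp add: leval_add)
  then show ?case by blast
next
  case (mult f g)
  then obtain P Q where "\<forall>x\<in>bicircle. of_real (f x) = leval P x" "\<forall>x\<in>bicircle. of_real (g x) = leval Q x" by blast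
  then have "\<forall>x\<in>bicircle. of_real (f x * g x) = leval (P * Q) x" using bicircle_nz by (simp add: leval_mult)
  then show ?case by blast
qed

lemma laurent_dense:
  fixes h :: "complex \<times> complex \<Rightarrow> real"
  assumes "continuous_on bicircle h" "e > 0"
  obtains Q where "\<And>x. x \<in> bicircle \<Longrightarrow> norm (of_real (h x) - leval Q x) < e"
proof -
  obtain g where g: "real_polynomial_function g" "\<And>x. x \<in> bicircle \<Longrightarrow> \<bar>h x - g x\<bar> < e"
    using Stone_Weierstrass_real_polynomial_function[OF compact_bicircle assms] by blast
  obtain Q where "\<forall>x\<in>bicircle. of_real (g x) = leval Q x" using real_polynomial_on_bicircle[OF g(1)] by blast
  then have "norm (of_real (h x) - leval Q x) < e" if "x \<in> bicircle" for x
    using g(2)[OF that] that by (metis norm_of_real of_real_diff)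
  then show ?thesis using that by blast
qed

lemma moments_imp_integrals:
  assumes M: "bicircle_measure M" and N: "bicircle_measure N"
    and mom: "\<And>a. (LINT x|M. pw a x) = (LINT x|N. pw a x)"
    and h: "continuous_on bicircle (h :: complex \<times> complex \<Rightarrow> real)"
  shows "(LINT x|M. h x) = (LINT x|N. h x)"
proof -
  have lev: "(LINT x|M. leval Q x) = (LINT x|N. leval Q x)" for Q
    unfolding leval_sum[OF finite_keys subset_refl]
    by (simp add: mom bicircle_integrable[OF M continuous_pw] bicircle_integrable[OF N continuous_pw])
  have approx: "norm (of_real (LINT x|M. h x) - (LINT x|M. leval Q x)) \<le> e * measure M bicircle"
    if M: "bicircle_measure M" and Q: "\<And>x. x \<in> bicircle \<Longrightarrow> norm (of_real (h x) - leval Q x) < e" for M Q e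
  proof -
    have hc: "continuous_on bicircle (\<lambda>x. of_real (h x) :: complex)" using h by (intro continuous_intros)
    note int = bicircle_integrable[OF M hc] bicircle_integrable[OF M continuous_leval, of Q]
    interpret finite_measure M using M by (rule bicircle_measure_finite)
    have "of_real (LINT x|M. h x) - (LINT x|M. leval Q x) = (LINT x|M. of_real (h x) - leval Q x)"
      using int by simp
    also have "norm \<dots> \<le> (LINT x|M. e)"
      using int Q bicircle_space[OF M] by (intro Bochner_Integration.integral_norm_bound_integral) (auto intro: less_imp_le)
    finally show ?thesis using bicircle_space[OF M] by (simp add: mult.commute)
  qed
  have "norm (of_real (LINT x|M. h x) - of_real (LINT x|N. h x) :: complex) \<le> e" if "e > 0" for e
  proof -
    define B where "B = measure M bicircle + measure N bicircle + 1"
    have B: "B > 0" "measure M bicircle + measure N bicircle \<le> B" by (simp_all add: B_def add_nonneg_pos)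
    have "e / B > 0" using that B by simp
    then obtain Q where Q: "\<And>x. x \<in> bicircle \<Longrightarrow> norm (of_real (h x) - leval Q x) < e / B"
      by (rule laurent_dense[OF h]) blast
    have "norm (of_real (LINT x|M. h x) - of_real (LINT x|N. h x) :: complex) \<le>
        norm (of_real (LINT x|M. h x) - (LINT x|M. leval Q x)) + norm (of_real (LINT x|N. h x) - (LINT x|N. leval Q x))"
      unfolding lev by norm
    also have "\<dots> \<le> e / B * measure M bicircle + e / B * measure N bicircle"
      using approx[OF M Q] approx[OF N Q] by (rule add_mono)
    also have "\<dots> = e / B * (measure M bicircle + measure N bicircle)" by (simp add: distrib_left)
    also have "\<dots> \<le> e / B * B" using B that by (intro mult_left_mono) auto
    finally show ?thesis using B by simp
  qed
  then have "norm (of_real (LINT x|M. h x) - of_real (LINT x|N. h x) :: complex) \<le> 0"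
    by (rule field_le_epsilon) simp
  then show ?thesis by simp
qed

text \<open>Integrals of continuous functions determine the measure of closed sets, which are stable
  under intersection and generate the Borel sets.\<close>

lemma bicircle_measure_eqI:
  assumes M: "bicircle_measure M" and N: "bicircle_measure N"
    and mom: "\<And>a. (LINT x|M. pw a x) = (LINT x|N. pw a x)"
  shows "M = N"
proof -
  have bic: "bicircle \<in> sets borel" using compact_bicircle by (intro borel_closed compact_imp_closed)
  have closed_eq: "measure M (C \<inter> bicircle) = measure N (C \<inter> bicircle)" if C: "closed C" for C
  proof (cases "C = {}")
    case False
    \<comment> \<open>Continuous functions decreasing to the indicator of \<open>C\<close>. The
      empty set is treated apart because its \<open>infdist\<close> is 0 by convention.\<close>
    define h where "h n x = max 0 (1 - real n * infdist x C)" for n x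
    have cont: "continuous_on bicircle (h n)" for n
      unfolding h_def by (intro continuous_intros)
    have lim: "(\<lambda>n. h n x) \<longlonglongrightarrow> indicator C x" for x
    proof (cases "x \<in> C")
      case True
      then show ?thesis using False C by (simp add: h_def)
    next
      case x: False
      then have pos: "infdist x C > 0"
        using in_closed_iff_infdist_zero[OF C False, of x] infdist_nonneg[of x C] by linarith
      obtain n0 :: nat where "1 / infdist x C < real n0" using reals_Archimedean2 by blast
      then have "h n x = 0" if "n \<ge> n0" for n
      proof -
        have "1 / infdist x C \<le> real n" using \<open>1 / infdist x C < real n0\<close> that by linarith
        then have "1 \<le> real n * infdist x C" using pos by (simp add: pos_divide_le_eq)
        then show ?thesis by (simp add: h_def)
      qed
      then have "eventually (\<lambda>n. h n x = 0) sequentially" using eventually_sequentially by blast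
      then show ?thesis using x by (simp add: tendsto_eventually)
    qed
    have limM: "(\<lambda>n. LINT x|M. h n x) \<longlonglongrightarrow> measure M (C \<inter> bicircle)" if M: "bicircle_measure M" for M
    proof -
      interpret finite_measure M using M by (rule bicircle_measure_finite)
      have CM: "C \<inter> bicircle \<in> sets M"
        using M C bic by (auto simp: bicircle_measure_def sets_restrict_space)
      have "(\<lambda>n. LINT x|M. h n x) \<longlonglongrightarrow> (LINT x|M. indicator (C \<inter> bicircle) x)"
      proof (rule integral_dominated_convergence[where w = "\<lambda>_. 1"])
        show "AE x in M. (\<lambda>n. h n x) \<longlonglongrightarrow> indicator (C \<inter> bicircle) x"
        proof (rule AE_I2)
          fix x assume "x \<in> space M"
          then have "indicator (C \<inter> bicircle) x = (indicator C x :: real)" using bicircle_space[OF M] by (simp add: indicator_def)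
          then show "(\<lambda>n. h n x) \<longlonglongrightarrow> indicator (C \<inter> bicircle) x" using lim by simp
        qed
        show "AE x in M. norm (h n x) \<le> 1" for n
          by (rule AE_I2) (simp add: h_def infdist_nonneg)
      qed (use CM bicircle_measurable[OF M cont] in auto)
      then show ?thesis using CM by simp
    qed
    show ?thesis
      using limM[OF M] limM[OF N] moments_imp_integrals[OF M N mom cont] LIMSEQ_unique by simp
  qed simp
  have ext: "distr M borel id = distr N borel id"
  proof -
    have em: "emeasure (distr M borel id) A = emeasure M (A \<inter> bicircle)"
      if "A \<in> sets borel" "bicircle_measure M" for A M
    proof -
      have "id \<in> measurable M borel" using bicircle_measurable[OF that(2) continuous_on_id] by (simp add: id_def)
      then show ?thesis using that bicircle_space[OF that(2)] by (simp add: emeasure_distr)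
    qed
    interpret M: finite_measure M using M by (rule bicircle_measure_finite)
    interpret N: finite_measure N using N by (rule bicircle_measure_finite)
    show ?thesis
    proof (rule measure_eqI_generator_eq[where E = "Collect closed" and \<Omega> = UNIV and A = "\<lambda>_. UNIV"])
      show "Int_stable (Collect closed)" by (auto simp: Int_stable_def)
      show "emeasure (distr M borel id) X = emeasure (distr N borel id) X" if "X \<in> Collect closed" for X
        using that closed_eq[of X] by (simp add: em M N M.emeasure_eq_measure N.emeasure_eq_measure)
      show "emeasure (distr M borel id) UNIV \<noteq> \<infinity>" for i :: nat
        by (simp add: em M M.emeasure_eq_measure)
    qed (simp_all add: borel_eq_closed)
  qed
  show ?thesis
  proof (rule measure_eqI)
    show "sets M = sets N" using M N by (simp add: bicircle_measure_def)
    fix A assume "A \<in> sets M"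
    then obtain B where B: "B \<in> sets borel" "A = B \<inter> bicircle"
      using M by (auto simp: bicircle_measure_def sets_restrict_space)
    have "emeasure (distr M borel id) B = emeasure M A" if M: "bicircle_measure M" for M
      using bicircle_measurable[OF M continuous_on_id] bicircle_space[OF M] B by (simp add: emeasure_distr id_def)
    from this[OF M] this[OF N] show "emeasure M A = emeasure N A" using ext by simp
  qed
qed

subsection \<open>Lebesgue measure on the bicircle\<close>

text \<open>Cauchy's formula at the center. The half-open interval matches
  \<open>bicircle_lebesgue\<close>; the missing endpoint is a null set.\<close>

lemma circle_mean_value:
  fixes g :: "complex \<Rightarrow> complex"
  assumes cont: "continuous_on (cball 0 1) g" and hol: "g holomorphic_on ball 0 1"
  shows "(LINT t|lborel. indicator {0..<2*pi} t *\<^sub>R g (cis t)) = of_real (2 * pi) * g 0"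
proof -
  have "((\<lambda>u. g u / (u - 0)) has_contour_integral (2 * of_real pi * \<i> * g 0)) (part_circlepath 0 1 0 (2 * pi))"
    using Cauchy_integral_circlepath[OF cont hol, of 0] by (simp add: circlepath_def)
  then have "((\<lambda>t. g (cis t) / cis t * \<i> * cis t) has_integral (2 * of_real pi * \<i> * g 0)) {0..2*pi}"
    by (subst (asm) has_contour_integral_part_circlepath_iff) simp_all
  then have "((\<lambda>t. - \<i> * (g (cis t) / cis t * \<i> * cis t)) has_integral - \<i> * (2 * of_real pi * \<i> * g 0)) {0..2*pi}"
    by (rule has_integral_mult_right)
  then have I: "((\<lambda>t. g (cis t)) has_integral of_real (2 * pi) * g 0) {0..2*pi}"
  proof -
    have "x / cis t * \<i> * cis t = \<i> * x" for x t by (simp add: mult.commute)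
    then have "- \<i> * (x / cis t * \<i> * cis t) = x" for x t by (simp add: complex_eq_iff)
    moreover have "- \<i> * (2 * of_real pi * \<i> * g 0) = of_real (2 * pi) * g 0" by (simp add: complex_eq_iff)
    ultimately show ?thesis using \<open>((\<lambda>t. - \<i> * _ t) has_integral _) _\<close> by (simp only:)
  qed
  have cont': "continuous_on {0..2*pi} (\<lambda>t. g (cis t))"
    by (intro continuous_on_compose2[OF cont] continuous_intros) auto
  have "set_integrable lborel {0..2*pi} (\<lambda>t. g (cis t))"
    unfolding set_integrable_def by (rule borel_integrable_compact[OF _ cont']) simp
  then have "(LINT t:{0..2*pi}|lborel. g (cis t)) = of_real (2 * pi) * g 0"
    using set_borel_integral_eq_integral(2) integral_unique[OF I] by metis
  moreover have "(LINT t|lborel. indicator {0..<2*pi} t *\<^sub>R g (cis t)) = (LINT t:{0..2*pi}|lborel. g (cis t))"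
    unfolding set_lebesgue_integral_def
  proof (rule integral_cong_AE)
    have [measurable]: "(\<lambda>t. indicator {0..2*pi} t *\<^sub>R g (cis t)) \<in> borel_measurable lborel"
      using borel_integrable_compact[OF _ cont'] by (simp add: borel_measurable_integrable)
    then show "(\<lambda>t. indicator {0..2*pi} t *\<^sub>R g (cis t)) \<in> borel_measurable lborel" .
    have eq: "(\<lambda>t. indicator {0..<2*pi} t *\<^sub>R g (cis t)) =
        (\<lambda>t. indicator {0..<2*pi} t *\<^sub>R (indicator {0..2*pi} t *\<^sub>R g (cis t)))"
      by (auto simp: indicator_def)
    show "(\<lambda>t. indicator {0..<2*pi} t *\<^sub>R g (cis t)) \<in> borel_measurable lborel"
      unfolding eq by measurable
    show "AE t in lborel. indicator {0..<2*pi} t *\<^sub>R g (cis t) = indicator {0..2*pi} t *\<^sub>R g (cis t)"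
      using AE_lborel_singleton[of "2*pi"] by eventually_elim (auto simp: indicator_def)
  qed
  ultimately show ?thesis by simp
qed

definition torus_map :: "real \<times> real \<Rightarrow> complex \<times> complex" where
  "torus_map x = (cis (fst x), cis (snd x))"

abbreviation square :: "(real \<times> real) set" where
  "square \<equiv> {0..<2*pi} \<times> {0..<2*pi}"

lemma torus_map_bicircle: "torus_map x \<in> bicircle"
  by (simp add: torus_map_def bicircle_def)

lemma bicircle_lebesgue_alt:
  "bicircle_lebesgue = distr (restrict_space lborel square) (restrict_space borel bicircle) torus_map"
  unfolding bicircle_lebesgue_def torus_map_def[abs_def] by (simp add: case_prod_unfold)

lemma square_borel: "square \<in> sets borel"
  by (intro borel_Times) auto

lemma continuous_torus_map: "continuous_on UNIV torus_map"
  unfolding torus_map_def[abs_def] by (intro continuous_intros)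

lemma torus_map_measurable:
  "torus_map \<in> measurable (restrict_space lborel square) (restrict_space borel bicircle)"
proof (rule measurable_restrict_space2)
  show "torus_map \<in> space (restrict_space lborel square) \<rightarrow> bicircle" using torus_map_bicircle by auto
  have "torus_map \<in> measurable borel borel" using continuous_torus_map by (rule borel_measurable_continuous_onI)
  then have "torus_map \<in> measurable lborel borel" by simp
  then show "torus_map \<in> measurable (restrict_space lborel square) borel" by (rule measurable_restrict_space1)
qed

lemma finite_square: "finite_measure (restrict_space lborel square)"
proof
  have "bounded square" by (intro bounded_Times) (auto intro: bounded_subset[of "{0..2*pi}"])
  then have "emeasure lborel square < \<infinity>" by (rule emeasure_bounded_finite)
  then show "emeasure (restrict_space lborel square) (space (restrict_space lborel square)) \<noteq> \<infinity>"
    using square_borel by (simp add: emeasure_restrict_space space_restrict_space)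
qed

lemma bicircle_measure_lebesgue: "bicircle_measure bicircle_lebesgue"
  unfolding bicircle_measure_def bicircle_lebesgue_alt
  using finite_measure.finite_measure_distr[OF finite_square torus_map_measurable] by simp

lemma lebesgue_integral_square:
  assumes F: "continuous_on bicircle (F :: complex \<times> complex \<Rightarrow> complex)"
  shows "(LINT x|bicircle_lebesgue. F x) = (LINT x|lborel. indicator square x *\<^sub>R F (torus_map x))"
    and "integrable lborel (\<lambda>x. indicator square x *\<^sub>R F (torus_map x))"
proof -
  have F': "F \<in> borel_measurable (restrict_space borel bicircle)"
    using F by (rule borel_measurable_continuous_on_restrict)
  have "(LINT x|bicircle_lebesgue. F x) = (LINT x|restrict_space lborel square. F (torus_map x))"
    unfolding bicircle_lebesgue_alt by (rule integral_distr[OF torus_map_measurable F'])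
  also have "\<dots> = (LINT x|lborel. indicator square x *\<^sub>R F (torus_map x))"
    by (rule integral_restrict_space) (simp add: square_borel)
  finally show "(LINT x|bicircle_lebesgue. F x) = (LINT x|lborel. indicator square x *\<^sub>R F (torus_map x))" .
  have "integrable bicircle_lebesgue F" by (rule bicircle_integrable[OF bicircle_measure_lebesgue F])
  then have "integrable (restrict_space lborel square) (\<lambda>x. F (torus_map x))"
    unfolding bicircle_lebesgue_alt by (rule integrable_distr[OF torus_map_measurable])
  then show "integrable lborel (\<lambda>x. indicator square x *\<^sub>R F (torus_map x))"
    by (subst (asm) integrable_restrict_space) (simp_all add: square_borel)
qed

text \<open>Both orders are needed, since the inner integral must run over the variable in which the
  integrand is analytic with a zero at 0.\<close>

lemma lebesgue_integral_iterated:
  assumes F: "continuous_on bicircle (F :: complex \<times> complex \<Rightarrow> complex)"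
  shows "(LINT x|bicircle_lebesgue. F x) = (LINT s|lborel. indicator {0..<2*pi} s *\<^sub>R
      (LINT t|lborel. indicator {0..<2*pi} t *\<^sub>R F (cis s, cis t)))"
    and "(LINT x|bicircle_lebesgue. F x) = (LINT t|lborel. indicator {0..<2*pi} t *\<^sub>R
      (LINT s|lborel. indicator {0..<2*pi} s *\<^sub>R F (cis s, cis t)))"
proof -
  let ?f = "\<lambda>s t. indicator square (s, t) *\<^sub>R F (cis s, cis t)"
  have f: "indicator square x *\<^sub>R F (torus_map x) = case_prod ?f x" for x
    by (simp add: torus_map_def case_prod_unfold)
  have int: "integrable (lborel \<Otimes>\<^sub>M lborel) (case_prod ?f)"
    using lebesgue_integral_square(2)[OF F] unfolding f lborel_prod .
  have eq: "(LINT x|bicircle_lebesgue. F x) = integral\<^sup>L (lborel \<Otimes>\<^sub>M lborel) (case_prod ?f)"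
    using lebesgue_integral_square(1)[OF F] unfolding f lborel_prod .
  have ind: "?f s t = indicator {0..<2*pi} s *\<^sub>R (indicator {0..<2*pi} t *\<^sub>R F (cis s, cis t))" for s t
    by (auto simp: indicator_def)
  have ind': "?f s t = indicator {0..<2*pi} t *\<^sub>R (indicator {0..<2*pi} s *\<^sub>R F (cis s, cis t))" for s t
    by (auto simp: indicator_def)
  show "(LINT x|bicircle_lebesgue. F x) = (LINT s|lborel. indicator {0..<2*pi} s *\<^sub>R
      (LINT t|lborel. indicator {0..<2*pi} t *\<^sub>R F (cis s, cis t)))"
    unfolding eq lborel_pair.integral_fst[OF int, symmetric] unfolding ind by (simp del: scaleR_scaleR)
  show "(LINT x|bicircle_lebesgue. F x) = (LINT t|lborel. indicator {0..<2*pi} t *\<^sub>R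
      (LINT s|lborel. indicator {0..<2*pi} s *\<^sub>R F (cis s, cis t)))"
    unfolding eq lborel_pair.integral_snd[OF int, symmetric] unfolding ind' by (simp del: scaleR_scaleR)
qed

lemma circle_powi: "(LINT t|lborel. indicator {0..<2*pi} t *\<^sub>R (cis t powi k)) = (if k = 0 then of_real (2 * pi) else 0)"
proof -
  have *: "(LINT t|lborel. indicator {0..<2*pi} t *\<^sub>R (cis t ^ n)) = (if n = 0 then of_real (2 * pi) else 0)" for n
    using circle_mean_value[of "\<lambda>z. z ^ n"] by (simp add: continuous_intros holomorphic_intros power_0_left)
  show ?thesis
  proof (cases "k \<ge> 0")
    case True
    then show ?thesis using *[of "nat k"] by (simp add: power_int_def)
  next
    case False
    have "cis t powi k = cnj (cis t ^ nat (- k))" for t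
      using False by (simp add: power_int_def cis_cnj cis_inverse)
    then have "(LINT t|lborel. indicator {0..<2*pi} t *\<^sub>R (cis t powi k)) =
        (LINT t|lborel. cnj (indicator {0..<2*pi} t *\<^sub>R (cis t ^ nat (- k))))" by simp
    also have "\<dots> = cnj (LINT t|lborel. indicator {0..<2*pi} t *\<^sub>R (cis t ^ nat (- k)))" by (rule Bochner_Integration.integral_cnj)
    finally show ?thesis using False *[of "nat (- k)"] by simp
  qed
qed

lemma lebesgue_moments: "(LINT x|bicircle_lebesgue. pw a x) = (if a = 0 then (2 * pi)\<^sup>2 else 0)"
proof -
  have inner: "(LINT t|lborel. indicator {0..<2*pi} t *\<^sub>R pw a (cis s, cis t)) =
      cis s powi fst a * (if snd a = 0 then of_real (2 * pi) else 0)" for s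
  proof -
    have "(LINT t|lborel. indicator {0..<2*pi} t *\<^sub>R pw a (cis s, cis t)) =
        (LINT t|lborel. cis s powi fst a * (indicator {0..<2*pi} t *\<^sub>R (cis t powi snd a)))"
      by (simp add: pw_def)
    then show ?thesis by (simp only: integral_mult_right_zero circle_powi)
  qed
  define c :: complex where "c = (if snd a = 0 then of_real (2 * pi) else 0)"
  have "(LINT x|bicircle_lebesgue. pw a x) = (LINT s|lborel. (indicator {0..<2*pi} s *\<^sub>R (cis s powi fst a)) * c)"
    unfolding lebesgue_integral_iterated(1)[OF continuous_pw] inner c_def[symmetric] by simp
  also have "\<dots> = (if fst a = 0 then of_real (2 * pi) else 0) * c"
    by (simp only: integral_mult_left_zero circle_powi)
  also have "\<dots> = (if a = 0 then (2 * pi)\<^sup>2 else 0)"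
    by (cases a) (simp add: c_def zero_prod_def power2_eq_square)
  finally show ?thesis .
qed

lemma lebesgue_leval: "(LINT x|bicircle_lebesgue. leval f x) = (2 * pi)\<^sup>2 * coef f 0"
proof -
  let ?S = "insert 0 (exps f)"
  have "(LINT x|bicircle_lebesgue. leval f x) = (\<Sum>a\<in>?S. coef f a * (LINT x|bicircle_lebesgue. pw a x))"
    unfolding leval_sum[of ?S f, OF _ subset_insertI, simplified]
    by (simp add: bicircle_integrable[OF bicircle_measure_lebesgue continuous_pw] del: sum.insert)
  also have "\<dots> = (\<Sum>a\<in>?S. if a = 0 then coef f a * (2 * pi)\<^sup>2 else 0)"
    by (rule sum.cong) (auto simp: lebesgue_moments)
  finally show ?thesis by (simp add: sum.delta mult.commute)
qed

section \<open>Weights 1 / |p|^2 with stable reversal\<close>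

lemma leval_holomorphic:
  assumes "exps q \<subseteq> {0..} \<times> {0..}"
  shows "(\<lambda>z. leval q (z, w)) holomorphic_on S" and "(\<lambda>w. leval q (z, w)) holomorphic_on S"
proof -
  have pos: "fst a \<ge> 0" "snd a \<ge> 0" if "a \<in> exps q" for a using assms that by auto
  have 1: "leval q (z, w) = (\<Sum>a\<in>exps q. coef q a * (z ^ nat (fst a) * w ^ nat (snd a)))" for z w
    unfolding leval_sum[OF finite_keys subset_refl]
    by (rule sum.cong) (use pos in \<open>auto simp: pw_def power_int_def\<close>)
  show "(\<lambda>z. leval q (z, w)) holomorphic_on S" "(\<lambda>w. leval q (z, w)) holomorphic_on S"
    unfolding 1 by (intro holomorphic_intros)+
qed

text \<open>The inner integral is over a variable with positive exponent, so the quotient is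
  analytic in the disk and vanishes at 0. The other variable is fixed on the circle, where its
  exponent may be negative.\<close>

lemma quotient_integral_eq_0:
  assumes q: "exps q \<subseteq> {0..} \<times> {0..}" and stable: "bidisk_stable q" and b: "fst b > 0 \<or> snd b > 0"
  shows "(LINT x|bicircle_lebesgue. pw b x / leval q x) = 0"
proof -
  have nz: "leval q (z, w) \<noteq> 0" if "norm z \<le> 1" "norm w \<le> 1" for z w
    using stable that by (simp add: bidisk_stable_def)
  have nz': "leval q x \<noteq> 0" if "x \<in> bicircle" for x
    using that nz by (auto simp: bicircle_def)
  have cont: "continuous_on bicircle (\<lambda>x. pw b x / leval q x)"
    using nz' by (intro continuous_intros continuous_pw continuous_leval) auto
  from b show ?thesis
  proof
    assume b: "fst b > 0"
    have "(LINT s|lborel. indicator {0..<2*pi} s *\<^sub>R (pw b (cis s, cis t) / leval q (cis s, cis t))) = 0" for t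
    proof -
      define g where "g z = z ^ nat (fst b) * cis t powi snd b / leval q (z, cis t)" for z
      have hol: "g holomorphic_on cball 0 1"
        unfolding g_def using nz by (intro holomorphic_intros leval_holomorphic[OF q]) auto
      have "(LINT s|lborel. indicator {0..<2*pi} s *\<^sub>R g (cis s)) = of_real (2 * pi) * g 0"
        using hol by (intro circle_mean_value holomorphic_on_imp_continuous_on holomorphic_on_subset[OF hol]) auto
      moreover have "g (cis s) = pw b (cis s, cis t) / leval q (cis s, cis t)" for s
        using b by (simp add: g_def pw_def power_int_def)
      moreover have "g 0 = 0" using b by (simp add: g_def)
      ultimately show ?thesis by simp
    qed
    then show ?thesis unfolding lebesgue_integral_iterated(2)[OF cont] by simp
  next
    assume b: "snd b > 0"
    have "(LINT t|lborel. indicator {0..<2*pi} t *\<^sub>R (pw b (cis s, cis t) / leval q (cis s, cis t))) = 0" for s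
    proof -
      define g where "g w = cis s powi fst b * w ^ nat (snd b) / leval q (cis s, w)" for w
      have hol: "g holomorphic_on cball 0 1"
        unfolding g_def using nz by (intro holomorphic_intros leval_holomorphic[OF q]) auto
      have "(LINT t|lborel. indicator {0..<2*pi} t *\<^sub>R g (cis t)) = of_real (2 * pi) * g 0"
        using hol by (intro circle_mean_value holomorphic_on_imp_continuous_on holomorphic_on_subset[OF hol]) auto
      moreover have "g (cis t) = pw b (cis s, cis t) / leval q (cis s, cis t)" for t
        using b by (simp add: g_def pw_def power_int_def)
      moreover have "g 0 = 0" using b by (simp add: g_def)
      ultimately show ?thesis by simp
    qed
    then show ?thesis unfolding lebesgue_integral_iterated(1)[OF cont] by simp
  qed
qed

lemma leval_reversal: "x \<in> bicircle \<Longrightarrow> leval (mon a * ladj p) x = pw a x * cnj (leval p x)"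
  using bicircle_nz by (simp add: leval_mult leval_mon leval_ladj)

lemma continuous_weight:
  assumes "\<And>x. x \<in> bicircle \<Longrightarrow> leval p x \<noteq> 0"
  shows "continuous_on bicircle (\<lambda>x. 1 / (norm (leval p x))\<^sup>2)"
  using assms by (intro continuous_intros continuous_leval) auto

lemma Lfun_density:
  assumes "\<And>x. x \<in> bicircle \<Longrightarrow> leval p x \<noteq> 0"
  shows "Lfun (density bicircle_lebesgue (\<lambda>x. ennreal (1 / (norm (leval p x))\<^sup>2))) f =
     of_real ((1 / (2*pi))\<^sup>2) * (LINT x|bicircle_lebesgue. (1 / (norm (leval p x))\<^sup>2) *\<^sub>R leval f x)"
proof -
  note meas = bicircle_measurable[OF bicircle_measure_lebesgue continuous_leval, of f]
    bicircle_measurable[OF bicircle_measure_lebesgue continuous_weight[OF assms]]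
  show ?thesis
    unfolding Lfun_def by (subst integral_density[OF meas]) auto
qed

lemma bs_of_density:
  fixes n m :: nat
  assumes deg: "exps p \<subseteq> {0..int n} \<times> {0..int m}"
    and stable: "bidisk_stable (mon (int n, int m) * ladj p)"
    and L: "L = Lfun (density bicircle_lebesgue (\<lambda>x. ennreal (1 / (norm (leval p x))\<^sup>2)))"
    and pd: "pd_form L"
  shows "pd_form.bs L (int n) (int m) p"
proof -
  interpret pd_form L by fact
  define q where "q = mon (int n, int m) * ladj p"
  have q: "exps q \<subseteq> {0..} \<times> {0..}"
    unfolding q_def keys_reflect using deg by auto
  have nz: "leval p x \<noteq> 0" if x: "x \<in> bicircle" for x
  proof -
    have "leval (mon (int n, int m) * ladj p) x \<noteq> 0"
      using stable x by (auto simp: bidisk_stable_def bicircle_def)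
    then show ?thesis using leval_reversal[OF x] by auto
  qed
  have L': "L f = of_real ((1 / (2*pi))\<^sup>2) * (LINT x|bicircle_lebesgue. (1 / (norm (leval p x))\<^sup>2) *\<^sub>R leval f x)" for f
    unfolding L by (rule Lfun_density[OF nz])
  have "ip p (mon a) = 0" if "fst a < int n \<or> snd a < int m" for a
  proof -
    \<comment> \<open>On the torus |p|^2 is \<open>p\<close> times its conjugate, and that conjugate
      is q / (z^n w^m). What remains is a monomial over \<open>q\<close>, with a positive exponent
      because \<open>a\<close> is outside the quadrant.\<close>
    have "(LINT x|bicircle_lebesgue. (1 / (norm (leval p x))\<^sup>2) *\<^sub>R leval (p * ladj (mon a)) x) =
        (LINT x|bicircle_lebesgue. pw ((int n, int m) - a) x / leval q x)"
    proof (rule bicircle_integral_cong[OF bicircle_measure_lebesgue])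
      fix x assume x: "x \<in> bicircle"
      have "pw ((int n, int m) - a) x = pw (int n, int m) x * pw (- a) x"
        using pw_add[of x "(int n, int m)" "- a"] bicircle_nz[OF x] by simp
      moreover have "leval q x = pw (int n, int m) x * cnj (leval p x)"
        unfolding q_def by (rule leval_reversal[OF x])
      moreover have "leval (p * ladj (mon a)) x = leval p x * pw (- a) x"
        using bicircle_nz[OF x] by (simp add: leval_mult ladj_single leval_mon)
      moreover have "pw (int n, int m) x \<noteq> 0" using bicircle_nz[OF x] by (simp add: pw_def)
      moreover have "of_real ((norm (leval p x))\<^sup>2) = leval p x * cnj (leval p x)" by (rule complex_norm_square)
      ultimately show "(1 / (norm (leval p x))\<^sup>2) *\<^sub>R leval (p * ladj (mon a)) x = pw ((int n, int m) - a) x / leval q x"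
        using nz[OF x] by (simp add: scaleR_conv_of_real del: of_real_power)
    qed
    also have "\<dots> = 0"
      using stable that unfolding q_def[symmetric] by (intro quotient_integral_eq_0[OF q]) auto
    finally show ?thesis unfolding ip_def L' by simp
  qed
  then have "perp p {(k, l). k < int n \<or> l < int m}" by (auto simp: perp_def)
  moreover have "ip p p = 1"
  proof -
    have "(LINT x|bicircle_lebesgue. (1 / (norm (leval p x))\<^sup>2) *\<^sub>R leval (p * ladj p) x) =
        (LINT x|bicircle_lebesgue. pw 0 x)"
    proof (rule bicircle_integral_cong[OF bicircle_measure_lebesgue])
      fix x assume x: "x \<in> bicircle"
      have "leval (p * ladj p) x = of_real ((norm (leval p x))\<^sup>2)"
        unfolding complex_norm_square using bicircle_nz[OF x] by (simp add: leval_mult leval_ladj[OF x])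
      then show "(1 / (norm (leval p x))\<^sup>2) *\<^sub>R leval (p * ladj p) x = pw 0 x"
        using nz[OF x] by (simp add: pw_def scaleR_conv_of_real)
    qed
    also have "\<dots> = (2 * pi)\<^sup>2" by (simp only: lebesgue_moments simp_thms if_True)
    finally show ?thesis unfolding ip_def L' by (simp add: power_divide)
  qed
  ultimately show ?thesis using deg by (simp add: bs_def)
qed

text \<open>With a Laurent polynomial in place of the weight the integral is a single coefficient,
  exactly zero once \<open>a N\<close> leaves a finite set; the weight is uniformly close to such a
  polynomial.\<close>

lemma Riemann_Lebesgue:
  assumes nz: "\<And>x. x \<in> bicircle \<Longrightarrow> leval p x \<noteq> 0"
    and L: "L = Lfun (density bicircle_lebesgue (\<lambda>x. ennreal (1 / (norm (leval p x))\<^sup>2)))"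
    and pd: "pd_form L"
    and a: "\<And>S. finite S \<Longrightarrow> eventually (\<lambda>N. a N \<notin> S) sequentially"
  shows "(\<lambda>N. pd_form.ip L f (mon (a N))) \<longlonglongrightarrow> 0"
proof -
  interpret pd_form L by fact
  interpret fin: finite_measure bicircle_lebesgue
    using bicircle_measure_lebesgue by (rule bicircle_measure_finite)
  have L': "L f = of_real ((1 / (2*pi))\<^sup>2) * (LINT x|bicircle_lebesgue. (1 / (norm (leval p x))\<^sup>2) *\<^sub>R leval f x)" for f
    unfolding L by (rule Lfun_density[OF nz])
  define h where "h x = 1 / (norm (leval p x))\<^sup>2" for x
  define c where "c = (1 / (2*pi))\<^sup>2"
  have h: "continuous_on bicircle h" unfolding h_def by (rule continuous_weight[OF nz])
  obtain B where B: "B > 0" "\<And>x. x \<in> bicircle \<Longrightarrow> norm (leval f x) \<le> B"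
    using bicircle_bounded[OF continuous_leval] by metis
  define V where "V = measure bicircle_lebesgue (space bicircle_lebesgue)"
  have "c > 0" by (simp add: c_def)
  have "V \<ge> 0" by (simp add: V_def)
  show ?thesis
  proof (rule LIMSEQ_I)
    fix e :: real assume "e > 0"
    \<comment> \<open>Total mass plus one keeps the denominator positive and makes the last
      inequality strict.\<close>
    define D where "D = V + 1"
    have D: "D > 0" "V < D" using \<open>V \<ge> 0\<close> by (simp_all add: D_def)
    define e' where "e' = e / (c * B * D)"
    have "e' > 0" using \<open>e > 0\<close> \<open>c > 0\<close> D B by (simp add: e'_def)
    then obtain Q where Q: "\<And>x. x \<in> bicircle \<Longrightarrow> norm (of_real (h x) - leval Q x) < e'"
      by (rule laurent_dense[OF h]) blast
    obtain N0 where N0: "\<And>N. N \<ge> N0 \<Longrightarrow> a N \<notin> exps (Q * f)"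
      using a[of "exps (Q * f)"] by (auto simp: eventually_sequentially)
    have "norm (ip f (mon (a N)) - 0) < e" if N: "N \<ge> N0" for N
    proof -
      let ?g = "\<lambda>x. leval f x * pw (- a N) x"
      have g: "continuous_on bicircle ?g" by (rule continuous_on_mult[OF continuous_leval continuous_pw])
      have hg: "continuous_on bicircle (\<lambda>x. of_real (h x) * ?g x)"
        by (rule continuous_on_mult[OF continuous_on_of_real[OF h] g])
      have Qg: "continuous_on bicircle (\<lambda>x. leval Q x * ?g x)"
        by (rule continuous_on_mult[OF continuous_leval g])
      note int = bicircle_integrable[OF bicircle_measure_lebesgue hg] bicircle_integrable[OF bicircle_measure_lebesgue Qg]
      have "ip f (mon (a N)) = of_real c * (LINT x|bicircle_lebesgue. of_real (h x) * ?g x)"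
        unfolding ip_def L' c_def h_def
        by (intro arg_cong2[where f = "(*)"] refl bicircle_integral_cong[OF bicircle_measure_lebesgue])
           (use bicircle_nz in \<open>simp add: leval_mult ladj_single leval_mon scaleR_conv_of_real\<close>)
      moreover have "(LINT x|bicircle_lebesgue. leval Q x * ?g x) = 0"
      proof -
        have "(LINT x|bicircle_lebesgue. leval Q x * ?g x) = (LINT x|bicircle_lebesgue. leval (mon (- a N) * (Q * f)) x)"
          by (rule bicircle_integral_cong[OF bicircle_measure_lebesgue])
             (use bicircle_nz in \<open>simp add: leval_mult leval_mon mult.commute mult.left_commute\<close>)
        also have "\<dots> = (2 * pi)\<^sup>2 * coef (Q * f) (a N)" by (simp add: lebesgue_leval)
        also have "\<dots> = 0" using N0[OF N] by (simp add: in_keys_iff)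
        finally show ?thesis .
      qed
      ultimately have "ip f (mon (a N)) = of_real c * (LINT x|bicircle_lebesgue. of_real (h x) * ?g x - leval Q x * ?g x)"
        using int by simp
      then have "norm (ip f (mon (a N))) = c * norm (LINT x|bicircle_lebesgue. of_real (h x) * ?g x - leval Q x * ?g x)"
        using \<open>c > 0\<close> by (simp add: norm_mult)
      also have "\<dots> \<le> c * (LINT x|bicircle_lebesgue. e' * B)"
      proof (intro mult_left_mono Bochner_Integration.integral_norm_bound_integral)
        fix x assume "x \<in> space bicircle_lebesgue"
        then have x: "x \<in> bicircle" by (simp add: bicircle_space[OF bicircle_measure_lebesgue])
        have "norm (of_real (h x) * ?g x - leval Q x * ?g x) = norm (of_real (h x) - leval Q x) * (norm (leval f x) * norm (pw (- a N) x))"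
          by (simp only: norm_mult flip: left_diff_distrib)
        also have "\<dots> \<le> e' * (B * 1)"
          using Q[OF x] B(1) B(2)[OF x] norm_pw[OF x] \<open>e' > 0\<close> by (intro mult_mono) auto
        finally show "norm (of_real (h x) * ?g x - leval Q x * ?g x) \<le> e' * B" by simp
      qed (use int \<open>c > 0\<close> in auto)
      also have "\<dots> = c * (V * (e' * B))" by (simp add: V_def)
      also have "\<dots> = e * (V / D)" using \<open>c > 0\<close> B(1) D by (simp add: e'_def)
      also have "\<dots> < e * 1" using \<open>e > 0\<close> D by (intro mult_strict_left_mono) auto
      finally show ?thesis by simp
    qed
    then show "\<exists>N0. \<forall>N\<ge>N0. norm (ip f (mon (a N)) - 0) < e" by blast
  qed
qed

text \<open>Multiplying by |p|^2 gives a measure with the moments of Lebesgue measure, hence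
  Lebesgue measure itself. As \<open>p\<close> has no zero on the torus the factor can be divided
  out, and no singular part survives.\<close>

lemma density_of_moments:
  assumes M: "bicircle_measure \<mu>" and nz: "\<And>x. x \<in> bicircle \<Longrightarrow> leval p x \<noteq> 0"
    and mom: "\<And>a. Lfun \<mu> (mon a * (p * ladj p)) = (if a = 0 then 1 else 0)"
  shows "\<mu> = density bicircle_lebesgue (\<lambda>x. ennreal (1 / (norm (leval p x))\<^sup>2))"
proof -
  let ?w = "\<lambda>x. (norm (leval p x))\<^sup>2"
  have w: "continuous_on bicircle ?w" by (intro continuous_intros continuous_leval)
  note meas = bicircle_measurable[OF M w] bicircle_measurable[OF M continuous_weight[OF nz]]
  define \<nu> where "\<nu> = density \<mu> (\<lambda>x. ennreal (?w x))"
  have \<nu>: "bicircle_measure \<nu>"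
  proof -
    have "emeasure \<nu> (space \<nu>) = (\<integral>\<^sup>+x. ennreal (?w x) \<partial>\<mu>)"
      using meas by (simp add: \<nu>_def emeasure_density cong: nn_integral_cong)
    also have "\<dots> = ennreal (LINT x|\<mu>. ?w x)"
      by (rule nn_integral_eq_integral[OF bicircle_integrable[OF M w]]) simp
    finally have "finite_measure \<nu>" by (intro finite_measureI) simp
    then show ?thesis using M by (simp add: bicircle_measure_def \<nu>_def)
  qed
  have "\<nu> = bicircle_lebesgue"
  proof (rule bicircle_measure_eqI[OF \<nu> bicircle_measure_lebesgue])
    fix a
    have "(LINT x|\<nu>. pw a x) = (LINT x|\<mu>. ?w x *\<^sub>R pw a x)"
      unfolding \<nu>_def by (rule integral_density) (use meas bicircle_measurable[OF M continuous_pw] in auto)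
    also have "\<dots> = (LINT x|\<mu>. leval (mon a * (p * ladj p)) x)"
    proof (rule bicircle_integral_cong[OF M])
      fix x assume x: "x \<in> bicircle"
      show "?w x *\<^sub>R pw a x = leval (mon a * (p * ladj p)) x"
        using bicircle_nz[OF x] complex_norm_square[of "leval p x"]
        by (simp add: leval_mult leval_mon leval_ladj[OF x] scaleR_conv_of_real mult.commute)
    qed
    also have "\<dots> = (2 * pi)\<^sup>2 * Lfun \<mu> (mon a * (p * ladj p))"
      by (simp add: Lfun_def power_divide)
    also have "\<dots> = (LINT x|bicircle_lebesgue. pw a x)"
      by (simp add: mom lebesgue_moments)
    finally show "(LINT x|\<nu>. pw a x) = (LINT x|bicircle_lebesgue. pw a x)" .
  qed
  then have "density bicircle_lebesgue (\<lambda>x. ennreal (1 / ?w x)) = density \<nu> (\<lambda>x. ennreal (1 / ?w x))" by simp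
  also have "\<dots> = density \<mu> (\<lambda>x. ennreal (?w x) * ennreal (1 / ?w x))"
    unfolding \<nu>_def by (rule density_density_eq) (use meas in auto)
  also have "\<dots> = density \<mu> (\<lambda>_. 1)"
  proof (rule density_cong)
    show "AE x in \<mu>. ennreal (?w x) * ennreal (1 / ?w x) = 1"
      by (rule AE_I2) (use nz bicircle_space[OF M] in \<open>auto simp flip: ennreal_mult\<close>)
  qed (use meas in auto)
  also have "\<dots> = \<mu>" by (rule density_1)
  finally show ?thesis ..
qed

theorem theorem7p7:
  fixes n m :: nat and \<mu> :: "(complex \<times> complex) measure" and L :: "laurent \<Rightarrow> complex"
  assumes "n \<ge> 1" and "m \<ge> 1"
    and "bicircle_measure \<mu>"
    and "L = Lfun \<mu>"
    and "positive_definite L"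
  shows "(absolutely_continuous bicircle_lebesgue \<mu> \<and>
          (\<exists>p. has_degree p n m \<and> bidisk_stable (poly_reversal n m p) \<and>
               \<mu> = density bicircle_lebesgue (\<lambda>x. ennreal (1 / (norm (leval p x))\<^sup>2))))
    \<longleftrightarrow>
         (\<forall>j\<ge>m. K_mat L n j = 0\<^sub>m j n \<and> E_hat_rev L (n - 1) (j + 1) = 0\<^sub>m n n \<and> u_pos L n (j + 1) = 0) \<and>
         (\<forall>i>n. K_mat L i m = 0\<^sub>m m i \<and> E_hat L i (m - 1) = 0\<^sub>m m m \<and> u_pos L i m = 0) \<and>
         (\<forall>i>n. \<forall>j>m. u_pos L i j = 0 \<and> u_neg L i j = 0)"
    (is "?density \<longleftrightarrow> ?A \<and> ?B \<and> ?C")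
proof
  interpret pd_form L using assms pd_form_Lfun by simp
  obtain n' where n': "n = Suc n'" using assms(1) by (cases n) auto
  obtain m' where m': "m = Suc m'" using assms(2) by (cases m) auto
  {
    assume ?density
    then obtain p where p: "has_degree p n m" "bidisk_stable (poly_reversal n m p)"
      and \<mu>: "\<mu> = density bicircle_lebesgue (\<lambda>x. ennreal (1 / (norm (leval p x))\<^sup>2))" by blast
    have L: "L = Lfun (density bicircle_lebesgue (\<lambda>x. ennreal (1 / (norm (leval p x))\<^sup>2)))"
      using assms(4) \<mu> by simp
    have stable: "bidisk_stable (mon (int n, int m) * ladj p)" using p(2) by (simp add: poly_reversal_def)
    have bs: "bs (int n) (int m) p"
      using bs_of_density[OF _ stable L pd_form_axioms] p(1) by (simp add: has_degree_def)
    have nz: "leval p x \<noteq> 0" if x: "x \<in> bicircle" for x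
    proof -
      have "leval (mon (int n, int m) * ladj p) x \<noteq> 0"
        using stable x by (auto simp: bidisk_stable_def bicircle_def)
      then show ?thesis using leval_reversal[OF x] by auto
    qed
    have ev1: "eventually (\<lambda>N. (k, int N) \<notin> S) sequentially" if "finite S" for S and k :: int
    proof -
      have "finite {N. (k, int N) \<in> S}"
        using finite_vimageI[OF that, of "\<lambda>N. (k, int N)"] by (simp add: inj_def vimage_def)
      then show ?thesis by (simp add: eventually_cofinite flip: cofinite_eq_sequentially)
    qed
    have ev2: "eventually (\<lambda>N. (int N, k) \<notin> S) sequentially" if "finite S" for S and k :: int
    proof -
      have "finite {N. (int N, k) \<in> S}"
        using finite_vimageI[OF that, of "\<lambda>N. (int N, k)"] by (simp add: inj_def vimage_def)
      then show ?thesis by (simp add: eventually_cofinite flip: cofinite_eq_sequentially)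
    qed
    have RL1: "(\<lambda>N. ip f (mon (k, int N))) \<longlonglongrightarrow> 0" for f k
      by (rule Riemann_Lebesgue[OF nz L pd_form_axioms ev1])
    have RL2: "(\<lambda>N. ip f (mon (int N, k))) \<longlonglongrightarrow> 0" for f k
      by (rule Riemann_Lebesgue[OF nz L pd_form_axioms ev2])
    have ci: "ciK (int i) (int j)" "ciW (int i - 1) (int j)" "ciZ (int i) (int j - 1)" if "i \<ge> n" "j \<ge> m" for i j
      using bs_imp_ci[OF bs _ _ RL1 RL2, of "int i" "int j"] that assms(1,2) by auto
    have K: "K_mat L i j = 0\<^sub>m j i" if "i \<ge> n" "j \<ge> m" for i j
      using ci(1)[OF that] ciK_iff_K_mat[of i j] that assms(1,2) by simp
    have u: "u_pos L (Suc i) (Suc j) = 0" if "n \<le> Suc i \<and> m \<le> j \<or> n \<le> i \<and> m \<le> Suc j" for i j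
      using that assms(1,2) by (intro bs_imp_u_pos_0[OF bs]) auto
    have "E_hat_rev L (n - 1) (j + 1) = 0\<^sub>m n n" if "j \<ge> m" for j
      using ci(2)[of n j] ciW_iff_E_hat_rev[of n' j] that by (simp add: n')
    moreover have "u_pos L n (j + 1) = 0" if "j \<ge> m" for j
      using u[of n' j] that by (simp add: n')
    ultimately have ?A using K by auto
    moreover have ?B
    proof (intro allI impI)
      fix i assume "i > n"
      then obtain i' where i': "i = Suc i'" "i' \<ge> n" by (cases i) auto
      have "E_hat L i (m - 1) = 0\<^sub>m m m"
        using ci(3)[of i' m] ciZ_iff_E_hat[of i' m'] i' by (simp add: m')
      moreover have "u_pos L i m = 0" using u[of i' m'] i' by (simp add: m')
      ultimately show "K_mat L i m = 0\<^sub>m m i \<and> E_hat L i (m - 1) = 0\<^sub>m m m \<and> u_pos L i m = 0"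
        using K[of i m] \<open>i > n\<close> by simp
    qed
    moreover have ?C
    proof (intro allI impI)
      fix i j assume "i > n" "j > m"
      then obtain i' j' where ij: "i = Suc i'" "i' \<ge> n" "j = Suc j'" "j' \<ge> m"
        by (cases i; cases j) auto
      have "ciN (int i' + 1) (int j' + 1)"
        using ciK_imp_ciN[of "int i" "int j"] ci(1)[of i j] ij by (simp add: add.commute)
      then have "u_neg L (Suc i') (Suc j') = 0"
        using u_neg_eq_0_iff[of i' j'] ciN_iff[of i' j'] ij assms(1) by simp
      then show "u_pos L i j = 0 \<and> u_neg L i j = 0" using u[of i' j'] ij by simp
    qed
    ultimately show "?A \<and> ?B \<and> ?C" by blast
  }
  {
    assume ABC: "?A \<and> ?B \<and> ?C"
    define N M where "N = int n" and "M = int m"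
    have NM: "N \<ge> 1" "M \<ge> 1" using assms(1,2) by (simp_all add: N_def M_def)
    have nat_of: "\<exists>k'. k = int k' \<and> k' \<ge> l" if "k \<ge> int l" for k l
      using that by (intro exI[of _ "nat k"]) auto
    have A: "ciK N j" "ciW (N - 1) j" "ciU N (j + 1)" if jM: "j \<ge> M" for j
    proof -
      obtain j' where j: "j = int j'" "j' \<ge> m" using nat_of[of m j] jM by (auto simp: M_def)
      show "ciK N j" using ciK_iff_K_mat[of n j'] ABC j assms(1,2) by (simp add: N_def)
      show "ciW (N - 1) j" using ciW_iff_E_hat_rev[of n' j'] ABC j by (simp add: N_def n')
      show "ciU N (j + 1)" using u_pos_imp_ciU(1)[of n' j'] ABC j by (simp add: N_def n' add.commute)
    qed
    have B: "ciK i M" "ciZ i (M - 1)" "ciU' (i + 1) M" if iN: "i \<ge> N" for i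
    proof -
      obtain i' where i: "i = int i'" "i' \<ge> n" using nat_of[of n i] iN by (auto simp: N_def)
      \<comment> \<open>Condition (b) starts at \<open>n + 1\<close>; the corner
        \<open>i = n\<close> is the case \<open>j = m\<close> of (a).\<close>
      show "ciK i M"
        using ciK_iff_K_mat[of i' m] ABC i assms(1,2) A(1)[of M] by (cases "i' = n") (auto simp: N_def M_def)
      show "ciZ i (M - 1)" using ciZ_iff_E_hat[of i' m'] ABC i by (simp add: M_def m')
      show "ciU' (i + 1) M" using u_pos_imp_ciU(2)[of i' m'] ABC i by (simp add: M_def m' add.commute)
    qed
    have D: "ciU i j \<and> ciU' i j \<and> ciN i j" if ij: "i > N" "j > M" for i j
    proof -
      obtain i' j' where "i - 1 = int i'" "i' \<ge> n" "j - 1 = int j'" "j' \<ge> m"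
        using nat_of[of n "i - 1"] nat_of[of m "j - 1"] ij by (auto simp: N_def M_def)
      then have i: "i = int i' + 1" "i' \<ge> n" and j: "j = int j' + 1" "j' \<ge> m" by simp_all
      have "u_pos L (Suc i') (Suc j') = 0" "u_neg L (Suc i') (Suc j') = 0"
        using ABC i j by auto
      then show ?thesis
        using u_pos_imp_ciU[of i' j'] u_neg_eq_0_iff[of i' j'] ciN_iff[of i' j'] i j assms(1) by simp
    qed
    have H: "ciK i j \<and> ciW i j \<and> ciZ i j" if "i \<ge> N" "j \<ge> M" for i j
      using ci_propagate[OF NM A B D that(1)] that(2) by blast
    \<comment> \<open>Up to a unimodular factor the only candidate: a polynomial with this density
      has norm one and is orthogonal to its rectangle without the top corner.\<close>
    define p where "p = phi L n m m"
    have p: "is_orthopoly ({0..N} \<times> {0..M}) (N, M) p"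
    proof -
      have "{0..N - 1} \<times> {0..M} \<union> {N} \<times> {0..M} = {0..N} \<times> {0..M}" using NM by auto
      then show ?thesis using phi_is[of m m n] by (simp add: p_def N_def M_def)
    qed
    then have p': "exps p \<subseteq> {0..N} \<times> {0..M}" "coef p (N, M) \<noteq> 0" "ip p p = 1"
      and top: "top_orthogonal N M p"
      by (auto simp: is_orthopoly_def top_orthogonal_def)
    have bs: "bs N M p"
      using perp_everything[OF H top] NM p' by (simp add: bs_def)
    have stable: "bidisk_stable (mon (N, M) * ladj p)"
      unfolding bidisk_stable_def
    proof (intro allI impI, elim conjE)
      fix z w :: complex assume zw: "norm z \<le> 1" "norm w \<le> 1"
      show "leval (mon (N, M) * ladj p) (z, w) \<noteq> 0"
        unfolding N_def M_def
      proof (rule reversal_no_zero[where ev = "\<lambda>f. leval f (z, w)" and z = z and w = w])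
        show "ciK (int n) (int m)" using H[of N M] by (simp add: N_def M_def)
        show "leval 1 (z, w) = 1" using leval_mon[of 0 "(z, w)"] by (simp add: pw_def)
      qed (use assms(1,2) p zw in \<open>auto simp: leval_add leval_cst leval_z N_def M_def\<close>)
    qed
    have nz: "leval p x \<noteq> 0" if x: "x \<in> bicircle" for x
    proof -
      have "leval (mon (N, M) * ladj p) x \<noteq> 0"
        using stable x by (auto simp: bidisk_stable_def bicircle_def)
      then show ?thesis using leval_reversal[OF x] by auto
    qed
    have \<mu>: "\<mu> = density bicircle_lebesgue (\<lambda>x. ennreal (1 / (norm (leval p x))\<^sup>2))"
      using density_of_moments[OF assms(3) nz] bs_norm[OF bs] assms(4) by simp
    moreover have "has_degree p n m"
      using p' by (simp add: has_degree_def N_def M_def)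
    moreover have "bidisk_stable (poly_reversal n m p)"
      using stable by (simp add: poly_reversal_def N_def M_def)
    moreover have "absolutely_continuous bicircle_lebesgue \<mu>"
    proof -
      have "(\<lambda>x. ennreal (1 / (norm (leval p x))\<^sup>2)) \<in> borel_measurable bicircle_lebesgue"
        using bicircle_measurable[OF bicircle_measure_lebesgue continuous_weight[OF nz]] by simp
      then show ?thesis by (subst \<mu>) (rule absolutely_continuousI_density)
    qed
    ultimately show ?density by blast
  }
qed

end
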